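(* Let $\Gamma_n$ be the banana graph with two vertices and $n$ parallel edges between them. The class $[X_{\Gamma_n}]$ in the Grothendieck ring satisfies the condition that it can be written as a polynomial $\sum_{k\ge 0}a_k\mathbb{T}^k$ in $\mathbb{T}$ with non-negative integer coefficients $a_k\ge 0$, while the class of the complement $[Y_{\Gamma_n}]=[\mathbb{P}^{n-1}\smallsetminus X_{\Gamma_n}]$ does not satisfy this condition.
   Context: For a connected finite graph $\Gamma$ with $n=\#E(\Gamma)$ edges, the Kirchhoff polynomial is $\Psi_\Gamma(t)=\sum_{T}\prod_{e\notin T}t_e$, where the sum is over the spanning trees $T$ of $\Gamma$ and $t_e$ is a variable attached to the edge $e$; $X_\Gamma\subset\mathbb{P}^{n-1}$ is the projective hypersurface $\{\Psi_\Gamma=0\}$, defined over $\mathbb{Z}$. For the banana graph, $\Psi_{\Gamma_n}=\sum_{i=1}^n\prod_{j\ne i}t_j$. Classes are taken in the Grothendieck ring $K_0(\mathcal{V}_{\mathbb{Z}})$ of quasi-projective varieties over $\mathbb{Z}$: it is generated by isomorphism classes $[X]$ modulo $[X]=[Y]+[X\smallsetminus Y]$ for $Y\subseteq X$ closed, with product $[X][Y]=[X\times Y]$. Here $\mathbb{L}=[\mathbb{A}^1]$ and $\mathbb{T}=[\mathbb{G}_m]=\mathbb{L}-1$.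
   Formalization: The claim that the class of the complement Y_{Γ_n} is not of the required form is stated only for n ≥ 4, since it fails for n = 1, 2, 3, where the class of Y_{Γ_n} is 1, 1+T and 1+2T+T²; the claim on X_{Γ_n} is stated for all n ≥ 1. *)

theory Defs
  imports
    "HOL-Analysis.Abstract_Topology"
    "HOL-Library.FuncSet"
    "HOL-Library.Poly_Mapping"
    "HOL-Algebra.QuotRing"
begin

section \<open>Kirchhoff polynomials of finite multigraphs\<close>

text \<open>Integer polynomials in the variables \<open>x\<^sub>0, x\<^sub>1, \<dots>\<close>: finitely supported maps from monomials
  (exponent vectors) to coefficients. Multiplication is convolution.\<close>

type_synonym zpoly = "(nat \<Rightarrow>\<^sub>0 nat) \<Rightarrow>\<^sub>0 int"

definition pvar :: "nat \<Rightarrow> zpoly" where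
  "pvar i = Poly_Mapping.single (Poly_Mapping.single i 1) 1"

text \<open>The edges of a multigraph are numbered \<open>0, \<dots>, nedges - 1\<close>, and \<open>ends\<close> gives the set of the
  two (or, for a loop, the one) end points of an edge.\<close>

record multigraph =
  verts :: "nat set"
  nedges :: nat
  ends :: "nat \<Rightarrow> nat set"

inductive walk :: "multigraph \<Rightarrow> nat set \<Rightarrow> nat \<Rightarrow> nat list \<Rightarrow> nat \<Rightarrow> bool"
  for \<Gamma> :: multigraph and F :: "nat set" where
  walk_Nil: "v \<in> verts \<Gamma> \<Longrightarrow> walk \<Gamma> F v [] v"
| walk_Cons: "e \<in> F \<Longrightarrow> ends \<Gamma> e = {u, v} \<Longrightarrow> walk \<Gamma> F v es w \<Longrightarrow> walk \<Gamma> F u (e # es) w"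

text \<open>A spanning tree is given by its edge set. Cycles are detected as nonempty closed walks without
  repeated edges, so that loops and pairs of parallel edges count as cycles.\<close>

definition spanning_trees :: "multigraph \<Rightarrow> nat set set" where
  "spanning_trees \<Gamma> = {T. T \<subseteq> {..<nedges \<Gamma>} \<and>
     (\<forall>u\<in>verts \<Gamma>. \<forall>v\<in>verts \<Gamma>. \<exists>es. walk \<Gamma> T u es v) \<and>
     \<not> (\<exists>v es. es \<noteq> [] \<and> distinct es \<and> walk \<Gamma> T v es v)}"

definition kirchhoff :: "multigraph \<Rightarrow> zpoly" where
  "kirchhoff \<Gamma> = (\<Sum>T\<in>spanning_trees \<Gamma>. \<Prod>e\<in>{..<nedges \<Gamma>} - T. pvar e)"

definition banana :: "nat \<Rightarrow> multigraph" where
  "banana n = \<lparr>verts = {0, 1}, nedges = n, ends = (\<lambda>_. {0, 1})\<rparr>"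


lemma walk_banana_empty: "walk (banana n) {} u es v \<Longrightarrow> u = v"
  by (erule walk.cases) auto

lemma spanning_trees_banana: "spanning_trees (banana n) = (\<lambda>i. {i}) ` {..<n}"
proof (intro equalityI subsetI)
  fix T assume T: "T \<in> spanning_trees (banana n)"
  then have sub: "T \<subseteq> {..<n}" and conn: "\<exists>es. walk (banana n) T 0 es 1"
    and acyc: "\<And>v es. es \<noteq> [] \<Longrightarrow> distinct es \<Longrightarrow> \<not> walk (banana n) T v es v"
    by (auto simp: spanning_trees_def banana_def)
  have "T \<noteq> {}"
    using conn walk_banana_empty by fastforce
  moreover have "e = f" if "e \<in> T" "f \<in> T" for e f
  proof (rule ccontr)
    assume "e \<noteq> f"
    have "walk (banana n) T 0 [e, f] 0"
      using that by (intro walk_Cons[where v = 1] walk_Cons[where v = 0, OF _ _ walk_Nil])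
        (auto simp: banana_def)
    then show False
      using acyc[of "[e, f]"] \<open>e \<noteq> f\<close> by auto
  qed
  ultimately obtain e where "T = {e}"
    by blast
  then show "T \<in> (\<lambda>i. {i}) ` {..<n}"
    using sub by auto
next
  fix T assume "T \<in> (\<lambda>i. {i}) ` {..<n}"
  then obtain i where i: "i < n" "T = {i}"
    by auto
  have "\<exists>es. walk (banana n) {i} u es v" if "u \<in> {0, 1}" "v \<in> {0, 1}" for u v
  proof (cases "u = v")
    case True
    then show ?thesis
      using that walk_Nil[of u "banana n"] by (auto simp: banana_def)
  next
    case False
    have "walk (banana n) {i} u [i] v"
      using that False by (intro walk_Cons[where v = v] walk_Nil) (auto simp: banana_def)
    then show ?thesis by blast
  qed
  moreover have "\<not> walk (banana n) {i} v es v" if "es \<noteq> []" "distinct es" for v es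
  proof
    assume "walk (banana n) {i} v es v"
    then show False
    proof cases
      case (walk_Cons e w es')
      have "es' = []"
        using \<open>walk (banana n) {i} w es' v\<close> walk_Cons that(2) by cases auto
      then have "w = v"
        using \<open>walk (banana n) {i} w es' v\<close> by (auto elim: walk.cases)
      then show False
        using walk_Cons by (auto simp: banana_def doubleton_eq_iff)
    qed (use that in auto)
  qed
  ultimately show "T \<in> spanning_trees (banana n)"
    using i by (auto simp: spanning_trees_def banana_def)
qed

lemma kirchhoff_banana: "kirchhoff (banana n) = (\<Sum>i<n. \<Prod>j\<in>{..<n} - {i}. pvar j)"
  unfolding kirchhoff_def spanning_trees_banana
  by (subst sum.reindex) (auto simp: banana_def)


section \<open>Projective space over the integers\<close>

definition zpoly_ring :: "nat \<Rightarrow> zpoly ring" where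
  "zpoly_ring N = \<lparr>carrier = {f. \<forall>m\<in>Poly_Mapping.keys f. Poly_Mapping.keys m \<subseteq> {..N}},
     monoid.mult = (*), one = 1, zero = 0, add = (+)\<rparr>"

definition mdeg :: "(nat \<Rightarrow>\<^sub>0 nat) \<Rightarrow> nat" where
  "mdeg m = (\<Sum>i\<in>Poly_Mapping.keys m. Poly_Mapping.lookup m i)"

definition homog :: "nat \<Rightarrow> nat \<Rightarrow> zpoly set" where
  "homog N d = {f \<in> carrier (zpoly_ring N). \<forall>m\<in>Poly_Mapping.keys f. mdeg m = d}"

definition hcomp :: "nat \<Rightarrow> zpoly \<Rightarrow> zpoly" where
  "hcomp d f = (\<Sum>m\<in>{m \<in> Poly_Mapping.keys f. mdeg m = d}.
     Poly_Mapping.single m (Poly_Mapping.lookup f m))"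

text \<open>The points of \<open>\<P>\<^sup>N\<close> over the integers, as \<open>Proj\<close>: homogeneous prime ideals
  of \<open>\<int>[x\<^sub>0, \<dots>, x\<^sub>N]\<close> which do not contain the irrelevant ideal.\<close>

definition proj_points :: "nat \<Rightarrow> zpoly set set" where
  "proj_points N = {p. primeideal p (zpoly_ring N) \<and> (\<forall>f\<in>p. \<forall>d. hcomp d f \<in> p) \<and>
     (\<exists>i\<le>N. pvar i \<notin> p)}"

definition basic_open :: "nat \<Rightarrow> zpoly \<Rightarrow> zpoly set set" where
  "basic_open N f = {p \<in> proj_points N. f \<notin> p}"

text \<open>The Zariski topology. Homogeneous \<open>f\<close> would suffice: a point is a homogeneous ideal, so
  \<open>basic_open N f\<close> is the union of the \<open>basic_open N (hcomp d f)\<close>.\<close>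

definition proj_top :: "nat \<Rightarrow> zpoly set topology" where
  "proj_top N = topology_generated_by {basic_open N f | f. f \<in> carrier (zpoly_ring N)}"

text \<open>The residue field at a point \<open>p\<close> consists of the degree zero homogeneous fractions \<open>f/g\<close>
  with \<open>g \<notin> p\<close> modulo \<open>p\<close>; \<open>hfrac N p f g\<close> is the class of \<open>f/g\<close>.\<close>

definition hfrac :: "nat \<Rightarrow> zpoly set \<Rightarrow> zpoly \<Rightarrow> zpoly \<Rightarrow> (zpoly \<times> zpoly) set" where
  "hfrac N p f g = {(f', g'). (\<exists>d. f' \<in> homog N d \<and> g' \<in> homog N d) \<and> g' \<notin> p \<and> f * g' - f' * g \<in> p}"

definition residue_field :: "nat \<Rightarrow> zpoly set \<Rightarrow> (zpoly \<times> zpoly) set ring" where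
  "residue_field N p = \<lparr>
     carrier = {hfrac N p f g | f g d. f \<in> homog N d \<and> g \<in> homog N d \<and> g \<notin> p},
     monoid.mult = (\<lambda>a b. \<Union>(f, g)\<in>a. \<Union>(f', g')\<in>b. hfrac N p (f * f') (g * g')),
     one = hfrac N p 1 1,
     zero = hfrac N p 0 1,
     add = (\<lambda>a b. \<Union>(f, g)\<in>a. \<Union>(f', g')\<in>b. hfrac N p (f * g' + f' * g) (g * g'))\<rparr>"


section \<open>Quasi-projective varieties over the integers\<close>

text \<open>A quasi-projective variety over the integers is a locally closed subset of some \<open>\<P>\<^sup>N\<close> with its
  reduced induced scheme structure. It need not be irreducible, nonempty, or flat over \<open>\<int>\<close>.\<close>

definition locally_closed_in :: "'a topology \<Rightarrow> 'a set \<Rightarrow> bool" where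
  "locally_closed_in T A \<longleftrightarrow> (\<exists>U C. openin T U \<and> closedin T C \<and> A = U \<inter> C)"

lemma topspace_proj_top: "topspace (proj_top N) = proj_points N"
proof -
  have "1 \<in> carrier (zpoly_ring N)"
    by (simp add: zpoly_ring_def)
  moreover have "1 \<notin> p" if "p \<in> proj_points N" for p
  proof
    assume "1 \<in> p"
    interpret primeideal p "zpoly_ring N"
      using that by (simp add: proj_points_def)
    show False
      using one_imp_carrier \<open>1 \<in> p\<close> I_notcarr by (simp add: zpoly_ring_def)
  qed
  ultimately have "basic_open N 1 = proj_points N" "basic_open N 1 \<in> {basic_open N f | f. f \<in> carrier (zpoly_ring N)}"
    by (auto simp: basic_open_def)
  then show ?thesis
    by (auto simp: proj_top_def basic_open_def)
qed

lemma openin_basic_open: "f \<in> carrier (zpoly_ring N) \<Longrightarrow> openin (proj_top N) (basic_open N f)"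
  unfolding proj_top_def by (rule topology_generated_by_Basis) auto

lemma basic_open_outside:
  assumes "f \<notin> carrier (zpoly_ring N)" shows "basic_open N f = proj_points N"
proof -
  have "p \<subseteq> carrier (zpoly_ring N)" if "p \<in> proj_points N" for p
  proof -
    interpret primeideal p "zpoly_ring N"
      using that by (simp add: proj_points_def)
    show ?thesis using a_subset by simp
  qed
  then show ?thesis
    using assms by (auto simp: basic_open_def)
qed

lemma openin_basic_open': "openin (proj_top N) (basic_open N f)"
  using openin_basic_open basic_open_outside openin_topspace topspace_proj_top by metis

typedef qp_variety = "{(N, A). locally_closed_in (proj_top N) A}"
  by (rule exI[of _ "(0, {})"]) (auto simp: locally_closed_in_def)

definition pdim :: "qp_variety \<Rightarrow> nat" where
  "pdim X = fst (Rep_qp_variety X)"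

definition pts :: "qp_variety \<Rightarrow> zpoly set set" where
  "pts X = snd (Rep_qp_variety X)"

definition vtop :: "qp_variety \<Rightarrow> zpoly set topology" where
  "vtop X = subtopology (proj_top (pdim X)) (pts X)"

definition basic_open_variety :: "nat \<Rightarrow> zpoly \<Rightarrow> qp_variety" where
  "basic_open_variety N f = Abs_qp_variety (N, basic_open N f)"

definition hypersurface :: "nat \<Rightarrow> zpoly \<Rightarrow> qp_variety" where
  "hypersurface N f = Abs_qp_variety (N, proj_points N - basic_open N f)"

lemma pdim_basic_open_variety: "pdim (basic_open_variety N f) = N"
  and pts_basic_open_variety: "pts (basic_open_variety N f) = basic_open N f"
proof -
  have "locally_closed_in (proj_top N) (basic_open N f)"
    unfolding locally_closed_in_def using openin_basic_open'[of N f]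
    by (metis closedin_topspace inf.absorb1 openin_subset)
  then show "pdim (basic_open_variety N f) = N" "pts (basic_open_variety N f) = basic_open N f"
    by (simp_all add: pdim_def pts_def basic_open_variety_def Abs_qp_variety_inverse)
qed

lemma pdim_hypersurface: "pdim (hypersurface N f) = N"
  and pts_hypersurface: "pts (hypersurface N f) = {p \<in> proj_points N. f \<in> p}"
proof -
  have "closedin (proj_top N) (proj_points N - basic_open N f)"
    using openin_basic_open'[of N f] by (metis closedin_diff closedin_topspace topspace_proj_top)
  then have "locally_closed_in (proj_top N) (proj_points N - basic_open N f)"
    unfolding locally_closed_in_def
    by (metis closedin_subset inf.absorb2 openin_topspace)
  then show "pdim (hypersurface N f) = N" "pts (hypersurface N f) = {p \<in> proj_points N. f \<in> p}"
    by (auto simp add: pdim_def pts_def hypersurface_def basic_open_def Abs_qp_variety_inverse)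
qed

text \<open>The structure sheaf, as in the classical construction of \<open>Proj\<close>: sections are families of values in
  the residue fields which are locally given by one homogeneous fraction. Functions on a reduced
  scheme are determined by their values in the residue fields.\<close>

definition struct_sheaf :: "qp_variety \<Rightarrow> zpoly set set \<Rightarrow> (zpoly set \<Rightarrow> (zpoly \<times> zpoly) set) ring" where
  "struct_sheaf X U = (let N = pdim X in \<lparr>
     carrier = {s \<in> extensional U. \<forall>p\<in>U. \<exists>V. openin (vtop X) V \<and> p \<in> V \<and> V \<subseteq> U \<and>
       (\<exists>d. \<exists>f\<in>homog N d. \<exists>g\<in>homog N d. \<forall>q\<in>V. g \<notin> q \<and> s q = hfrac N q f g)},
     monoid.mult = (\<lambda>s t. \<lambda>p\<in>U. s p \<otimes>\<^bsub>residue_field N p\<^esub> t p),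
     one = (\<lambda>p\<in>U. \<one>\<^bsub>residue_field N p\<^esub>),
     zero = (\<lambda>p\<in>U. \<zero>\<^bsub>residue_field N p\<^esub>),
     add = (\<lambda>s t. \<lambda>p\<in>U. s p \<oplus>\<^bsub>residue_field N p\<^esub> t p)\<rparr>)"

text \<open>Isomorphism of schemes, i.e. of ringed spaces (an isomorphism of ringed spaces between locally
  ringed spaces is automatically local on stalks).\<close>

definition isomorphic :: "qp_variety \<Rightarrow> qp_variety \<Rightarrow> bool" where
  "isomorphic X Y \<longleftrightarrow> (\<exists>\<phi> \<psi>. homeomorphic_map (vtop X) (vtop Y) \<phi> \<and>
     (\<forall>V. openin (vtop Y) V \<longrightarrow>
        \<psi> V \<in> ring_iso (struct_sheaf Y V) (struct_sheaf X {p \<in> pts X. \<phi> p \<in> V})) \<and>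
     (\<forall>V W. openin (vtop Y) V \<and> openin (vtop Y) W \<and> W \<subseteq> V \<longrightarrow>
        (\<forall>s\<in>carrier (struct_sheaf Y V).
           \<psi> W (restrict s W) = restrict (\<psi> V s) {p \<in> pts X. \<phi> p \<in> W})))"


section \<open>Products\<close>

definition subst_poly :: "(nat \<Rightarrow> zpoly) \<Rightarrow> zpoly \<Rightarrow> zpoly" where
  "subst_poly \<sigma> f = (\<Sum>m\<in>Poly_Mapping.keys f.
     of_int (Poly_Mapping.lookup f m) * (\<Prod>i\<in>Poly_Mapping.keys m. \<sigma> i ^ Poly_Mapping.lookup m i))"

text \<open>The product is formed in the Segre embedding of \<open>\<P>\<^sup>N \<times> \<P>\<^sup>M\<close>
  into \<open>\<P>\<close> of dimension \<open>(N + 1) * (M + 1) - 1\<close>, whose coordinates \<open>z\<^sub>i\<^sub>j = x\<^sub>i y\<^sub>j\<close> are numbered row by row.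
  On the Segre variety, the first projection is \<open>[z\<^sub>0\<^sub>j : \<dots> : z\<^sub>N\<^sub>j]\<close> for every \<open>j\<close> for which this is
  defined, whence the description of the two projections on prime ideals: for the other \<open>j\<close> all
  \<open>z\<^sub>i\<^sub>j\<close> lie in \<open>r\<close>, so only the constant term of \<open>f\<close> is tested there. The product of locally closed
  sets is locally closed, so it always exists as a variety.\<close>

definition segre_var :: "nat \<Rightarrow> nat \<Rightarrow> nat \<Rightarrow> zpoly" where
  "segre_var M i j = pvar (i * (M + 1) + j)"

definition segre_dim :: "nat \<Rightarrow> nat \<Rightarrow> nat" where
  "segre_dim N M = (N + 1) * (M + 1) - 1"

definition segre_points :: "nat \<Rightarrow> nat \<Rightarrow> zpoly set set" where
  "segre_points N M = {r \<in> proj_points (segre_dim N M).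
     \<forall>i\<le>N. \<forall>k\<le>N. \<forall>j\<le>M. \<forall>l\<le>M.
       segre_var M i j * segre_var M k l - segre_var M i l * segre_var M k j \<in> r}"

definition segre_fst :: "nat \<Rightarrow> nat \<Rightarrow> zpoly set \<Rightarrow> zpoly set" where
  "segre_fst N M r = {f \<in> carrier (zpoly_ring N). \<forall>j\<le>M. subst_poly (\<lambda>i. segre_var M i j) f \<in> r}"

definition segre_snd :: "nat \<Rightarrow> nat \<Rightarrow> zpoly set \<Rightarrow> zpoly set" where
  "segre_snd N M r = {f \<in> carrier (zpoly_ring M). \<forall>i\<le>N. subst_poly (\<lambda>j. segre_var M i j) f \<in> r}"

definition is_product :: "qp_variety \<Rightarrow> qp_variety \<Rightarrow> qp_variety \<Rightarrow> bool" where
  "is_product X Y Z \<longleftrightarrow> pdim Z = segre_dim (pdim X) (pdim Y) \<and>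
     pts Z = {r \<in> segre_points (pdim X) (pdim Y).
       segre_fst (pdim X) (pdim Y) r \<in> pts X \<and> segre_snd (pdim X) (pdim Y) r \<in> pts Y}"


section \<open>The Grothendieck ring\<close>

text \<open>The free commutative ring on all varieties, as the ring of integer polynomials with one
  variable \<open>gen X\<close> for each variety \<open>X\<close>.\<close>

type_synonym free_elem = "(qp_variety \<Rightarrow>\<^sub>0 nat) \<Rightarrow>\<^sub>0 int"

definition free_ring :: "free_elem ring" where
  "free_ring = \<lparr>carrier = UNIV, monoid.mult = (*), one = 1, zero = 0, add = (+)\<rparr>"

definition gen :: "qp_variety \<Rightarrow> free_elem" where
  "gen X = Poly_Mapping.single (Poly_Mapping.single X 1) 1"

text \<open>The last relation identifies the unit of the free ring with the class of \<open>\<P>\<^sup>0 = Spec \<int>\<close>, the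
  unit for the product of varieties.\<close>

inductive_set K0_relations :: "free_elem set" where
  rel_iso: "isomorphic X Y \<Longrightarrow> gen X - gen Y \<in> K0_relations"
| rel_scissor: "pdim Y = pdim X \<Longrightarrow> pdim Z = pdim X \<Longrightarrow> closedin (vtop X) (pts Y) \<Longrightarrow>
    pts Z = pts X - pts Y \<Longrightarrow> gen X - (gen Y + gen Z) \<in> K0_relations"
| rel_product: "is_product X Y Z \<Longrightarrow> gen X * gen Y - gen Z \<in> K0_relations"
| rel_point: "gen (basic_open_variety 0 1) - 1 \<in> K0_relations"

definition K0_ideal :: "free_elem set" where
  "K0_ideal = Idl\<^bsub>free_ring\<^esub> K0_relations"

definition K0 :: "free_elem set ring" where
  "K0 = free_ring Quot K0_ideal"

definition K0_class :: "qp_variety \<Rightarrow> free_elem set" where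
  "K0_class X = K0_ideal +>\<^bsub>free_ring\<^esub> gen X"

lemma cring_free_ring: "cring free_ring"
proof (rule cringI)
  show "abelian_group free_ring"
  proof (rule abelian_groupI)
    show "\<exists>y\<in>carrier free_ring. y \<oplus>\<^bsub>free_ring\<^esub> x = \<zero>\<^bsub>free_ring\<^esub>" for x
      by (auto simp: free_ring_def intro: exI[of _ "- x"])
  qed (auto simp: free_ring_def algebra_simps)
  show "comm_monoid free_ring"
    by (rule comm_monoidI) (auto simp: free_ring_def algebra_simps)
qed (auto simp: free_ring_def algebra_simps)

lemma ideal_K0_ideal: "ideal K0_ideal free_ring"
  unfolding K0_ideal_def
  by (rule ring.genideal_ideal) (use cring_free_ring in \<open>auto simp: cring_def free_ring_def\<close>)

lemma cring_K0: "cring K0"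
  unfolding K0_def by (rule ideal.quotient_is_cring[OF ideal_K0_ideal cring_free_ring])

lemma K0_class_closed: "K0_class X \<in> carrier K0"
  by (auto simp: K0_def K0_class_def FactRing_def A_RCOSETS_def' free_ring_def)

definition Gm :: qp_variety where
  "Gm = basic_open_variety 1 (pvar 0 * pvar 1)"

definition T_class :: "free_elem set" where
  "T_class = K0_class Gm"

definition effective_in_T :: "free_elem set \<Rightarrow> bool" where
  "effective_in_T c \<longleftrightarrow> (\<exists>(d::nat) (a::nat \<Rightarrow> nat).
     c = (\<Oplus>\<^bsub>K0\<^esub>k\<in>{..d}. [a k] \<cdot>\<^bsub>K0\<^esub> (T_class [^]\<^bsub>K0\<^esub> k)))"


section \<open>Graph hypersurfaces\<close>

definition graph_hypersurface :: "multigraph \<Rightarrow> qp_variety" where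
  "graph_hypersurface \<Gamma> = hypersurface (nedges \<Gamma> - 1) (kirchhoff \<Gamma>)"

definition graph_complement :: "multigraph \<Rightarrow> qp_variety" where
  "graph_complement \<Gamma> = basic_open_variety (nedges \<Gamma> - 1) (kirchhoff \<Gamma>)"

end

(* Proof idea. Cutting P^(n-1) along the coordinate hyperplanes reduces everything to tori. A stratum
   with k nonzero coordinates is G_m^(k-1), of class T^(k-1). On it Psi vanishes identically if at least
   two coordinates are zero, and nowhere if exactly one is. On the open torus the zero locus of Psi_(n+1)
   is a graph over the nonvanishing locus of Psi_n, so its class h_n satisfies h_(n+1) = T^(n-1) - h_n,
   i.e. h_n = T^(n-2) - T^(n-3) + ... . In [X] the binomial coefficients counting strata absorb the
   signs; in [Y] = T^(n-1) - h_n + n T^(n-2) the coefficient -1 of T^(n-4) survives. That no other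
   expression of [Y] in T has nonnegative coefficients follows by counting points over F_q for all
   primes q: this is a ring homomorphism sending T to q - 1, so it determines polynomials in T. For it to
   be well defined, rationality of a point is expressed through the structure sheaf. *)

theory Submission
  imports Defs "HOL-Number_Theory.Cong" "HOL-Computational_Algebra.Polynomial"
begin


section \<open>Evaluation of polynomials\<close>

text \<open>Explicit isomorphisms are pairs of tuples of forms \<open>F\<close> and
  \<open>G\<close>, inverse to each other up to a common factor at every point; substitution then
  yields the homeomorphism and the maps of sections at once. Products exist only in Segre
  coordinates, so a torus is never formed as a power: one coordinate at a time is split off as a
  factor G_m. Point counting meets the opposite situation. A proof of \<open>isomorphic\<close>
  provides a homeomorphism and compatible ring isomorphisms, but no polynomials and no map of
  residue fields. Vanishing of a section at a point therefore has to be phrased through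
  invertibility on neighbourhoods; only in this form is it visibly invariant, and with it the
  property of having residue field F_q.\<close>

abbreviation polys :: "nat \<Rightarrow> zpoly set" where "polys N \<equiv> carrier (zpoly_ring N)"

text \<open>The index type and the target ring stay arbitrary because evaluation has several roles:
  substitution of polynomials into polynomials, values at coordinates in \<open>int\<close> or
  \<open>int poly\<close>, and the point count on \<open>free_elem\<close>, where the variables are
  varieties.\<close>

definition meval :: "('a \<Rightarrow> 'b::comm_ring_1) \<Rightarrow> ('a \<Rightarrow>\<^sub>0 nat) \<Rightarrow> 'b" where
  "meval \<sigma> m = (\<Prod>i\<in>Poly_Mapping.keys m. \<sigma> i ^ Poly_Mapping.lookup m i)"

definition peval :: "('a \<Rightarrow> 'b::comm_ring_1) \<Rightarrow> (('a \<Rightarrow>\<^sub>0 nat) \<Rightarrow>\<^sub>0 int) \<Rightarrow> 'b" where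
  "peval \<sigma> f = (\<Sum>m\<in>Poly_Mapping.keys f. of_int (Poly_Mapping.lookup f m) * meval \<sigma> m)"

lemma subst_poly_eq_peval: "subst_poly \<sigma> f = peval \<sigma> f"
  by (simp add: subst_poly_def peval_def meval_def)

lemma meval_superset:
  assumes "finite A" "Poly_Mapping.keys m \<subseteq> A"
  shows "meval \<sigma> m = (\<Prod>i\<in>A. \<sigma> i ^ Poly_Mapping.lookup m i)"
  unfolding meval_def by (rule prod.mono_neutral_left) (use assms in \<open>auto simp: in_keys_iff\<close>)

lemma meval_0 [simp]: "meval \<sigma> 0 = 1"
  by (simp add: meval_def)

lemma meval_add: "meval \<sigma> (m + m') = meval \<sigma> m * meval \<sigma> m'"
proof -
  let ?A = "Poly_Mapping.keys m \<union> Poly_Mapping.keys m'"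
  have "meval \<sigma> (m + m') = (\<Prod>i\<in>?A. \<sigma> i ^ Poly_Mapping.lookup (m + m') i)"
    by (rule meval_superset) (simp_all add: Poly_Mapping.keys_add)
  also have "\<dots> = (\<Prod>i\<in>?A. \<sigma> i ^ Poly_Mapping.lookup m i) * (\<Prod>i\<in>?A. \<sigma> i ^ Poly_Mapping.lookup m' i)"
    by (simp add: lookup_add power_add prod.distrib)
  also have "\<dots> = meval \<sigma> m * meval \<sigma> m'"
    by (simp add: meval_superset[of ?A m] meval_superset[of ?A m'])
  finally show ?thesis .
qed

lemma meval_cong: "(\<And>i. i \<in> Poly_Mapping.keys m \<Longrightarrow> \<sigma> i = \<tau> i) \<Longrightarrow> meval \<sigma> m = meval \<tau> m"
  by (simp add: meval_def)

lemma meval_times: "meval (\<lambda>i. \<sigma> i * \<tau> i) m = meval \<sigma> m * meval \<tau> m"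
  by (simp add: meval_def power_mult_distrib prod.distrib)

lemma meval_const: "meval (\<lambda>_. c) m = c ^ mdeg m"
  by (simp add: meval_def mdeg_def power_sum)

lemma peval_0 [simp]: "peval \<sigma> 0 = 0"
  by (simp add: peval_def)

lemma peval_add [simp]: "peval \<sigma> (f + g) = peval \<sigma> f + peval \<sigma> g"
  unfolding peval_def by (rule setsum_keys_plus_distrib) (simp_all add: algebra_simps)

lemma peval_uminus [simp]: "peval \<sigma> (- f) = - peval \<sigma> f"
  using peval_add[of \<sigma> f "- f"] by (simp add: eq_neg_iff_add_eq_0 add.commute)

lemma peval_diff [simp]: "peval \<sigma> (f - g) = peval \<sigma> f - peval \<sigma> g"
  using peval_add[of \<sigma> f "- g"] by simp

lemma peval_single: "peval \<sigma> (Poly_Mapping.single m c) = of_int c * meval \<sigma> m"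
  by (simp add: peval_def)

lemma peval_sum [simp]: "peval \<sigma> (sum f A) = (\<Sum>x\<in>A. peval \<sigma> (f x))"
  by (induction A rule: infinite_finite_induct) auto

lemma poly_mapping_sum_single:
  fixes f :: "'a \<Rightarrow>\<^sub>0 'b::comm_monoid_add"
  shows "f = (\<Sum>m\<in>Poly_Mapping.keys f. Poly_Mapping.single m (Poly_Mapping.lookup f m))"
  by (rule poly_mapping_eqI) (auto simp: lookup_sum lookup_single when_def in_keys_iff)

lemma poly_mapping_add_induct:
  fixes f :: "'a \<Rightarrow>\<^sub>0 'b::comm_monoid_add"
  assumes "P 0" "\<And>m c. P (Poly_Mapping.single m c)" "\<And>f g. P f \<Longrightarrow> P g \<Longrightarrow> P (f + g)"
  shows "P f"
proof -
  have "P (\<Sum>m\<in>A. Poly_Mapping.single m (Poly_Mapping.lookup f m))" if "finite A" for A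
    using that by (induction A) (use assms in auto)
  then show ?thesis
    by (subst poly_mapping_sum_single) simp
qed

lemma peval_mult [simp]: "peval \<sigma> (f * g) = peval \<sigma> f * peval \<sigma> g"
proof (induction f rule: poly_mapping_add_induct)
  case (2 m c)
  show ?case
    by (induction g rule: poly_mapping_add_induct)
      (simp_all add: mult_single peval_single meval_add algebra_simps)
qed (simp_all add: algebra_simps)

lemma single_0_int: "Poly_Mapping.single 0 c = (of_int c :: ('a \<Rightarrow>\<^sub>0 nat) \<Rightarrow>\<^sub>0 int)"
  by (metis single_of_int of_int_eq_id id_apply)

lemma peval_of_int [simp]: "peval \<sigma> (of_int c) = of_int c"
  using peval_single[of \<sigma> 0 c] by (simp add: single_0_int)

lemma peval_1 [simp]: "peval \<sigma> 1 = 1"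
  using peval_of_int[of \<sigma> 1] by simp

lemma peval_of_nat [simp]: "peval \<sigma> (of_nat c) = of_nat c"
  using peval_of_int[of \<sigma> "int c"] by simp

lemma peval_power [simp]: "peval \<sigma> (f ^ k) = peval \<sigma> f ^ k"
  by (induction k) auto

lemma peval_prod [simp]: "peval \<sigma> (prod f A) = (\<Prod>x\<in>A. peval \<sigma> (f x))"
  by (induction A rule: infinite_finite_induct) auto

lemma peval_pvar [simp]: "peval \<sigma> (pvar i) = \<sigma> i"
  by (simp add: pvar_def peval_single meval_def)

lemma peval_gen [simp]: "peval \<sigma> (gen X) = \<sigma> X"
  by (simp add: gen_def peval_single meval_def)

lemma peval_pvar_self: "peval pvar f = f"
proof (induction f rule: poly_mapping_add_induct)
  case (2 m c)
  have "meval pvar m = Poly_Mapping.single m 1"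
  proof (induction m rule: poly_mapping_add_induct)
    case (2 i k)
    have "pvar i ^ k = Poly_Mapping.single (Poly_Mapping.single i k) 1"
      by (induction k) (simp_all add: pvar_def mult_single single_add[symmetric])
    then show ?case by (cases "k = 0") (simp_all add: meval_def)
  qed (simp_all add: meval_add mult_single)
  then show ?case
    by (simp add: peval_single single_0_int[symmetric] mult_single)
qed simp_all

lemma peval_cong:
  "(\<And>m i. m \<in> Poly_Mapping.keys f \<Longrightarrow> i \<in> Poly_Mapping.keys m \<Longrightarrow> \<sigma> i = \<tau> i) \<Longrightarrow> peval \<sigma> f = peval \<tau> f"
  unfolding peval_def by (intro sum.cong refl arg_cong2[of _ _ _ _ "(*)"] meval_cong) auto

lemma peval_cong_polys: "f \<in> polys N \<Longrightarrow> (\<And>i. i \<le> N \<Longrightarrow> \<sigma> i = \<tau> i) \<Longrightarrow> peval \<sigma> f = peval \<tau> f"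
  by (rule peval_cong) (auto simp: zpoly_ring_def)

lemma peval_peval: "peval \<tau> (peval \<sigma> f) = peval (\<lambda>i. peval \<tau> (\<sigma> i)) f"
proof -
  have "peval \<tau> (meval \<sigma> m) = meval (\<lambda>i. peval \<tau> (\<sigma> i)) m" for m
    by (simp add: meval_def)
  then show ?thesis
    unfolding peval_def[of \<sigma>] by (simp add: peval_def[of _ f])
qed


section \<open>Homogeneous polynomials\<close>

lemma mdeg_0 [simp]: "mdeg 0 = 0"
  by (simp add: mdeg_def)

lemma mdeg_add: "mdeg (m + m') = mdeg m + mdeg m'"
  unfolding mdeg_def by (rule setsum_keys_plus_distrib) simp_all

lemma polys_iff: "f \<in> polys N \<longleftrightarrow> (\<forall>m\<in>Poly_Mapping.keys f. Poly_Mapping.keys m \<subseteq> {..N})"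
  by (simp add: zpoly_ring_def)

lemma homog_iff: "f \<in> homog N d \<longleftrightarrow> (\<forall>m\<in>Poly_Mapping.keys f. Poly_Mapping.keys m \<subseteq> {..N} \<and> mdeg m = d)"
  by (auto simp: homog_def polys_iff)

lemma homog_polys [intro]: "f \<in> homog N d \<Longrightarrow> f \<in> polys N"
  by (simp add: homog_def)

lemma homog_0 [simp]: "0 \<in> homog N d" and polys_0 [simp]: "0 \<in> polys N"
  by (auto simp: homog_iff polys_iff)

lemma homog_add [intro]: "f \<in> homog N d \<Longrightarrow> g \<in> homog N d \<Longrightarrow> f + g \<in> homog N d"
  unfolding homog_iff using Poly_Mapping.keys_add[of f g] by blast

lemma polys_add [intro]: "f \<in> polys N \<Longrightarrow> g \<in> polys N \<Longrightarrow> f + g \<in> polys N"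
  unfolding polys_iff using Poly_Mapping.keys_add[of f g] by blast

lemma homog_uminus [intro]: "f \<in> homog N d \<Longrightarrow> - f \<in> homog N d"
  by (simp add: homog_iff)

lemma polys_uminus [intro]: "f \<in> polys N \<Longrightarrow> - f \<in> polys N"
  by (simp add: polys_iff)

lemma homog_diff [intro]: "f \<in> homog N d \<Longrightarrow> g \<in> homog N d \<Longrightarrow> f - g \<in> homog N d"
  using homog_add[of f N d "- g"] by auto

lemma polys_diff [intro]: "f \<in> polys N \<Longrightarrow> g \<in> polys N \<Longrightarrow> f - g \<in> polys N"
  using polys_add[of f N "- g"] by auto

lemma homog_mult [intro]:
  assumes "f \<in> homog N d" "g \<in> homog N e" shows "f * g \<in> homog N (d + e)"
  unfolding homog_iff
proof
  fix m assume "m \<in> Poly_Mapping.keys (f * g)"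
  then obtain a b where ab: "m = a + b" "a \<in> Poly_Mapping.keys f" "b \<in> Poly_Mapping.keys g"
    using Poly_Mapping.keys_mult[of f g] by blast
  then show "Poly_Mapping.keys m \<subseteq> {..N} \<and> mdeg m = d + e"
    using assms Poly_Mapping.keys_add[of a b] unfolding homog_iff by (fastforce simp: mdeg_add)
qed

lemma polys_mult [intro]:
  assumes "f \<in> polys N" "g \<in> polys N" shows "f * g \<in> polys N"
  unfolding polys_iff
proof
  fix m assume "m \<in> Poly_Mapping.keys (f * g)"
  then obtain a b where ab: "m = a + b" "a \<in> Poly_Mapping.keys f" "b \<in> Poly_Mapping.keys g"
    using Poly_Mapping.keys_mult[of f g] by blast
  then show "Poly_Mapping.keys m \<subseteq> {..N}"
    using assms Poly_Mapping.keys_add[of a b] unfolding polys_iff by fastforce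
qed

lemma homog_of_int [intro, simp]: "of_int c \<in> homog N 0"
proof -
  have "Poly_Mapping.single 0 c \<in> homog N 0"
    by (simp add: homog_iff)
  then show ?thesis
    by (simp add: single_0_int)
qed

lemma homog_1 [intro, simp]: "1 \<in> homog N 0"
  using homog_of_int[of 1] by simp

lemma homog_of_nat [intro, simp]: "of_nat c \<in> homog N 0"
  using homog_of_int[of "int c"] by simp

lemma polys_1 [intro, simp]: "1 \<in> polys N" and polys_of_nat [intro, simp]: "of_nat c \<in> polys N"
  and polys_of_int [intro, simp]: "of_int i \<in> polys N"
  by (blast intro: homog_1 homog_of_nat homog_of_int)+

lemma homog_of_int_mult [intro]: "f \<in> homog N d \<Longrightarrow> of_int c * f \<in> homog N d"
  using homog_mult[OF homog_of_int, of f N d c] by simp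

lemma homog_of_nat_mult [intro]: "f \<in> homog N d \<Longrightarrow> of_nat c * f \<in> homog N d"
  using homog_mult[OF homog_of_nat, of f N d c] by simp

lemma homog_pvar [intro]: "i \<le> N \<Longrightarrow> pvar i \<in> homog N 1"
  by (simp add: homog_iff pvar_def mdeg_def)

lemma polys_pvar [intro]: "i \<le> N \<Longrightarrow> pvar i \<in> polys N"
  by (blast intro: homog_pvar)

lemma homog_power [intro]: "f \<in> homog N d \<Longrightarrow> f ^ k \<in> homog N (d * k)"
proof (induction k)
  case (Suc k)
  then show ?case using homog_mult[of f N d "f ^ k" "d * k"] by simp
qed simp

lemma homog_sum [intro]: "(\<And>x. x \<in> A \<Longrightarrow> f x \<in> homog N d) \<Longrightarrow> sum f A \<in> homog N d"
  by (induction A rule: infinite_finite_induct) auto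

lemma polys_sum [intro]: "(\<And>x. x \<in> A \<Longrightarrow> f x \<in> polys N) \<Longrightarrow> sum f A \<in> polys N"
  by (induction A rule: infinite_finite_induct) auto

lemma homog_prod: "(\<And>x. x \<in> A \<Longrightarrow> f x \<in> homog N (e x)) \<Longrightarrow> prod f A \<in> homog N (sum e A)"
  by (induction A rule: infinite_finite_induct) auto

lemma homog_prod_const: "(\<And>x. x \<in> A \<Longrightarrow> f x \<in> homog N 1) \<Longrightarrow> prod f A \<in> homog N (card A)"
  using homog_prod[of A f N "\<lambda>_. 1"] by simp

lemma polys_prod [intro]: "(\<And>x. x \<in> A \<Longrightarrow> f x \<in> polys N) \<Longrightarrow> prod f A \<in> polys N"
  by (induction A rule: infinite_finite_induct) auto

lemma polys_power [intro]: "f \<in> polys N \<Longrightarrow> f ^ k \<in> polys N"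
  by (induction k) auto

lemma peval_homog:
  assumes f: "f \<in> homog N d" and \<sigma>: "\<And>i. i \<le> N \<Longrightarrow> \<sigma> i \<in> homog M e"
  shows "peval \<sigma> f \<in> homog M (d * e)"
  unfolding peval_def
proof (intro homog_sum homog_of_int_mult)
  fix m assume "m \<in> Poly_Mapping.keys f"
  then have m: "Poly_Mapping.keys m \<subseteq> {..N}" "mdeg m = d"
    using f by (auto simp: homog_iff)
  have "meval \<sigma> m \<in> homog M (\<Sum>i\<in>Poly_Mapping.keys m. e * Poly_Mapping.lookup m i)"
    unfolding meval_def by (rule homog_prod) (use m \<sigma> in blast)
  also have "(\<Sum>i\<in>Poly_Mapping.keys m. e * Poly_Mapping.lookup m i) = d * e"
    using m by (simp add: mdeg_def sum_distrib_left[symmetric] mult.commute)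
  finally show "meval \<sigma> m \<in> homog M (d * e)" .
qed

lemma lookup_hcomp: "Poly_Mapping.lookup (hcomp d f) m = (if mdeg m = d then Poly_Mapping.lookup f m else 0)"
  by (auto simp: hcomp_def lookup_sum lookup_single when_def in_keys_iff)

lemma keys_hcomp: "Poly_Mapping.keys (hcomp d f) = {m \<in> Poly_Mapping.keys f. mdeg m = d}"
  by (auto simp: in_keys_iff lookup_hcomp split: if_splits)

lemma hcomp_homog [intro]: "f \<in> polys N \<Longrightarrow> hcomp d f \<in> homog N d"
  by (auto simp: polys_iff homog_iff keys_hcomp)

lemma hcomp_add: "hcomp d (f + g) = hcomp d f + hcomp d g"
  by (rule poly_mapping_eqI) (simp add: lookup_hcomp lookup_add)

lemma hcomp_0 [simp]: "hcomp d 0 = 0"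
  by (rule poly_mapping_eqI) (simp add: lookup_hcomp)

lemma hcomp_sum: "hcomp d (sum f A) = (\<Sum>x\<in>A. hcomp d (f x))"
  by (induction A rule: infinite_finite_induct) (auto simp: hcomp_add)

lemma hcomp_of_homog: "f \<in> homog N e \<Longrightarrow> hcomp d f = (if d = e then f else 0)"
  by (rule poly_mapping_eqI) (auto simp: lookup_hcomp homog_iff in_keys_iff)

lemma sum_hcomp: "(\<Sum>d\<in>mdeg ` Poly_Mapping.keys f. hcomp d f) = f"
  by (rule poly_mapping_eqI) (auto simp: lookup_sum lookup_hcomp in_keys_iff)

lemma peval_polys:
  assumes f: "f \<in> polys N" and \<sigma>: "\<And>i. i \<le> N \<Longrightarrow> \<sigma> i \<in> homog M e"
  shows "peval \<sigma> f \<in> polys M"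
proof -
  have "peval \<sigma> f = (\<Sum>d\<in>mdeg ` Poly_Mapping.keys f. peval \<sigma> (hcomp d f))"
    by (subst (1) sum_hcomp[symmetric]) simp
  also have "\<dots> \<in> polys M"
    using f \<sigma> by (intro polys_sum) (metis homog_polys peval_homog hcomp_homog)
  finally show ?thesis .
qed

text \<open>Substituting forms of degree \<open>e\<close> multiplies degrees by \<open>e\<close>, so
  only multiples of \<open>e\<close> occur. For \<open>e = 0\<close> all degrees would collapse to 0
  and the components could not be recovered.\<close>

lemma hcomp_peval:
  assumes f: "f \<in> polys N" and \<sigma>: "\<And>i. i \<le> N \<Longrightarrow> \<sigma> i \<in> homog M e" and e: "e \<ge> 1"
  shows "hcomp k (peval \<sigma> f) = (if e dvd k then peval \<sigma> (hcomp (k div e) f) else 0)"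
proof -
  let ?D = "mdeg ` Poly_Mapping.keys f"
  have hom: "peval \<sigma> (hcomp d f) \<in> homog M (d * e)" for d
    using f \<sigma> by (intro peval_homog[of _ N]) auto
  have out: "hcomp d f = 0" if "d \<notin> ?D" for d
    using that by (intro poly_mapping_eqI) (auto simp: lookup_hcomp in_keys_iff)
  have "peval \<sigma> f = (\<Sum>d\<in>?D. peval \<sigma> (hcomp d f))"
    by (subst (1) sum_hcomp[symmetric]) simp
  then have "hcomp k (peval \<sigma> f) = (\<Sum>d\<in>?D. hcomp k (peval \<sigma> (hcomp d f)))"
    by (simp add: hcomp_sum)
  also have "\<dots> = (\<Sum>d\<in>?D. if k = d * e then peval \<sigma> (hcomp d f) else 0)"
    by (intro sum.cong refl) (rule hcomp_of_homog[OF hom])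
  also have "\<dots> = (if e dvd k then peval \<sigma> (hcomp (k div e) f) else 0)"
  proof (cases "e dvd k")
    case True
    then obtain l where l: "k = l * e" by (metis dvdE mult.commute)
    have "(\<Sum>d\<in>?D. if k = d * e then peval \<sigma> (hcomp d f) else 0) = (\<Sum>d\<in>?D. if d = l then peval \<sigma> (hcomp d f) else 0)"
      using l e by (intro sum.cong) auto
    also have "\<dots> = peval \<sigma> (hcomp l f)"
      using out[of l] by (simp add: sum.delta')
    finally show ?thesis using l e by simp
  next
    case False
    then have "k \<noteq> d * e" for d by auto
    then show ?thesis using False by simp
  qed
  finally show ?thesis .
qed

lemma peval_scale:
  assumes f: "f \<in> homog N d"
  shows "peval (\<lambda>i. h * \<sigma> i) f = h ^ d * peval \<sigma> f"
  using f by (auto simp: peval_def meval_times meval_const homog_iff sum_distrib_left mult_ac intro!: sum.cong)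


section \<open>Points of projective space\<close>

lemma zpoly_ring_ops [simp]:
  "x \<otimes>\<^bsub>zpoly_ring N\<^esub> y = x * y" "x \<oplus>\<^bsub>zpoly_ring N\<^esub> y = x + y"
  "\<zero>\<^bsub>zpoly_ring N\<^esub> = 0" "\<one>\<^bsub>zpoly_ring N\<^esub> = 1"
  by (simp_all add: zpoly_ring_def)

lemma cring_zpoly_ring: "cring (zpoly_ring N)"
proof (rule cringI)
  show "abelian_group (zpoly_ring N)"
  proof (rule abelian_groupI)
    show "\<exists>y\<in>polys N. y \<oplus>\<^bsub>zpoly_ring N\<^esub> x = \<zero>\<^bsub>zpoly_ring N\<^esub>" if "x \<in> polys N" for x
      using that by (intro bexI[of _ "- x"] polys_uminus) simp_all
  qed (simp_all add: polys_add algebra_simps)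
  show "comm_monoid (zpoly_ring N)"
    by (rule comm_monoidI) (simp_all add: polys_mult algebra_simps)
qed (simp add: algebra_simps)

lemma a_inv_zpoly_ring:
  assumes "x \<in> polys N" shows "\<ominus>\<^bsub>zpoly_ring N\<^esub> x = - x"
proof -
  interpret cring "zpoly_ring N" by (rule cring_zpoly_ring)
  show ?thesis
    using minus_equality[of "- x" x] assms polys_uminus[OF assms] by simp
qed

locale point =
  fixes N :: nat and p :: "zpoly set"
  assumes p: "p \<in> proj_points N"
begin

sublocale P: primeideal p "zpoly_ring N"
  using p by (simp add: proj_points_def)

text \<open>As simp rules these would turn every goal \<open>f \<in> polys N\<close> into a search
  for \<open>f \<in> p\<close>.\<close>

declare P.a_Hcarr [simp del] P.Icarr [simp del]

lemma sub: "f \<in> p \<Longrightarrow> f \<in> polys N"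
  using P.a_subset by auto

lemma zero [simp]: "0 \<in> p"
  using additive_subgroup.zero_closed[OF P.is_additive_subgroup] by simp

lemma add: "f \<in> p \<Longrightarrow> g \<in> p \<Longrightarrow> f + g \<in> p"
  using additive_subgroup.a_closed[OF P.is_additive_subgroup, of f g] by simp

lemma mult: "f \<in> polys N \<Longrightarrow> g \<in> p \<Longrightarrow> f * g \<in> p"
  using P.I_l_closed[of g f] by simp

lemma mult': "f \<in> p \<Longrightarrow> g \<in> polys N \<Longrightarrow> f * g \<in> p"
  using mult[of g f] by (simp add: mult.commute)

lemma uminus: "f \<in> p \<Longrightarrow> - f \<in> p"
  using mult[of "-1" f] polys_uminus[OF polys_1] by simp

lemma diff: "f \<in> p \<Longrightarrow> g \<in> p \<Longrightarrow> f - g \<in> p"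
  using add[of f "- g"] uminus by simp

lemma sum: "(\<And>x. x \<in> A \<Longrightarrow> f x \<in> p) \<Longrightarrow> sum f A \<in> p"
  by (induction A rule: infinite_finite_induct) (auto intro: add)

lemma one: "1 \<notin> p"
proof
  assume "1 \<in> p"
  then have "p = polys N"
    using P.one_imp_carrier by simp
  then show False using P.I_notcarr by simp
qed

lemma mult_iff: "f \<in> polys N \<Longrightarrow> g \<in> polys N \<Longrightarrow> f * g \<in> p \<longleftrightarrow> f \<in> p \<or> g \<in> p"
  using P.I_prime[of f g] mult mult' by auto

lemma power_iff: "f \<in> polys N \<Longrightarrow> f ^ k \<in> p \<longleftrightarrow> f \<in> p \<and> k > 0"
proof (induction k)
  case (Suc k)
  have "f ^ k \<in> polys N"
    using Suc.prems by (rule polys_power)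
  then show ?case using Suc mult_iff by auto
qed (use one in simp)

lemma prod_iff: "finite A \<Longrightarrow> (\<And>x. x \<in> A \<Longrightarrow> f x \<in> polys N) \<Longrightarrow> prod f A \<in> p \<longleftrightarrow> (\<exists>x\<in>A. f x \<in> p)"
proof (induction A rule: finite_induct)
  case (insert x A)
  have "prod f A \<in> polys N"
    using insert by (intro polys_prod) auto
  then show ?case
    using insert mult_iff by auto
qed (use one in simp)

lemma hcomp: "f \<in> p \<Longrightarrow> hcomp d f \<in> p"
  using p by (simp add: proj_points_def)

lemma ex_pvar: "\<exists>i\<le>N. pvar i \<notin> p"
  using p by (simp add: proj_points_def)

lemma mem_iff_hcomp: "f \<in> p \<longleftrightarrow> (\<forall>d. hcomp d f \<in> p)"
proof
  assume "\<forall>d. hcomp d f \<in> p"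
  then have "(\<Sum>d\<in>mdeg ` Poly_Mapping.keys f. hcomp d f) \<in> p"
    by (intro sum) auto
  then show "f \<in> p" by (simp add: sum_hcomp)
qed (simp add: hcomp)

lemma diff_mem_iff: "f - g \<in> p \<Longrightarrow> f \<in> p \<longleftrightarrow> g \<in> p"
  using add[of "f - g" g] diff[of f "f - g"] by auto

end

lemma proj_pointsI:
  assumes sub: "p \<subseteq> polys N" and zero: "0 \<in> p"
    and add: "\<And>f g. f \<in> p \<Longrightarrow> g \<in> p \<Longrightarrow> f + g \<in> p"
    and mult: "\<And>f g. f \<in> p \<Longrightarrow> g \<in> polys N \<Longrightarrow> f * g \<in> p"
    and prime: "\<And>f g. f \<in> polys N \<Longrightarrow> g \<in> polys N \<Longrightarrow> f * g \<in> p \<Longrightarrow> f \<in> p \<or> g \<in> p"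
    and hcomp: "\<And>f d. f \<in> p \<Longrightarrow> hcomp d f \<in> p"
    and ex: "i \<le> N" "pvar i \<notin> p"
  shows "p \<in> proj_points N"
proof -
  interpret R: cring "zpoly_ring N" by (rule cring_zpoly_ring)
  have um: "- f \<in> p" if "f \<in> p" for f
    using mult[OF that, of "-1"] polys_uminus[OF polys_1] by simp
  have "ideal p (zpoly_ring N)"
  proof (rule idealI)
    show "subgroup p (add_monoid (zpoly_ring N))"
    proof (rule subgroup.intro)
      fix x assume "x \<in> p"
      then have "\<ominus>\<^bsub>zpoly_ring N\<^esub> x = - x"
        using sub a_inv_zpoly_ring by blast
      then show "inv\<^bsub>add_monoid (zpoly_ring N)\<^esub> x \<in> p"
        using um \<open>x \<in> p\<close> by (simp add: a_inv_def)
    qed (use sub zero add in auto)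
  qed (use mult R.ring_axioms in \<open>auto simp: mult.commute\<close>)
  moreover have "polys N \<noteq> p"
    using ex by auto
  ultimately have "primeideal p (zpoly_ring N)"
    by (intro primeidealI R.cring_axioms) (use prime in auto)
  then show ?thesis
    using hcomp ex by (auto simp: proj_points_def)
qed

text \<open>Points are homogeneous ideals: a polynomial lies in one exactly when all its homogeneous
  components do. This confines later comparisons of points to forms.\<close>

lemma point_eqI:
  assumes "p \<in> proj_points N" "q \<in> proj_points N"
    and "\<And>f d. f \<in> homog N d \<Longrightarrow> f \<in> p \<longleftrightarrow> f \<in> q"
  shows "p = q"
proof -
  interpret p: point N p by unfold_locales fact
  interpret q: point N q by unfold_locales fact
  have "f \<in> p \<longleftrightarrow> f \<in> q" if "f \<in> polys N" for f
    using p.mem_iff_hcomp[of f] q.mem_iff_hcomp[of f] assms(3) hcomp_homog[OF that] by blast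
  then show ?thesis using p.sub q.sub by blast
qed

section \<open>Congruence modulo a point\<close>

context point
begin

text \<open>Membership in \<open>polys N\<close> is part of the relation because a point is an ideal
  of \<open>zpoly_ring N\<close> only; it does not absorb polynomials in the further variables of
  the type \<open>zpoly\<close>.\<close>

definition cong :: "zpoly \<Rightarrow> zpoly \<Rightarrow> bool" where
  "cong f g \<longleftrightarrow> f \<in> polys N \<and> g \<in> polys N \<and> f - g \<in> p"

lemma congI: "f \<in> polys N \<Longrightarrow> g \<in> polys N \<Longrightarrow> f - g \<in> p \<Longrightarrow> cong f g"
  by (simp add: cong_def)

lemma cong_refl: "f \<in> polys N \<Longrightarrow> cong f f"
  by (simp add: cong_def)

lemma cong_sym: "cong f g \<Longrightarrow> cong g f"
  using uminus[of "f - g"] by (auto simp: cong_def)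

lemma cong_add: "cong f g \<Longrightarrow> cong f' g' \<Longrightarrow> cong (f + f') (g + g')"
  using add[of "f - g" "f' - g'"] by (auto simp: cong_def algebra_simps)

lemma cong_diff: "cong f g \<Longrightarrow> cong f' g' \<Longrightarrow> cong (f - f') (g - g')"
  using diff[of "f - g" "f' - g'"] by (auto simp: cong_def algebra_simps)

lemma cong_mult:
  assumes "cong f g" "cong f' g'" shows "cong (f * f') (g * g')"
proof -
  have "f * (f' - g') + (f - g) * g' \<in> p"
    using assms by (intro add mult mult') (auto simp: cong_def)
  then show ?thesis
    using assms by (auto simp: cong_def algebra_simps)
qed

lemma cong_power: "cong f g \<Longrightarrow> cong (f ^ k) (g ^ k)"
  by (induction k) (auto intro: cong_mult cong_refl)

lemma cong_sum: "(\<And>x. x \<in> A \<Longrightarrow> cong (f x) (g x)) \<Longrightarrow> cong (sum f A) (sum g A)"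
  by (induction A rule: infinite_finite_induct) (auto intro: cong_add cong_refl)

lemma cong_prod: "(\<And>x. x \<in> A \<Longrightarrow> cong (f x) (g x)) \<Longrightarrow> cong (prod f A) (prod g A)"
  by (induction A rule: infinite_finite_induct) (auto intro: cong_mult cong_refl)

lemma cong_mem_iff: "cong f g \<Longrightarrow> f \<in> p \<longleftrightarrow> g \<in> p"
  using diff_mem_iff by (auto simp: cong_def)

lemma cong_peval:
  assumes f: "f \<in> polys M" and \<sigma>: "\<And>i. i \<le> M \<Longrightarrow> cong (\<sigma> i) (\<tau> i)"
  shows "cong (peval \<sigma> f) (peval \<tau> f)"
  unfolding peval_def meval_def
  using f by (intro cong_sum cong_mult[OF cong_refl[OF polys_of_int]] cong_prod cong_power \<sigma>) (auto simp: polys_iff)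

text \<open>Projective coordinates matter only up to a common factor, which leaves a form of degree
  \<open>d\<close> as its \<open>d\<close>-th power.\<close>

lemma cong_peval_scale:
  assumes f: "f \<in> homog M d" and h: "h \<in> polys N"
    and \<sigma>: "\<And>i. i \<le> M \<Longrightarrow> cong (\<sigma> i) (h * \<tau> i)"
  shows "cong (peval \<sigma> f) (h ^ d * peval \<tau> f)"
  using cong_peval[OF homog_polys[OF f], of \<sigma> "\<lambda>i. h * \<tau> i", OF \<sigma>] peval_scale[OF f, of h \<tau>] by simp

end

section \<open>Values in residue fields\<close>

definition hpair :: "nat \<Rightarrow> zpoly set \<Rightarrow> zpoly \<Rightarrow> zpoly \<Rightarrow> bool" where
  "hpair N p f g \<longleftrightarrow> (\<exists>d. f \<in> homog N d \<and> g \<in> homog N d) \<and> g \<notin> p"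

lemma hpair_polys: "hpair N p f g \<Longrightarrow> f \<in> polys N \<and> g \<in> polys N"
  by (auto simp: hpair_def)

lemma carrier_residue_field: "carrier (residue_field N p) = {hfrac N p f g | f g. hpair N p f g}"
  unfolding residue_field_def hpair_def by auto

lemma mem_hfrac: "(f', g') \<in> hfrac N p f g \<longleftrightarrow> hpair N p f' g' \<and> f * g' - f' * g \<in> p"
  by (auto simp: hfrac_def hpair_def)

context point
begin

lemma hpair_mult: "hpair N p f g \<Longrightarrow> hpair N p f' g' \<Longrightarrow> hpair N p (f * f') (g * g')"
  unfolding hpair_def using mult_iff[of g g'] by blast

lemma hpair_add: "hpair N p f g \<Longrightarrow> hpair N p f' g' \<Longrightarrow> hpair N p (f * g' + f' * g) (g * g')"
  unfolding hpair_def using mult_iff[of g g'] homog_mult homog_add homog_polys by (metis add.commute)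

lemma hpair_of_nat: "hpair N p (of_nat c) 1"
  unfolding hpair_def using one by (auto intro!: exI[of _ 0])

lemma hfrac_trans:
  assumes "f1 * g2 - f2 * g1 \<in> p" "f2 * g3 - f3 * g2 \<in> p"
    and "g1 \<in> polys N" "g2 \<in> polys N" "g3 \<in> polys N" "f1 \<in> polys N" "f3 \<in> polys N" "g2 \<notin> p"
  shows "f1 * g3 - f3 * g1 \<in> p"
proof -
  \<comment> \<open>In this combination the terms with \<open>f2\<close> cancel and
    \<open>g2\<close> times the goal remains; \<open>g2\<close> lies outside the prime
    \<open>p\<close>.\<close>
  have "g3 * (f1 * g2 - f2 * g1) + g1 * (f2 * g3 - f3 * g2) \<in> p"
    using assms by (intro add mult) auto
  then have "g2 * (f1 * g3 - f3 * g1) \<in> p"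
    by (simp add: algebra_simps)
  then show ?thesis
    using assms mult_iff[of g2 "f1 * g3 - f3 * g1"] by blast
qed

lemma hfrac_eq_iff:
  assumes "hpair N p f g" "hpair N p f' g'"
  shows "hfrac N p f g = hfrac N p f' g' \<longleftrightarrow> f * g' - f' * g \<in> p"
proof
  assume "hfrac N p f g = hfrac N p f' g'"
  then have "(f', g') \<in> hfrac N p f g"
    using assms by (simp add: mem_hfrac)
  then show "f * g' - f' * g \<in> p" by (simp add: mem_hfrac)
next
  have *: "hfrac N p f' g' \<subseteq> hfrac N p f g"
    if "f * g' - f' * g \<in> p" "hpair N p f g" "hpair N p f' g'" for f g f' g'
    using that by (auto simp: mem_hfrac hpair_def
      intro!: hfrac_trans[of f g' f' g, OF that(1)])
  assume 1: "f * g' - f' * g \<in> p"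
  then have "f' * g - f * g' \<in> p"
    using uminus by fastforce
  with 1 show "hfrac N p f g = hfrac N p f' g'"
    using *[of f g' f' g] *[of f' g f g'] assms by blast
qed

lemma hfrac_self: "hpair N p f g \<Longrightarrow> (f, g) \<in> hfrac N p f g"
  by (simp add: mem_hfrac)

text \<open>The operations of \<open>residue_field\<close> are unions over all representatives. If
  every representative gives the same class, the union is that class; \<open>(f, g)\<close> itself
  shows that the union is not an empty one.\<close>

lemma UN_hfrac:
  assumes "hpair N p f g" "\<And>f' g'. (f', g') \<in> hfrac N p f g \<Longrightarrow> H f' g' = K"
  shows "(\<Union>(f', g')\<in>hfrac N p f g. H f' g') = K"
proof -
  have "(\<Union>(f', g')\<in>hfrac N p f g. H f' g') = (\<Union>_\<in>hfrac N p f g. K)"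
    using assms(2) by (intro SUP_cong) auto
  then show ?thesis using hfrac_self[OF assms(1)] by auto
qed

lemma residue_mult:
  assumes "hpair N p f g" "hpair N p f' g'"
  shows "hfrac N p f g \<otimes>\<^bsub>residue_field N p\<^esub> hfrac N p f' g' = hfrac N p (f * f') (g * g')"
proof -
  have "hfrac N p (a * a') (b * b') = hfrac N p (f * f') (g * g')"
    if "(a, b) \<in> hfrac N p f g" "(a', b') \<in> hfrac N p f' g'" for a b a' b'
  proof -
    have ab: "hpair N p a b" "f * b - a * g \<in> p" "hpair N p a' b'" "f' * b' - a' * g' \<in> p"
      using that by (auto simp: mem_hfrac)
    then have "cong (f * b) (a * g)" "cong (f' * b') (a' * g')"
      using assms by (auto simp: cong_def dest!: hpair_polys)
    from cong_mult[OF this] have "(f * f') * (b * b') - (a * a') * (g * g') \<in> p"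
      by (simp add: cong_def mult_ac)
    then show ?thesis
      using hfrac_eq_iff[OF hpair_mult[OF assms] hpair_mult[OF ab(1,3)]] by simp
  qed
  then show ?thesis
    unfolding residue_field_def by (simp add: UN_hfrac assms)
qed

lemma residue_add:
  assumes "hpair N p f g" "hpair N p f' g'"
  shows "hfrac N p f g \<oplus>\<^bsub>residue_field N p\<^esub> hfrac N p f' g' = hfrac N p (f * g' + f' * g) (g * g')"
proof -
  have "hfrac N p (a * b' + a' * b) (b * b') = hfrac N p (f * g' + f' * g) (g * g')"
    if "(a, b) \<in> hfrac N p f g" "(a', b') \<in> hfrac N p f' g'" for a b a' b'
  proof -
    have ab: "hpair N p a b" "f * b - a * g \<in> p" "hpair N p a' b'" "f' * b' - a' * g' \<in> p"
      using that by (auto simp: mem_hfrac)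
    then have c: "cong (f * b) (a * g)" "cong (g' * b') (g' * b')" "cong (f' * b') (a' * g')" "cong (g * b) (g * b)"
      using assms by (auto simp: cong_def dest!: hpair_polys)
    from cong_add[OF cong_mult[OF c(1,2)] cong_mult[OF c(3,4)]] have "(f * g' + f' * g) * (b * b') - (a * b' + a' * b) * (g * g') \<in> p"
      by (simp add: cong_def algebra_simps)
    then show ?thesis
      using hfrac_eq_iff[OF hpair_add[OF assms] hpair_add[OF ab(1,3)]] by simp
  qed
  then show ?thesis
    unfolding residue_field_def by (simp add: UN_hfrac assms)
qed

lemma residue_one: "\<one>\<^bsub>residue_field N p\<^esub> = hfrac N p 1 1"
  by (simp add: residue_field_def)

end

section \<open>Pulling back points and values along homogeneous coordinates\<close>

text \<open>The preimage of the prime \<open>p\<close> under the substitution of \<open>F i\<close>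
  for the \<open>i\<close>-th variable, that is, the image of the point \<open>p\<close> under the
  rational map with homogeneous coordinates \<open>[F 0 : ... : F M]\<close>.\<close>

definition pull :: "nat \<Rightarrow> (nat \<Rightarrow> zpoly) \<Rightarrow> zpoly set \<Rightarrow> zpoly set" where
  "pull M F p = {f \<in> polys M. peval F f \<in> p}"

text \<open>The induced map of residue fields, from the image point to \<open>p\<close>. As for the
  field operations, the union over representatives stands for a choice that turns out not to
  matter.\<close>

definition pull_value :: "nat \<Rightarrow> (nat \<Rightarrow> zpoly) \<Rightarrow> zpoly set \<Rightarrow> (zpoly \<times> zpoly) set \<Rightarrow> (zpoly \<times> zpoly) set" where
  "pull_value N F p A = (\<Union>(f, g)\<in>A. hfrac N p (peval F f) (peval F g))"

lemma mem_pull: "f \<in> polys M \<Longrightarrow> f \<in> pull M F p \<longleftrightarrow> peval F f \<in> p"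
  by (simp add: pull_def)

lemma pvar_mem_pull: "i \<le> M \<Longrightarrow> pvar i \<in> pull M F p \<longleftrightarrow> F i \<in> p"
  by (simp add: mem_pull polys_pvar)

locale point_map = point N p for N p +
  fixes M :: nat and F :: "nat \<Rightarrow> zpoly" and e :: nat
  assumes F: "i \<le> M \<Longrightarrow> F i \<in> homog N e" and e: "e \<ge> 1" and F_nonzero: "\<exists>i\<le>M. F i \<notin> p"
begin

lemma peval_F_polys: "f \<in> polys M \<Longrightarrow> peval F f \<in> polys N"
  by (rule peval_polys[OF _ F])

lemma pull_point: "pull M F p \<in> proj_points M"
proof -
  obtain i where i: "i \<le> M" "F i \<notin> p" using F_nonzero by blast
  show ?thesis
  proof (rule proj_pointsI[of _ _ i])
    fix f d assume f: "f \<in> pull M F p"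
    then have fp: "f \<in> polys M" "peval F f \<in> p" by (auto simp: pull_def)
    \<comment> \<open>Degree \<open>d\<close> on the target corresponds to degree
      \<open>d * e\<close> on the source, and \<open>e \<ge> 1\<close> allows \<open>d\<close> to be
      recovered from it.\<close>
    have "hcomp (d * e) (peval F f) = peval F (hcomp d f)"
      using hcomp_peval[where \<sigma> = F and k = "d * e", OF fp(1) F e] e by simp
    then show "hcomp d f \<in> pull M F p"
      using hcomp[OF fp(2), of "d * e"] hcomp_homog[OF fp(1)] by (auto simp: pull_def)
  next
    fix f g assume "f \<in> polys M" "g \<in> polys M" "f * g \<in> pull M F p"
    then show "f \<in> pull M F p \<or> g \<in> pull M F p"
      using mult_iff[OF peval_F_polys peval_F_polys] by (auto simp: pull_def)
  next
    fix f g assume "f \<in> pull M F p" "g \<in> polys M"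
    then show "f * g \<in> pull M F p"
      using mult'[OF _ peval_F_polys] by (auto simp: pull_def)
  qed (use i add in \<open>auto simp: pull_def polys_pvar\<close>)
qed

sublocale image: point M "pull M F p"
  by unfold_locales (rule pull_point)

text \<open>For the component \<open>f_d\<close> of degree \<open>d\<close>,
  \<open>u^d G(f_d)\<close> is congruent to \<open>v^d F(f_d)\<close>, and \<open>u\<close> cancels
  because it is outside \<open>p\<close>. Since \<open>v\<close> may vanish at \<open>p\<close>, so
  may the whole tuple \<open>G\<close>; this happens for the vanishing rows and columns of a Segre
  point.\<close>

lemma peval_proportional:
  assumes f: "f \<in> polys M" "peval F f \<in> p"
    and G: "\<And>i. i \<le> M \<Longrightarrow> G i \<in> homog N e'"
    and u: "u \<in> polys N" "u \<notin> p" and v: "v \<in> polys N"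
    and proportional: "\<And>i. i \<le> M \<Longrightarrow> u * G i - v * F i \<in> p"
  shows "peval G f \<in> p"
proof -
  have "peval G (hcomp d f) \<in> p" for d
  proof -
    have fd: "hcomp d f \<in> homog M d" by (rule hcomp_homog[OF f(1)])
    have "hcomp d f \<in> pull M F p"
      using f by (intro image.hcomp) (simp add: mem_pull)
    then have Ff: "peval F (hcomp d f) \<in> p"
      using mem_pull[OF homog_polys[OF fd]] by blast
    have "cong (peval (\<lambda>i. u * G i) (hcomp d f)) (v ^ d * peval F (hcomp d f))"
    proof (rule cong_peval_scale[OF fd v])
      fix i assume i: "i \<le> M"
      show "cong (u * G i) (v * F i)"
        by (rule congI[OF polys_mult[OF u(1) homog_polys[OF G[OF i]]] polys_mult[OF v homog_polys[OF F[OF i]]] proportional[OF i]])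
    qed
    moreover have "v ^ d * peval F (hcomp d f) \<in> p"
      by (rule mult[OF polys_power[OF v] Ff])
    ultimately have "u ^ d * peval G (hcomp d f) \<in> p"
      using cong_mem_iff by (simp add: peval_scale[OF fd])
    moreover have "peval G (hcomp d f) \<in> polys N"
      by (rule homog_polys[OF peval_homog[OF fd G]])
    ultimately show ?thesis
      using mult_iff[OF polys_power[OF u(1)]] power_iff[OF u(1)] u(2) by blast
  qed
  then have "(\<Sum>d\<in>mdeg ` Poly_Mapping.keys f. peval G (hcomp d f)) \<in> p"
    by (intro sum)
  then show ?thesis
    by (simp add: peval_sum[symmetric] sum_hcomp del: peval_sum)
qed

lemma hpair_pull:
  assumes "hpair M (pull M F p) f g" shows "hpair N p (peval F f) (peval F g)"
proof -
  obtain d where d: "f \<in> homog M d" "g \<in> homog M d" "g \<notin> pull M F p"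
    using assms by (auto simp: hpair_def)
  have "peval F f \<in> homog N (d * e)" "peval F g \<in> homog N (d * e)"
    using peval_homog[OF d(1), of F N e] peval_homog[OF d(2), of F N e] F by blast+
  moreover have "peval F g \<notin> p"
    using d(3) mem_pull[OF homog_polys[OF d(2)], of F p] by simp
  ultimately have "peval F f \<in> homog N (d * e)" "peval F g \<in> homog N (d * e)" "peval F g \<notin> p"
    by blast+
  then show ?thesis by (auto simp: hpair_def)
qed

lemma pull_value_hfrac:
  assumes fg: "hpair M (pull M F p) f g"
  shows "pull_value N F p (hfrac M (pull M F p) f g) = hfrac N p (peval F f) (peval F g)"
  unfolding pull_value_def
proof (rule image.UN_hfrac[OF fg])
  fix f' g' assume "(f', g') \<in> hfrac M (pull M F p) f g"
  then have *: "hpair M (pull M F p) f' g'" "f * g' - f' * g \<in> pull M F p"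
    unfolding mem_hfrac by blast+
  from *(2) have "peval F f * peval F g' - peval F f' * peval F g \<in> p"
    unfolding pull_def mem_Collect_eq peval_diff peval_mult by (rule conjunct2)
  then show "hfrac N p (peval F f') (peval F g') = hfrac N p (peval F f) (peval F g)"
    using hfrac_eq_iff[OF hpair_pull[OF fg] hpair_pull[OF *(1)]] by simp
qed

lemma pull_value_mult:
  assumes "a \<in> carrier (residue_field M (pull M F p))" "b \<in> carrier (residue_field M (pull M F p))"
  shows "pull_value N F p (a \<otimes>\<^bsub>residue_field M (pull M F p)\<^esub> b) =
    pull_value N F p a \<otimes>\<^bsub>residue_field N p\<^esub> pull_value N F p b"
  using assms unfolding carrier_residue_field
  by (auto simp: image.residue_mult image.hpair_mult pull_value_hfrac residue_mult hpair_pull)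

lemma pull_value_add:
  assumes "a \<in> carrier (residue_field M (pull M F p))" "b \<in> carrier (residue_field M (pull M F p))"
  shows "pull_value N F p (a \<oplus>\<^bsub>residue_field M (pull M F p)\<^esub> b) =
    pull_value N F p a \<oplus>\<^bsub>residue_field N p\<^esub> pull_value N F p b"
  using assms unfolding carrier_residue_field
  by (auto simp: image.residue_add image.hpair_add pull_value_hfrac residue_add hpair_pull)

lemma pull_value_one:
  "pull_value N F p \<one>\<^bsub>residue_field M (pull M F p)\<^esub> = \<one>\<^bsub>residue_field N p\<^esub>"
  using pull_value_hfrac[OF image.hpair_of_nat[of 1]] by (simp add: image.residue_one residue_one)

end


section \<open>Isomorphisms given by homogeneous coordinates\<close>

lemma locally_closed_pts: "locally_closed_in (proj_top (pdim X)) (pts X)"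
  using Rep_qp_variety[of X] by (auto simp: pdim_def pts_def split: prod.splits)

lemma pts_subset: "pts X \<subseteq> proj_points (pdim X)"
  using locally_closed_pts[of X] openin_subset by (fastforce simp: locally_closed_in_def topspace_proj_top)

lemma topspace_vtop [simp]: "topspace (vtop X) = pts X"
  using pts_subset[of X] by (auto simp: vtop_def topspace_proj_top)

lemma openin_vtop_basic: "openin (vtop X) (pts X \<inter> basic_open (pdim X) f)"
  unfolding vtop_def using openin_basic_open' openin_subtopology_Int2 by blast

lemma carrier_struct_sheaf:
  "s \<in> carrier (struct_sheaf X U) \<longleftrightarrow> s \<in> extensional U \<and>
    (\<forall>p\<in>U. \<exists>V. openin (vtop X) V \<and> p \<in> V \<and> V \<subseteq> U \<and>
      (\<exists>d. \<exists>f\<in>homog (pdim X) d. \<exists>g\<in>homog (pdim X) d. \<forall>q\<in>V. g \<notin> q \<and> s q = hfrac (pdim X) q f g))"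
  by (simp add: struct_sheaf_def Let_def)

lemma struct_sheaf_ops:
  "s \<otimes>\<^bsub>struct_sheaf X U\<^esub> t = (\<lambda>p\<in>U. s p \<otimes>\<^bsub>residue_field (pdim X) p\<^esub> t p)"
  "s \<oplus>\<^bsub>struct_sheaf X U\<^esub> t = (\<lambda>p\<in>U. s p \<oplus>\<^bsub>residue_field (pdim X) p\<^esub> t p)"
  "\<one>\<^bsub>struct_sheaf X U\<^esub> = (\<lambda>p\<in>U. \<one>\<^bsub>residue_field (pdim X) p\<^esub>)"
  by (simp_all add: struct_sheaf_def Let_def)

lemma section_value:
  assumes "s \<in> carrier (struct_sheaf X U)" "p \<in> U"
  obtains f g where "hpair (pdim X) p f g" "s p = hfrac (pdim X) p f g"
  using assms unfolding carrier_struct_sheaf hpair_def by metis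

lemma section_value_carrier:
  "s \<in> carrier (struct_sheaf X U) \<Longrightarrow> p \<in> U \<Longrightarrow> s p \<in> carrier (residue_field (pdim X) p)"
  unfolding carrier_residue_field using section_value by blast

locale variety_map =
  fixes X Y :: qp_variety and F :: "nat \<Rightarrow> zpoly" and e :: nat
  assumes F: "i \<le> pdim Y \<Longrightarrow> F i \<in> homog (pdim X) e" and e: "e \<ge> 1"
    and F_nonzero: "p \<in> pts X \<Longrightarrow> \<exists>i\<le>pdim Y. F i \<notin> p"
    and image: "p \<in> pts X \<Longrightarrow> pull (pdim Y) F p \<in> pts Y"
begin

abbreviation "\<phi> \<equiv> pull (pdim Y) F"
abbreviation "pre V \<equiv> {p \<in> pts X. \<phi> p \<in> V}"

definition "pull_section V s = (\<lambda>p\<in>pre V. pull_value (pdim X) F p (s (\<phi> p)))"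

lemma point_map: "p \<in> pts X \<Longrightarrow> point_map (pdim X) p (pdim Y) F e"
  using pts_subset F e F_nonzero by unfold_locales auto

lemma pre_basic_open:
  assumes "f \<in> polys (pdim Y)"
  shows "pre (basic_open (pdim Y) f) = pts X \<inter> basic_open (pdim X) (peval F f)"
  using assms pts_subset[of X] pts_subset[of Y] image by (auto simp: basic_open_def mem_pull)

lemma continuous: "continuous_map (vtop X) (vtop Y) \<phi>"
proof -
  have "continuous_map (vtop X) (proj_top (pdim Y)) \<phi>"
    unfolding proj_top_def
  proof (rule continuous_on_generated_topo)
    fix U assume "U \<in> {basic_open (pdim Y) f | f. f \<in> polys (pdim Y)}"
    then obtain f where f: "U = basic_open (pdim Y) f" "f \<in> polys (pdim Y)" by blast
    have "\<phi> -` U \<inter> topspace (vtop X) = pre U" by auto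
    then show "openin (vtop X) (\<phi> -` U \<inter> topspace (vtop X))"
      using pre_basic_open[OF f(2)] f(1) openin_vtop_basic by simp
  next
    have "\<phi> ` topspace (vtop X) \<subseteq> topspace (proj_top (pdim Y))"
      using image pts_subset[of Y] by (auto simp: topspace_proj_top)
    then show "\<phi> ` topspace (vtop X) \<subseteq> \<Union> {basic_open (pdim Y) f | f. f \<in> polys (pdim Y)}"
      by (simp add: proj_top_def)
  qed
  then show ?thesis
    unfolding vtop_def[of Y] continuous_map_in_subtopology using image by auto
qed

lemma openin_pre: "openin (vtop Y) V \<Longrightarrow> openin (vtop X) (pre V)"
  using openin_continuous_map_preimage[OF continuous] by simp

lemma pull_section_closed:
  assumes V: "openin (vtop Y) V" and s: "s \<in> carrier (struct_sheaf Y V)"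
  shows "pull_section V s \<in> carrier (struct_sheaf X (pre V))"
  unfolding carrier_struct_sheaf
proof (intro conjI ballI)
  show "pull_section V s \<in> extensional (pre V)"
    unfolding pull_section_def by (rule restrict_extensional)
next
  fix p assume "p \<in> pre V"
  then have p: "p \<in> pts X" "\<phi> p \<in> V" by auto
  obtain W d f g where W: "openin (vtop Y) W" "\<phi> p \<in> W" "W \<subseteq> V"
    and fg: "f \<in> homog (pdim Y) d" "g \<in> homog (pdim Y) d"
    and eq: "\<And>q. q \<in> W \<Longrightarrow> g \<notin> q \<and> s q = hfrac (pdim Y) q f g"
    using s p(2) unfolding carrier_struct_sheaf by metis
  have hom: "peval F f \<in> homog (pdim X) (d * e)" "peval F g \<in> homog (pdim X) (d * e)"
    using peval_homog[OF fg(1), of F] peval_homog[OF fg(2), of F] F by blast+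
  have val: "peval F g \<notin> q \<and> pull_section V s q = hfrac (pdim X) q (peval F f) (peval F g)"
    if q: "q \<in> pre W" for q
  proof
    interpret q: point_map "pdim X" q "pdim Y" F e
      using q by (intro point_map) simp
    have hp: "hpair (pdim Y) (\<phi> q) f g"
      using q eq[of "\<phi> q"] fg by (auto simp: hpair_def)
    then show "peval F g \<notin> q"
      using q.hpair_pull unfolding hpair_def by blast
    have "pull_section V s q = pull_value (pdim X) F q (s (\<phi> q))"
      using q W(3) by (auto simp: pull_section_def)
    also have "s (\<phi> q) = hfrac (pdim Y) (\<phi> q) f g"
      using q eq[of "\<phi> q"] by simp
    finally show "pull_section V s q = hfrac (pdim X) q (peval F f) (peval F g)"
      using q.pull_value_hfrac[OF hp] by simp
  qed
  have "openin (vtop X) (pre W)" "p \<in> pre W" "pre W \<subseteq> pre V"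
    using openin_pre[OF W(1)] p W by auto
  then show "\<exists>W. openin (vtop X) W \<and> p \<in> W \<and> W \<subseteq> pre V \<and>
      (\<exists>d. \<exists>f\<in>homog (pdim X) d. \<exists>g\<in>homog (pdim X) d. \<forall>q\<in>W. g \<notin> q \<and> pull_section V s q = hfrac (pdim X) q f g)"
    by (intro exI[of _ "pre W"] exI[of _ "d * e"] bexI[OF _ hom(1)] bexI[OF _ hom(2)] conjI ballI val)
qed

lemma pull_section_hom:
  assumes V: "openin (vtop Y) V"
  shows "pull_section V \<in> ring_hom (struct_sheaf Y V) (struct_sheaf X (pre V))"
proof (rule ring_hom_memI)
  fix s t assume s: "s \<in> carrier (struct_sheaf Y V)" and t: "t \<in> carrier (struct_sheaf Y V)"
  show "pull_section V (s \<otimes>\<^bsub>struct_sheaf Y V\<^esub> t) =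
      pull_section V s \<otimes>\<^bsub>struct_sheaf X (pre V)\<^esub> pull_section V t"
    unfolding struct_sheaf_ops
  proof (rule ext)
    fix p
    show "pull_section V (\<lambda>p\<in>V. s p \<otimes>\<^bsub>residue_field (pdim Y) p\<^esub> t p) p =
        (\<lambda>p\<in>pre V. pull_section V s p \<otimes>\<^bsub>residue_field (pdim X) p\<^esub> pull_section V t p) p"
    proof (cases "p \<in> pre V")
      case True
      then interpret q: point_map "pdim X" p "pdim Y" F e
        by (intro point_map) simp
      show ?thesis
        using True section_value_carrier[OF s, of "\<phi> p"] section_value_carrier[OF t, of "\<phi> p"]
        by (simp add: pull_section_def q.pull_value_mult)
    qed (auto simp: pull_section_def)
  qed
  show "pull_section V (s \<oplus>\<^bsub>struct_sheaf Y V\<^esub> t) =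
      pull_section V s \<oplus>\<^bsub>struct_sheaf X (pre V)\<^esub> pull_section V t"
    unfolding struct_sheaf_ops
  proof (rule ext)
    fix p
    show "pull_section V (\<lambda>p\<in>V. s p \<oplus>\<^bsub>residue_field (pdim Y) p\<^esub> t p) p =
        (\<lambda>p\<in>pre V. pull_section V s p \<oplus>\<^bsub>residue_field (pdim X) p\<^esub> pull_section V t p) p"
    proof (cases "p \<in> pre V")
      case True
      then interpret q: point_map "pdim X" p "pdim Y" F e
        by (intro point_map) simp
      show ?thesis
        using True section_value_carrier[OF s, of "\<phi> p"] section_value_carrier[OF t, of "\<phi> p"]
        by (simp add: pull_section_def q.pull_value_add)
    qed (auto simp: pull_section_def)
  qed
next
  show "pull_section V \<one>\<^bsub>struct_sheaf Y V\<^esub> = \<one>\<^bsub>struct_sheaf X (pre V)\<^esub>"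
    unfolding struct_sheaf_ops
  proof (rule ext)
    fix p
    show "pull_section V (\<lambda>p\<in>V. \<one>\<^bsub>residue_field (pdim Y) p\<^esub>) p = (\<lambda>p\<in>pre V. \<one>\<^bsub>residue_field (pdim X) p\<^esub>) p"
    proof (cases "p \<in> pre V")
      case True
      then interpret q: point_map "pdim X" p "pdim Y" F e
        by (intro point_map) simp
      show ?thesis
        using True by (simp add: pull_section_def q.pull_value_one)
    qed (auto simp: pull_section_def)
  qed
qed (rule pull_section_closed[OF V])

end

text \<open>One-sided: going by \<open>F\<close> and returning by \<open>G\<close> is the identity
  of \<open>X\<close> up to a factor \<open>h\<close>, nonzero at \<open>p\<close> and possibly
  depending on \<open>p\<close>. An isomorphism is two such data with the roles exchanged.\<close>

locale variety_retraction = XY: variety_map X Y F d + YX: variety_map Y X G e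
  for X Y F d G e +
  assumes inverse: "p \<in> pts X \<Longrightarrow> \<exists>h\<in>polys (pdim X). h \<notin> p \<and> (\<forall>i\<le>pdim X. peval F (G i) - h * pvar i \<in> p)"
begin

lemma peval_inverse:
  assumes p: "p \<in> pts X"
  obtains h where "h \<in> polys (pdim X)" "h \<notin> p"
    "\<And>f k. f \<in> homog (pdim X) k \<Longrightarrow> point.cong (pdim X) p (peval F (peval G f)) (h ^ k * f)"
proof -
  interpret p: point_map "pdim X" p "pdim Y" F d
    using XY.point_map[OF p] .
  obtain h where h: "h \<in> polys (pdim X)" "h \<notin> p"
    "\<And>i. i \<le> pdim X \<Longrightarrow> peval F (G i) - h * pvar i \<in> p"
    using inverse[OF p] by blast
  have "p.cong (peval F (peval G f)) (h ^ k * f)" if f: "f \<in> homog (pdim X) k" for f k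
  proof -
    have "p.cong (peval F (G i)) (h * pvar i)" if "i \<le> pdim X" for i
      using that h YX.F p.peval_F_polys by (intro p.congI polys_mult polys_pvar) (auto dest: homog_polys)
    then have "p.cong (peval (\<lambda>i. peval F (G i)) f) (h ^ k * peval pvar f)"
      by (rule p.cong_peval_scale[OF f h(1)])
    then show ?thesis by (simp add: peval_peval peval_pvar_self)
  qed
  with h that show ?thesis by blast
qed

lemma retract:
  assumes p: "p \<in> pts X" shows "YX.\<phi> (XY.\<phi> p) = p"
proof (rule point_eqI)
  interpret p: point_map "pdim X" p "pdim Y" F d
    using XY.point_map[OF p] .
  interpret q: point_map "pdim Y" "XY.\<phi> p" "pdim X" G e
    using YX.point_map[OF XY.image[OF p]] .
  show "YX.\<phi> (XY.\<phi> p) \<in> proj_points (pdim X)" by (rule q.pull_point)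
  show "p \<in> proj_points (pdim X)" by (rule p.p)
  fix f k assume f: "f \<in> homog (pdim X) k"
  obtain h where h: "h \<in> polys (pdim X)" "h \<notin> p" "p.cong (peval F (peval G f)) (h ^ k * f)"
    using peval_inverse[OF p] f by metis
  have "f \<in> YX.\<phi> (XY.\<phi> p) \<longleftrightarrow> peval F (peval G f) \<in> p"
    using homog_polys[OF f] q.peval_F_polys mem_pull by metis
  also have "\<dots> \<longleftrightarrow> h ^ k * f \<in> p"
    by (rule p.cong_mem_iff[OF h(3)])
  also have "\<dots> \<longleftrightarrow> f \<in> p"
    using p.mult_iff[OF polys_power[OF h(1)] homog_polys[OF f]] p.power_iff[OF h(1)] h(2) by blast
  finally show "f \<in> YX.\<phi> (XY.\<phi> p) \<longleftrightarrow> f \<in> p" .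
qed

text \<open>Numerator and denominator are forms of the same degree \<open>k\<close>, so both acquire
  the factor \<open>h^k\<close>, which cancels in the fraction.\<close>

lemma retract_value:
  assumes p: "p \<in> pts X" and fg: "hpair (pdim X) p f g"
  shows "pull_value (pdim X) F p (pull_value (pdim Y) G (XY.\<phi> p) (hfrac (pdim X) p f g)) = hfrac (pdim X) p f g"
proof -
  interpret p: point_map "pdim X" p "pdim Y" F d
    using XY.point_map[OF p] .
  interpret q: point_map "pdim Y" "XY.\<phi> p" "pdim X" G e
    using YX.point_map[OF XY.image[OF p]] .
  note r = retract[OF p]
  obtain k where k: "f \<in> homog (pdim X) k" "g \<in> homog (pdim X) k"
    using fg by (auto simp: hpair_def)
  obtain h where h: "h \<in> polys (pdim X)" "h \<notin> p"
    "p.cong (peval F (peval G f)) (h ^ k * f)" "p.cong (peval F (peval G g)) (h ^ k * g)"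
    using peval_inverse[OF p] k by metis
  have hp: "hpair (pdim Y) (XY.\<phi> p) (peval G f) (peval G g)"
    by (rule q.hpair_pull) (simp only: r fg)
  then have hp': "hpair (pdim X) p (peval F (peval G f)) (peval F (peval G g))"
    by (rule p.hpair_pull)
  have "pull_value (pdim Y) G (XY.\<phi> p) (hfrac (pdim X) p f g) = hfrac (pdim Y) (XY.\<phi> p) (peval G f) (peval G g)"
    using q.pull_value_hfrac[of f g] fg unfolding r by blast
  then have "pull_value (pdim X) F p (pull_value (pdim Y) G (XY.\<phi> p) (hfrac (pdim X) p f g)) =
      hfrac (pdim X) p (peval F (peval G f)) (peval F (peval G g))"
    using p.pull_value_hfrac[OF hp] by simp
  also have "\<dots> = hfrac (pdim X) p f g"
  proof -
    have c: "p.cong f f" "p.cong g g"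
      using k p.cong_refl homog_polys by blast+
    have "p.cong (peval F (peval G f) * g - f * peval F (peval G g)) ((h ^ k * f) * g - f * (h ^ k * g))"
      by (intro p.cong_diff p.cong_mult h(3,4) c)
    then have "peval F (peval G f) * g - f * peval F (peval G g) \<in> p"
      using p.cong_mem_iff by (simp add: mult_ac)
    then show ?thesis
      using p.hfrac_eq_iff[OF hp' fg] by simp
  qed
  finally show ?thesis .
qed

text \<open>\<open>V\<close> is a variable tied to \<open>U\<close> by two equations because
  \<open>U\<close> and the preimage of its preimage are equal only by a proof. Each use in
  \<open>isomorphicI\<close> makes one of the two equations reflexive.\<close>

lemma retract_section:
  assumes U: "openin (vtop X) U" and s: "s \<in> carrier (struct_sheaf X U)"
    and V: "XY.pre V = U" "V = YX.pre U"
  shows "XY.pull_section V (YX.pull_section U s) = s"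
proof (rule ext)
  fix p
  show "XY.pull_section V (YX.pull_section U s) p = s p"
  proof (cases "p \<in> U")
    case True
    then have p: "p \<in> pts X" "XY.\<phi> p \<in> V" using V by auto
    obtain f g where fg: "hpair (pdim X) p f g" "s p = hfrac (pdim X) p f g"
      using section_value[OF s True] .
    have "XY.pull_section V (YX.pull_section U s) p =
        pull_value (pdim X) F p (YX.pull_section U s (XY.\<phi> p))"
      using True V(1) by (simp add: XY.pull_section_def)
    also have "YX.pull_section U s (XY.\<phi> p) = pull_value (pdim Y) G (XY.\<phi> p) (s p)"
      using p V(2) True by (simp add: YX.pull_section_def retract XY.image)
    finally show ?thesis
      using retract_value[OF p(1) fg(1)] fg(2) by simp
  next
    case False
    then show ?thesis
      using s V by (auto simp: XY.pull_section_def carrier_struct_sheaf extensional_def)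
  qed
qed

end

lemma isomorphicI:
  assumes "variety_retraction X Y F d G e" "variety_retraction Y X G e F d"
  shows "isomorphic X Y"
proof -
  interpret A: variety_retraction X Y F d G e by fact
  interpret B: variety_retraction Y X G e F d by fact
  have "homeomorphic_maps (vtop X) (vtop Y) A.XY.\<phi> A.YX.\<phi>"
    unfolding homeomorphic_maps_def using A.XY.continuous A.YX.continuous A.retract B.retract by simp
  then have hm: "homeomorphic_map (vtop X) (vtop Y) A.XY.\<phi>"
    by (rule homeomorphic_maps_imp_map)
  have pre: "A.YX.pre (A.XY.pre V) = V" if "V \<subseteq> pts Y" for V
    using that A.YX.image B.retract by auto
  have pre': "A.XY.pre (A.YX.pre V) = V" if "V \<subseteq> pts X" for V
    using that A.XY.image A.retract by auto
  have "A.XY.pull_section V \<in> ring_iso (struct_sheaf Y V) (struct_sheaf X (A.XY.pre V))"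
    if V: "openin (vtop Y) V" for V
  proof -
    let ?U = "A.XY.pre V"
    have sub: "V \<subseteq> pts Y" using openin_subset[OF V] by simp
    have U: "openin (vtop X) ?U" by (rule A.XY.openin_pre[OF V])
    have cl: "A.YX.pull_section ?U s \<in> carrier (struct_sheaf Y V)" if "s \<in> carrier (struct_sheaf X ?U)" for s
      using A.YX.pull_section_closed[OF U that] unfolding pre[OF sub] .
    have "bij_betw (A.XY.pull_section V) (carrier (struct_sheaf Y V)) (carrier (struct_sheaf X ?U))"
    proof (rule bij_betw_byWitness[where f' = "A.YX.pull_section ?U"])
      show "\<forall>s\<in>carrier (struct_sheaf Y V). A.YX.pull_section ?U (A.XY.pull_section V s) = s"
        by (intro ballI) (rule B.retract_section[OF V _ pre[OF sub] refl])
      show "\<forall>s\<in>carrier (struct_sheaf X ?U). A.XY.pull_section V (A.YX.pull_section ?U s) = s"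
        by (intro ballI) (rule A.retract_section[OF U _ refl pre[OF sub, symmetric]])
      show "A.XY.pull_section V ` carrier (struct_sheaf Y V) \<subseteq> carrier (struct_sheaf X ?U)"
        by (intro image_subsetI) (rule A.XY.pull_section_closed[OF V])
      show "A.YX.pull_section ?U ` carrier (struct_sheaf X ?U) \<subseteq> carrier (struct_sheaf Y V)"
        by (intro image_subsetI) (rule cl)
    qed
    then show ?thesis
      unfolding ring_iso_def using A.XY.pull_section_hom[OF V] by blast
  qed
  moreover have "A.XY.pull_section W (restrict s W) = restrict (A.XY.pull_section V s) (A.XY.pre W)"
    if "W \<subseteq> V" for V W s
  proof
    fix p
    show "A.XY.pull_section W (restrict s W) p = restrict (A.XY.pull_section V s) (A.XY.pre W) p"
    proof (cases "p \<in> A.XY.pre W")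
      case True
      then have "p \<in> A.XY.pre V" "A.XY.\<phi> p \<in> W" using that by auto
      with True show ?thesis
        unfolding A.XY.pull_section_def restrict_def by presburger
    next
      case False
      then show ?thesis
        unfolding A.XY.pull_section_def restrict_def by presburger
    qed
  qed
  ultimately show ?thesis
    unfolding isomorphic_def using hm by blast
qed


section \<open>Computing in the Grothendieck ring\<close>

text \<open>Congruence of representatives. \<open>free_elem\<close> is a commutative ring as a type,
  so sums and powers can be simplified directly, unlike cosets in the carrier of
  \<open>K0\<close>.\<close>

definition K0_eq :: "free_elem \<Rightarrow> free_elem \<Rightarrow> bool" (infix "\<approx>" 50) where
  "a \<approx> b \<longleftrightarrow> a - b \<in> K0_ideal"

lemma free_ring_ops [simp]:
  "x \<otimes>\<^bsub>free_ring\<^esub> y = x * y" "x \<oplus>\<^bsub>free_ring\<^esub> y = x + y"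
  "\<zero>\<^bsub>free_ring\<^esub> = 0" "\<one>\<^bsub>free_ring\<^esub> = 1" "carrier free_ring = UNIV"
  by (simp_all add: free_ring_def)

lemma a_inv_free_ring: "\<ominus>\<^bsub>free_ring\<^esub> x = - x"
proof -
  interpret cring free_ring by (rule cring_free_ring)
  show ?thesis using minus_equality[of "- x" x] by simp
qed

lemma K0_ideal_0: "0 \<in> K0_ideal"
  and K0_ideal_add: "a \<in> K0_ideal \<Longrightarrow> b \<in> K0_ideal \<Longrightarrow> a + b \<in> K0_ideal"
  and K0_ideal_mult: "a \<in> K0_ideal \<Longrightarrow> c * a \<in> K0_ideal"
proof -
  interpret I: ideal K0_ideal free_ring by (rule ideal_K0_ideal)
  show "0 \<in> K0_ideal"
    using additive_subgroup.zero_closed[OF I.is_additive_subgroup] by simp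
  show "a + b \<in> K0_ideal" if "a \<in> K0_ideal" "b \<in> K0_ideal"
    using additive_subgroup.a_closed[OF I.is_additive_subgroup that] by simp
  show "c * a \<in> K0_ideal" if "a \<in> K0_ideal"
    using I.I_l_closed[OF that, of c] by simp
qed

lemma K0_eq_relation: "a - b \<in> K0_relations \<Longrightarrow> a \<approx> b"
  unfolding K0_eq_def K0_ideal_def
  using ring.genideal_self[of free_ring K0_relations] cring_free_ring
  by (auto simp: cring_def)

lemma K0_eq_refl [simp]: "a \<approx> a"
  by (simp add: K0_eq_def K0_ideal_0)

lemma K0_eq_sym: "a \<approx> b \<Longrightarrow> b \<approx> a"
  using K0_ideal_mult[of "a - b" "-1"] by (simp add: K0_eq_def)

lemma K0_eq_trans [trans]: "a \<approx> b \<Longrightarrow> b \<approx> c \<Longrightarrow> a \<approx> c"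
  using K0_ideal_add[of "a - b" "b - c"] by (simp add: K0_eq_def)

lemma K0_eq_add: "a \<approx> b \<Longrightarrow> c \<approx> d \<Longrightarrow> a + c \<approx> b + d"
  using K0_ideal_add[of "a - b" "c - d"] by (simp add: K0_eq_def algebra_simps)

lemma K0_eq_mult: "a \<approx> b \<Longrightarrow> c \<approx> d \<Longrightarrow> a * c \<approx> b * d"
  using K0_ideal_add[of "c * (a - b)" "b * (c - d)"] K0_ideal_mult[of "a - b" c] K0_ideal_mult[of "c - d" b]
  by (simp add: K0_eq_def algebra_simps)

lemma K0_eq_diff: "a \<approx> b \<Longrightarrow> c \<approx> d \<Longrightarrow> a - c \<approx> b - d"
  using K0_eq_add[of a b "-1 * c" "-1 * d"] K0_eq_mult[of "-1" "-1" c d] by simp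

lemma K0_eq_sum: "(\<And>x. x \<in> A \<Longrightarrow> f x \<approx> g x) \<Longrightarrow> sum f A \<approx> sum g A"
  by (induction A rule: infinite_finite_induct) (auto intro: K0_eq_add)

lemma K0_coset_hom: "(+>\<^bsub>free_ring\<^esub>) K0_ideal \<in> ring_hom free_ring K0"
  unfolding K0_def by (rule ideal.rcos_ring_hom[OF ideal_K0_ideal])

lemma K0_coset_eq_iff: "K0_ideal +>\<^bsub>free_ring\<^esub> a = K0_ideal +>\<^bsub>free_ring\<^esub> b \<longleftrightarrow> a \<approx> b"
proof -
  interpret cring free_ring by (rule cring_free_ring)
  show ?thesis
    using quotient_eq_iff_same_a_r_cos[OF ideal_K0_ideal, of a b]
    by (simp add: K0_eq_def a_minus_def a_inv_free_ring)
qed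

text \<open>The passage from cosets to representatives: the coset map is a ring homomorphism and
  carries the polynomial in \<open>gen Gm\<close> to the one in \<open>T_class\<close>.\<close>

lemma effective_in_T_iff:
  "effective_in_T (K0_class X) \<longleftrightarrow> (\<exists>d (a :: nat \<Rightarrow> nat). gen X \<approx> (\<Sum>k\<le>d. of_nat (a k) * gen Gm ^ k))"
proof -
  define c where "c a = K0_ideal +>\<^bsub>free_ring\<^esub> a" for a
  interpret K: cring K0 by (rule cring_K0)
  note hom = K0_coset_hom
  have c_closed: "c x \<in> carrier K0" for x
    using ring_hom_closed[OF hom, of x] by (simp add: c_def)
  have c_add: "c (x + y) = c x \<oplus>\<^bsub>K0\<^esub> c y" and c_mult: "c (x * y) = c x \<otimes>\<^bsub>K0\<^esub> c y" for x y
    using ring_hom_add[OF hom, of x y] ring_hom_mult[OF hom, of x y] by (simp_all add: c_def)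
  have c_1: "c 1 = \<one>\<^bsub>K0\<^esub>"
    using ring_hom_one[OF hom] by (simp add: c_def)
  have c_0: "c 0 = \<zero>\<^bsub>K0\<^esub>"
    using c_add[of 0 0] c_closed[of 0] by (metis K.add.r_cancel_one' add.right_neutral)
  have c_pow: "c (x ^ k) = c x [^]\<^bsub>K0\<^esub> k" for x k
    by (induction k) (simp_all add: c_1 c_mult mult.commute K.m_comm c_closed)
  have c_nat: "c (of_nat m * x) = [m] \<cdot>\<^bsub>K0\<^esub> c x" for m x
  proof (induction m)
    case (Suc m)
    have "c (of_nat (Suc m) * x) = c (of_nat m * x) \<oplus>\<^bsub>K0\<^esub> c x"
      by (simp add: algebra_simps c_add[symmetric])
    then show ?case using Suc by simp
  qed (simp add: c_0)
  have c_sum: "c (\<Sum>k\<le>d. f k) = (\<Oplus>\<^bsub>K0\<^esub>k\<in>{..d}. c (f k))" for f :: "nat \<Rightarrow> free_elem" and d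
  proof (induction d)
    case (Suc d)
    have "(\<Oplus>\<^bsub>K0\<^esub>k\<in>{..Suc d}. c (f k)) = c (f (Suc d)) \<oplus>\<^bsub>K0\<^esub> (\<Oplus>\<^bsub>K0\<^esub>k\<in>{..d}. c (f k))"
      by (rule K.finsum_Suc) (simp add: c_closed)
    then show ?case by (simp add: c_add Suc K.a_comm c_closed)
  qed (simp add: c_closed)
  have "(K0_class X = (\<Oplus>\<^bsub>K0\<^esub>k\<in>{..d}. [a k] \<cdot>\<^bsub>K0\<^esub> (T_class [^]\<^bsub>K0\<^esub> k))) \<longleftrightarrow>
      gen X \<approx> (\<Sum>k\<le>d. of_nat (a k) * gen Gm ^ k)" for d and a :: "nat \<Rightarrow> nat"
  proof -
    have "(\<Oplus>\<^bsub>K0\<^esub>k\<in>{..d}. [a k] \<cdot>\<^bsub>K0\<^esub> (T_class [^]\<^bsub>K0\<^esub> k)) = c (\<Sum>k\<le>d. of_nat (a k) * gen Gm ^ k)"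
      by (simp add: c_sum c_nat c_pow T_class_def K0_class_def c_def[symmetric])
    then show ?thesis
      by (simp add: K0_class_def c_def K0_coset_eq_iff)
  qed
  then show ?thesis by (simp add: effective_in_T_def)
qed


section \<open>Classes of locally closed sets\<close>

lemma locally_closed_inter:
  assumes "locally_closed_in T A" "locally_closed_in T B" shows "locally_closed_in T (A \<inter> B)"
proof -
  obtain U C where "openin T U" "closedin T C" "A = U \<inter> C"
    using assms(1) by (auto simp: locally_closed_in_def)
  moreover obtain U' C' where "openin T U'" "closedin T C'" "B = U' \<inter> C'"
    using assms(2) by (auto simp: locally_closed_in_def)
  ultimately have "openin T (U \<inter> U')" "closedin T (C \<inter> C')" "A \<inter> B = (U \<inter> U') \<inter> (C \<inter> C')"
    by auto
  then show ?thesis unfolding locally_closed_in_def by blast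
qed

lemma locally_closed_basic_open: "locally_closed_in (proj_top N) (basic_open N f)"
  using locally_closed_pts[of "basic_open_variety N f"]
  by (simp add: pdim_basic_open_variety pts_basic_open_variety)

lemma locally_closed_hypersurface: "locally_closed_in (proj_top N) {p \<in> proj_points N. f \<in> p}"
  using locally_closed_pts[of "hypersurface N f"]
  by (simp add: pdim_hypersurface pts_hypersurface)

lemma locally_closed_proj_points: "locally_closed_in (proj_top N) (proj_points N)"
  unfolding locally_closed_in_def
  by (metis closedin_topspace inf.idem openin_topspace topspace_proj_top)

lemma locally_closed_subset: "locally_closed_in (proj_top N) A \<Longrightarrow> A \<subseteq> proj_points N"
  using openin_subset[of "proj_top N"] by (auto simp: locally_closed_in_def topspace_proj_top)

lemma locally_closed_conditions:
  assumes "finite E" "finite B" "locally_closed_in (proj_top N) A"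
  shows "locally_closed_in (proj_top N) {p \<in> A. (\<forall>f\<in>E. f \<in> p) \<and> (\<forall>f\<in>B. f \<notin> p)}"
  using assms
proof (induction E rule: finite_induct)
  case empty
  then show ?case
  proof (induction B rule: finite_induct)
    case (insert b B)
    have "A \<subseteq> proj_points N"
      using insert.prems by (rule locally_closed_subset)
    then have "{p \<in> A. (\<forall>f\<in>{}. f \<in> p) \<and> (\<forall>f\<in>insert b B. f \<notin> p)} =
        {p \<in> A. (\<forall>f\<in>{}. f \<in> p) \<and> (\<forall>f\<in>B. f \<notin> p)} \<inter> basic_open N b"
      by (auto simp: basic_open_def)
    then show ?case
      using locally_closed_inter[OF insert.IH[OF insert.prems] locally_closed_basic_open[of N b]] by (simp only:)
  qed simp
next
  case (insert e E)
  have "A \<subseteq> proj_points N"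
    using insert.prems(2) by (rule locally_closed_subset)
  then have "{p \<in> A. (\<forall>f\<in>insert e E. f \<in> p) \<and> (\<forall>f\<in>B. f \<notin> p)} =
      {p \<in> A. (\<forall>f\<in>E. f \<in> p) \<and> (\<forall>f\<in>B. f \<notin> p)} \<inter> {p \<in> proj_points N. e \<in> p}"
    by auto
  then show ?case
    using locally_closed_inter[OF insert.IH[OF insert.prems(1,2)] locally_closed_hypersurface[of N e]] by (simp only:)
qed

definition subvariety :: "nat \<Rightarrow> zpoly set set \<Rightarrow> qp_variety" where
  "subvariety N A = Abs_qp_variety (N, A)"

lemma pdim_subvariety: "locally_closed_in (proj_top N) A \<Longrightarrow> pdim (subvariety N A) = N"
  and pts_subvariety: "locally_closed_in (proj_top N) A \<Longrightarrow> pts (subvariety N A) = A"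
  by (simp_all add: pdim_def pts_def subvariety_def Abs_qp_variety_inverse)

lemma subvariety_pts: "subvariety (pdim X) (pts X) = X"
  by (simp add: subvariety_def pdim_def pts_def Rep_qp_variety_inverse)

lemma scissor:
  assumes A: "locally_closed_in (proj_top N) A"
  shows "gen (subvariety N A) \<approx> gen (subvariety N {p \<in> A. f \<in> p}) + gen (subvariety N {p \<in> A. f \<notin> p})"
proof (rule K0_eq_relation, rule rel_scissor)
  have lc: "locally_closed_in (proj_top N) {p \<in> A. f \<in> p}" "locally_closed_in (proj_top N) {p \<in> A. f \<notin> p}"
    using locally_closed_conditions[OF _ _ A, of "{f}" "{}"] locally_closed_conditions[OF _ _ A, of "{}" "{f}"]
    by simp_all
  show "pdim (subvariety N {p \<in> A. f \<in> p}) = pdim (subvariety N A)"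
    "pdim (subvariety N {p \<in> A. f \<notin> p}) = pdim (subvariety N A)"
    using A lc by (simp_all add: pdim_subvariety)
  show "pts (subvariety N {p \<in> A. f \<notin> p}) = pts (subvariety N A) - pts (subvariety N {p \<in> A. f \<in> p})"
    using A lc by (auto simp: pts_subvariety)
  have "{p \<in> A. f \<in> p} = topspace (vtop (subvariety N A)) - (pts (subvariety N A) \<inter> basic_open N f)"
    using pts_subset[of "subvariety N A"] A by (auto simp: pts_subvariety pdim_subvariety basic_open_def)
  moreover have "openin (vtop (subvariety N A)) (pts (subvariety N A) \<inter> basic_open N f)"
    using openin_vtop_basic[of "subvariety N A" f] A by (simp add: pdim_subvariety)
  ultimately show "closedin (vtop (subvariety N A)) (pts (subvariety N {p \<in> A. f \<in> p}))"
    using lc by (simp only: pts_subvariety) (rule closedin_diff[OF closedin_topspace])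
qed

text \<open>Cutting the empty set by an equation gives [empty] = [empty] + [empty].\<close>

lemma class_empty: "gen (subvariety N {}) \<approx> 0"
proof -
  have "locally_closed_in (proj_top N) {}"
    unfolding locally_closed_in_def using closedin_empty openin_empty by blast
  from scissor[OF this, of 0] have "gen (subvariety N {}) \<approx> gen (subvariety N {}) + gen (subvariety N {})"
    by simp
  from K0_eq_diff[OF this K0_eq_refl[of "gen (subvariety N {})"]] show ?thesis
    using K0_eq_sym by simp
qed

text \<open>Each piece is cut by one more equation \<open>pvar j = 0\<close>. Its two sides
  correspond to \<open>S\<close> and \<open>insert j S\<close>, which together run through the
  subsets of \<open>insert j I\<close>.\<close>

lemma stratify:
  assumes "finite I" and A: "locally_closed_in (proj_top N) A"
  shows "gen (subvariety N A) \<approx> (\<Sum>S\<in>Pow I. gen (subvariety N {p \<in> A. \<forall>i\<in>I. pvar i \<notin> p \<longleftrightarrow> i \<in> S}))"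
  using \<open>finite I\<close>
proof (induction I rule: finite_induct)
  case (insert j I)
  let ?g = "\<lambda>I S. gen (subvariety N {p \<in> A. \<forall>i\<in>I. pvar i \<notin> p \<longleftrightarrow> i \<in> S})"
  have step: "?g I S \<approx> ?g (insert j I) S + ?g (insert j I) (insert j S)" if S: "S \<in> Pow I" for S
  proof -
    have "{p \<in> A. \<forall>i\<in>I. pvar i \<notin> p \<longleftrightarrow> i \<in> S} = {p \<in> A. (\<forall>f\<in>pvar ` (I - S). f \<in> p) \<and> (\<forall>f\<in>pvar ` (I \<inter> S). f \<notin> p)}"
      by auto
    then have "locally_closed_in (proj_top N) {p \<in> A. \<forall>i\<in>I. pvar i \<notin> p \<longleftrightarrow> i \<in> S}"
      using locally_closed_conditions[OF _ _ A, of "pvar ` (I - S)" "pvar ` (I \<inter> S)"] insert(1) by simp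
    from scissor[OF this, of "pvar j"] have *: "?g I S \<approx>
        gen (subvariety N {p \<in> {p \<in> A. \<forall>i\<in>I. pvar i \<notin> p \<longleftrightarrow> i \<in> S}. pvar j \<in> p}) +
        gen (subvariety N {p \<in> {p \<in> A. \<forall>i\<in>I. pvar i \<notin> p \<longleftrightarrow> i \<in> S}. pvar j \<notin> p})" .
    have "{p \<in> {p \<in> A. \<forall>i\<in>I. pvar i \<notin> p \<longleftrightarrow> i \<in> S}. pvar j \<in> p} = {p \<in> A. \<forall>i\<in>insert j I. pvar i \<notin> p \<longleftrightarrow> i \<in> S}"
      using S insert(2) by auto
    moreover have "{p \<in> {p \<in> A. \<forall>i\<in>I. pvar i \<notin> p \<longleftrightarrow> i \<in> S}. pvar j \<notin> p} =
        {p \<in> A. \<forall>i\<in>insert j I. pvar i \<notin> p \<longleftrightarrow> i \<in> insert j S}"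
      using S insert(2) by auto
    ultimately show ?thesis using * by simp
  qed
  have "gen (subvariety N A) \<approx> (\<Sum>S\<in>Pow I. ?g I S)"
    by (rule insert.IH)
  also have "\<dots> \<approx> (\<Sum>S\<in>Pow I. ?g (insert j I) S + ?g (insert j I) (insert j S))"
    by (rule K0_eq_sum[OF step])
  also have "\<dots> = (\<Sum>S\<in>Pow I. ?g (insert j I) S) + (\<Sum>S\<in>insert j ` Pow I. ?g (insert j I) S)"
  proof -
    have "inj_on (insert j) (Pow I)"
      using insert(2) by (auto simp: inj_on_def)
    then show ?thesis by (simp add: sum.distrib sum.reindex)
  qed
  also have "\<dots> = (\<Sum>S\<in>Pow (insert j I). ?g (insert j I) S)"
    unfolding Pow_insert using insert(1,2) by (intro sum.union_disjoint[symmetric]) auto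
  finally show ?case .
qed simp


section \<open>Strata and their products\<close>

definition stratum :: "nat \<Rightarrow> nat set \<Rightarrow> zpoly set set" where
  "stratum N S = {p \<in> proj_points N. \<forall>i\<le>N. pvar i \<notin> p \<longleftrightarrow> i \<in> S}"

lemma locally_closed_stratum: "locally_closed_in (proj_top N) (stratum N S)"
proof -
  have "stratum N S = {p \<in> proj_points N. (\<forall>f\<in>pvar ` ({..N} - S). f \<in> p) \<and> (\<forall>f\<in>pvar ` ({..N} \<inter> S). f \<notin> p)}"
    by (auto simp: stratum_def)
  then show ?thesis
    using locally_closed_conditions[OF _ _ locally_closed_proj_points, of "pvar ` ({..N} - S)" "pvar ` ({..N} \<inter> S)" N]
    by simp
qed

lemma stratum_points: "p \<in> stratum N S \<Longrightarrow> p \<in> proj_points N"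
  by (simp add: stratum_def)

lemma stratum_pvar: "p \<in> stratum N S \<Longrightarrow> i \<le> N \<Longrightarrow> pvar i \<notin> p \<longleftrightarrow> i \<in> S"
  by (simp add: stratum_def)

section \<open>The Segre variety, its projections and its strata\<close>

lemma segre_index: "i \<le> N \<Longrightarrow> j \<le> M \<Longrightarrow> i * (M + 1) + j \<le> segre_dim N M"
proof -
  assume "i \<le> N" "j \<le> M"
  then have "i * (M + 1) + j \<le> N * (M + 1) + M"
    by (intro add_mono mult_right_mono) auto
  then show ?thesis by (simp add: segre_dim_def)
qed

lemma segre_index_cases:
  assumes "m \<le> segre_dim N M"
  obtains i j where "i \<le> N" "j \<le> M" "m = i * (M + 1) + j"
proof -
  have "m < (N + 1) * (M + 1)"
    using assms by (simp add: segre_dim_def)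
  then have "m div (M + 1) < N + 1"
    by (rule less_mult_imp_div_less)
  moreover have "m mod (M + 1) < M + 1" by simp
  moreover have "m = m div (M + 1) * (M + 1) + m mod (M + 1)"
    by (simp only: div_mult_mod_eq)
  ultimately show ?thesis
    using that[of "m div (M + 1)" "m mod (M + 1)"] by simp
qed

lemma segre_var_homog: "i \<le> N \<Longrightarrow> j \<le> M \<Longrightarrow> segre_var M i j \<in> homog (segre_dim N M) 1"
  unfolding segre_var_def by (intro homog_pvar segre_index)

locale segre_point =
  fixes N M :: nat and r :: "zpoly set"
  assumes r: "r \<in> segre_points N M"
begin

sublocale point "segre_dim N M" r
  using r by unfold_locales (simp add: segre_points_def)

lemma segre_relation:
  "i \<le> N \<Longrightarrow> k \<le> N \<Longrightarrow> j \<le> M \<Longrightarrow> l \<le> M \<Longrightarrow>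
    segre_var M i j * segre_var M k l - segre_var M i l * segre_var M k j \<in> r"
  using r by (simp add: segre_points_def)

lemma var_polys: "i \<le> N \<Longrightarrow> j \<le> M \<Longrightarrow> segre_var M i j \<in> polys (segre_dim N M)"
  using segre_var_homog homog_polys by blast

lemma ex_segre_var: obtains k j where "k \<le> N" "j \<le> M" "segre_var M k j \<notin> r"
  using ex_pvar by (metis segre_index_cases segre_var_def)

text \<open>By the Segre quadric \<open>z_ij z_kl\<close> and \<open>z_il z_kj\<close> agree modulo
  \<open>r\<close>. As \<open>z_kj\<close> is nonzero at the point, primality decides when
  \<open>z_il\<close> vanishes.\<close>

lemma segre_var_mem_iff:
  assumes "i \<le> N" "k \<le> N" "j \<le> M" "l \<le> M" "segre_var M k j \<notin> r"
  shows "segre_var M i l \<notin> r \<longleftrightarrow> segre_var M i j \<notin> r \<and> segre_var M k l \<notin> r"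
  using diff_mem_iff[OF segre_relation[of i k j l]] mult_iff[OF var_polys var_polys] assms by auto

context
  fixes k j assumes kj: "k \<le> N" "j \<le> M" "segre_var M k j \<notin> r"
begin

lemma fst_point_map: "point_map (segre_dim N M) r N (\<lambda>i. segre_var M i j) 1"
  using kj segre_var_homog by unfold_locales auto

lemma snd_point_map: "point_map (segre_dim N M) r M (\<lambda>j. segre_var M k j) 1"
  using kj segre_var_homog by unfold_locales auto

text \<open>\<open>segre_fst\<close> tests all columns. Every column is proportional modulo
  \<open>r\<close> to column \<open>j\<close>, which contains the nonvanishing entry
  \<open>z_kj\<close>, so the test on column \<open>j\<close> implies the others.\<close>

lemma segre_fst_eq: "segre_fst N M r = pull N (\<lambda>i. segre_var M i j) r"
proof -
  interpret F: point_map "segre_dim N M" r N "\<lambda>i. segre_var M i j" 1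
    by (rule fst_point_map)
  have "peval (\<lambda>i. segre_var M i l) f \<in> r"
    if f: "f \<in> polys N" "peval (\<lambda>i. segre_var M i j) f \<in> r" and l: "l \<le> M" for f l
  proof (rule F.peval_proportional[where e' = 1, OF f _ _ kj(3)])
    show "segre_var M k j * segre_var M i l - segre_var M k l * segre_var M i j \<in> r" if "i \<le> N" for i
      by (rule segre_relation[OF kj(1) that kj(2) l])
  qed (use kj l segre_var_homog var_polys in auto)
  then show ?thesis
    using kj unfolding segre_fst_def pull_def subst_poly_eq_peval by blast
qed

lemma segre_snd_eq: "segre_snd N M r = pull M (\<lambda>j. segre_var M k j) r"
proof -
  interpret F: point_map "segre_dim N M" r M "\<lambda>j. segre_var M k j" 1
    by (rule snd_point_map)
  have "peval (\<lambda>j. segre_var M l j) f \<in> r"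
    if f: "f \<in> polys M" "peval (\<lambda>j. segre_var M k j) f \<in> r" and l: "l \<le> N" for f l
  proof (rule F.peval_proportional[where e' = 1, OF f _ _ kj(3)])
    show "segre_var M k j * segre_var M l i - segre_var M l j * segre_var M k i \<in> r" if "i \<le> M" for i
      using segre_relation[OF kj(1) l kj(2) that] by (simp only: mult.commute)
  qed (use kj l segre_var_homog var_polys in auto)
  then show ?thesis
    using kj unfolding segre_snd_def pull_def subst_poly_eq_peval by blast
qed

end

lemma segre_fst_point: "segre_fst N M r \<in> proj_points N"
  and segre_snd_point: "segre_snd N M r \<in> proj_points M"
proof -
  obtain k j where kj: "k \<le> N" "j \<le> M" "segre_var M k j \<notin> r" by (rule ex_segre_var)
  show "segre_fst N M r \<in> proj_points N"
    unfolding segre_fst_eq[OF kj] by (rule point_map.pull_point[OF fst_point_map[OF kj]])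
  show "segre_snd N M r \<in> proj_points M"
    unfolding segre_snd_eq[OF kj] by (rule point_map.pull_point[OF snd_point_map[OF kj]])
qed

end

text \<open>The product of two strata in the coordinates \<open>z_ij\<close> alone, so that
  isomorphisms can be checked on Segre variables without the projections.\<close>

definition segre_stratum :: "nat \<Rightarrow> nat \<Rightarrow> nat set \<Rightarrow> nat set \<Rightarrow> zpoly set set" where
  "segre_stratum N M S R =
    {r \<in> segre_points N M. \<forall>i\<le>N. \<forall>j\<le>M. segre_var M i j \<notin> r \<longleftrightarrow> i \<in> S \<and> j \<in> R}"

text \<open>The zero pattern of a matrix of rank one is the product of the patterns of its two
  factors; a nonvanishing entry picks a column and a row that represent the two projections.\<close>

lemma segre_stratum_eq:
  assumes S: "S \<noteq> {}" "S \<subseteq> {..N}" and R: "R \<noteq> {}" "R \<subseteq> {..M}"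
  shows "segre_stratum N M S R =
    {r \<in> segre_points N M. segre_fst N M r \<in> stratum N S \<and> segre_snd N M r \<in> stratum M R}"
proof (intro equalityI subsetI)
  fix r assume ra: "r \<in> segre_stratum N M S R"
  then interpret segre_point N M r by unfold_locales (simp add: segre_stratum_def)
  obtain k j where kj: "k \<in> S" "j \<in> R" using S R by blast
  then have kj': "k \<le> N" "j \<le> M" "segre_var M k j \<notin> r"
    using S R ra unfolding segre_stratum_def by blast+
  have "pvar i \<notin> segre_fst N M r \<longleftrightarrow> i \<in> S" if "i \<le> N" for i
    using that ra kj kj'(2) by (simp add: segre_fst_eq[OF kj'] pvar_mem_pull segre_stratum_def)
  moreover have "pvar i \<notin> segre_snd N M r \<longleftrightarrow> i \<in> R" if "i \<le> M" for i
    using that ra kj kj'(1) by (simp add: segre_snd_eq[OF kj'] pvar_mem_pull segre_stratum_def)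
  ultimately show "r \<in> {r \<in> segre_points N M. segre_fst N M r \<in> stratum N S \<and> segre_snd N M r \<in> stratum M R}"
    using segre_fst_point segre_snd_point ra by (simp add: stratum_def segre_stratum_def)
next
  fix r assume ra: "r \<in> {r \<in> segre_points N M. segre_fst N M r \<in> stratum N S \<and> segre_snd N M r \<in> stratum M R}"
  then interpret segre_point N M r by unfold_locales simp
  obtain k j where kj: "k \<le> N" "j \<le> M" "segre_var M k j \<notin> r" by (rule ex_segre_var)
  have "segre_var M i j \<notin> r \<longleftrightarrow> i \<in> S" if "i \<le> N" for i
    using ra that stratum_pvar[of "segre_fst N M r" N S i] by (simp add: segre_fst_eq[OF kj] pvar_mem_pull)
  moreover have "segre_var M k l \<notin> r \<longleftrightarrow> l \<in> R" if "l \<le> M" for l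
    using ra that stratum_pvar[of "segre_snd N M r" M R l] by (simp add: segre_snd_eq[OF kj] pvar_mem_pull)
  ultimately show "r \<in> segre_stratum N M S R"
    using segre_var_mem_iff[OF _ kj(1,2) _ kj(3)] ra by (simp add: segre_stratum_def)
qed

lemma locally_closed_segre_stratum: "locally_closed_in (proj_top (segre_dim N M)) (segre_stratum N M S R)"
proof -
  let ?E = "(\<lambda>(i, k, j, l). segre_var M i j * segre_var M k l - segre_var M i l * segre_var M k j) `
    ({..N} \<times> {..N} \<times> {..M} \<times> {..M})"
  let ?v = "\<lambda>(i, j). segre_var M i j"
  let ?I = "{..N} \<times> {..M}"
  have "segre_stratum N M S R = {r \<in> proj_points (segre_dim N M).
      (\<forall>f\<in>?E \<union> ?v ` (?I - S \<times> R). f \<in> r) \<and> (\<forall>f\<in>?v ` (?I \<inter> S \<times> R). f \<notin> r)}"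
  proof -
    have 1: "(\<forall>f\<in>?v ` (?I - S \<times> R). f \<in> r) \<longleftrightarrow> (\<forall>i\<le>N. \<forall>j\<le>M. \<not> (i \<in> S \<and> j \<in> R) \<longrightarrow> segre_var M i j \<in> r)"
      "(\<forall>f\<in>?v ` (?I \<inter> S \<times> R). f \<notin> r) \<longleftrightarrow> (\<forall>i\<le>N. \<forall>j\<le>M. i \<in> S \<and> j \<in> R \<longrightarrow> segre_var M i j \<notin> r)"
      "(\<forall>f\<in>?E. f \<in> r) \<longleftrightarrow> (\<forall>i\<le>N. \<forall>k\<le>N. \<forall>j\<le>M. \<forall>l\<le>M.
         segre_var M i j * segre_var M k l - segre_var M i l * segre_var M k j \<in> r)" for r
      by fastforce+
    show ?thesis
      unfolding segre_stratum_def segre_points_def ball_Un 1 by blast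
  qed
  moreover have "locally_closed_in (proj_top (segre_dim N M)) \<dots>"
    by (rule locally_closed_conditions[OF _ _ locally_closed_proj_points]) auto
  ultimately show ?thesis by simp
qed

lemma Gm_eq: "Gm = subvariety 1 (stratum 1 {0, 1})"
proof -
  have "pdim Gm = 1" "pts Gm = basic_open 1 (pvar 0 * pvar 1)"
    by (simp_all add: Gm_def pdim_basic_open_variety pts_basic_open_variety)
  moreover have "basic_open 1 (pvar 0 * pvar 1) = stratum 1 {0, 1}"
  proof -
    have "pvar 0 * pvar 1 \<notin> p \<longleftrightarrow> (\<forall>i\<le>1. pvar i \<notin> p \<longleftrightarrow> i \<in> {0, 1})" if "p \<in> proj_points 1" for p
    proof -
      interpret point 1 p by unfold_locales fact
      have "(\<forall>i\<le>1. pvar i \<notin> p \<longleftrightarrow> i \<in> {0, 1}) \<longleftrightarrow> pvar 0 \<notin> p \<and> pvar 1 \<notin> p"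
        by (auto simp: le_Suc_eq)
      then show ?thesis
        using mult_iff[of "pvar 0" "pvar 1"] polys_pvar[of 0 1] polys_pvar[of 1 1] by simp
    qed
    then show ?thesis
      unfolding basic_open_def stratum_def by blast
  qed
  ultimately show ?thesis using subvariety_pts[of Gm] by simp
qed

lemma class_stratum_times_Gm:
  assumes S: "S \<noteq> {}" "S \<subseteq> {..N}"
  shows "gen (subvariety N (stratum N S)) * gen Gm \<approx> gen (subvariety (segre_dim N 1) (segre_stratum N 1 S {0, 1}))"
proof (rule K0_eq_relation, rule rel_product)
  have "segre_stratum N 1 S {0, 1} = {r \<in> segre_points N 1. segre_fst N 1 r \<in> stratum N S \<and> segre_snd N 1 r \<in> stratum 1 {0, 1}}"
    by (rule segre_stratum_eq[OF S]) auto
  then show "is_product (subvariety N (stratum N S)) Gm (subvariety (segre_dim N 1) (segre_stratum N 1 S {0, 1}))"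
    unfolding is_product_def Gm_eq pdim_subvariety[OF locally_closed_stratum] pts_subvariety[OF locally_closed_stratum]
      pdim_subvariety[OF locally_closed_segre_stratum] pts_subvariety[OF locally_closed_segre_stratum]
    by (intro conjI refl)
qed

text \<open>The image conditions may assume \<open>point_map\<close>, which already makes
  \<open>pull\<close> of a point a point; each use only has to verify the conditions that cut out
  the target.\<close>

lemma isomorphic_subvarieties:
  assumes lc: "locally_closed_in (proj_top N) A" "locally_closed_in (proj_top M) B"
    and F: "\<And>i. i \<le> M \<Longrightarrow> F i \<in> homog N d" "d \<ge> 1"
    and G: "\<And>i. i \<le> N \<Longrightarrow> G i \<in> homog M e" "e \<ge> 1"
    and A: "\<And>p. p \<in> A \<Longrightarrow> \<exists>i\<le>M. F i \<notin> p" "\<And>p. p \<in> A \<Longrightarrow> point_map N p M F d \<Longrightarrow> pull M F p \<in> B"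
    and B: "\<And>p. p \<in> B \<Longrightarrow> \<exists>i\<le>N. G i \<notin> p" "\<And>p. p \<in> B \<Longrightarrow> point_map M p N G e \<Longrightarrow> pull N G p \<in> A"
    and GF: "\<And>p. p \<in> A \<Longrightarrow> \<exists>h\<in>polys N. h \<notin> p \<and> (\<forall>i\<le>N. peval F (G i) - h * pvar i \<in> p)"
    and FG: "\<And>p. p \<in> B \<Longrightarrow> \<exists>h\<in>polys M. h \<notin> p \<and> (\<forall>i\<le>M. peval G (F i) - h * pvar i \<in> p)"
  shows "isomorphic (subvariety N A) (subvariety M B)"
proof -
  have pm: "p \<in> A \<Longrightarrow> point_map N p M F d" for p
    using locally_closed_subset[OF lc(1)] F A(1) by unfold_locales auto
  have pm': "p \<in> B \<Longrightarrow> point_map M p N G e" for p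
    using locally_closed_subset[OF lc(2)] G B(1) by unfold_locales auto
  note dims = pdim_subvariety[OF lc(1)] pdim_subvariety[OF lc(2)] pts_subvariety[OF lc(1)] pts_subvariety[OF lc(2)]
  show ?thesis
  proof (rule isomorphicI)
    show "variety_retraction (subvariety N A) (subvariety M B) F d G e"
      by unfold_locales (use F(2) G(2) in \<open>simp_all add: dims F(1) G(1) A B pm pm' GF\<close>)
    show "variety_retraction (subvariety M B) (subvariety N A) G e F d"
      by unfold_locales (use F(2) G(2) in \<open>simp_all add: dims F(1) G(1) A B pm pm' FG\<close>)
  qed
qed


section \<open>Classes of strata\<close>

lemma pull_stratum:
  assumes "point_map N p M F d" "\<And>i. i \<le> M \<Longrightarrow> F i \<notin> p \<longleftrightarrow> i \<in> S"
  shows "pull M F p \<in> stratum M S"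
  using point_map.pull_point[OF assms(1)] assms(2) by (simp add: stratum_def pvar_mem_pull)

lemma point_of_stratum: "p \<in> stratum N S \<Longrightarrow> point N p"
  by unfold_locales (rule stratum_points)

text \<open>The stratum is a coordinate point. It is compared with the zero-dimensional projective
  space, whose class is the unit by \<open>rel_point\<close>.\<close>

lemma class_point:
  assumes i: "i \<le> N" shows "gen (subvariety N (stratum N {i})) \<approx> 1"
proof -
  have "stratum 0 {0} = basic_open 0 1"
  proof -
    have "1 \<notin> p \<and> pvar 0 \<notin> p" if "p \<in> proj_points 0" for p
    proof -
      interpret point 0 p by unfold_locales fact
      show ?thesis using one ex_pvar by auto
    qed
    then show ?thesis by (auto simp: stratum_def basic_open_def)
  qed
  then have eq: "subvariety 0 (stratum 0 {0}) = basic_open_variety 0 1"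
    by (simp add: subvariety_def basic_open_variety_def)
  have "isomorphic (subvariety N (stratum N {i})) (subvariety 0 (stratum 0 {0}))"
  proof (rule isomorphic_subvarieties[OF locally_closed_stratum locally_closed_stratum])
    let ?F = "\<lambda>_::nat. pvar i" and ?G = "\<lambda>j. if j = i then pvar 0 else 0"
    show "?F k \<in> homog N 1" for k
      using i by (rule homog_pvar)
    show "?G k \<in> homog 0 1" for k
      using homog_pvar[of 0 0] by simp
    fix p assume p: "p \<in> stratum N {i}"
    interpret p: point N p by (rule point_of_stratum[OF p])
    show "\<exists>k\<le>0. ?F k \<notin> p"
      using stratum_pvar[OF p i] by simp
    show "point_map N p 0 ?F 1 \<Longrightarrow> pull 0 ?F p \<in> stratum 0 {0}"
      using stratum_pvar[OF p i] by (intro pull_stratum) auto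
    have "peval ?F (?G k) - 1 * pvar k \<in> p" if "k \<le> N" for k
      using stratum_pvar[OF p that] p.uminus[of "pvar k"] by auto
    then show "\<exists>h\<in>polys N. h \<notin> p \<and> (\<forall>k\<le>N. peval ?F (?G k) - h * pvar k \<in> p)"
      using p.one by (intro bexI[of _ 1]) auto
  next
    let ?F = "\<lambda>_::nat. pvar i" and ?G = "\<lambda>j. if j = i then pvar 0 else 0"
    fix p assume p: "p \<in> stratum 0 {0}"
    interpret p: point 0 p by (rule point_of_stratum[OF p])
    have 0: "pvar 0 \<notin> p" using stratum_pvar[OF p, of 0] by simp
    show "\<exists>k\<le>N. ?G k \<notin> p"
      using 0 i by auto
    show "point_map 0 p N ?G 1 \<Longrightarrow> pull N ?G p \<in> stratum N {i}"
      using 0 by (intro pull_stratum) auto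
    show "\<exists>h\<in>polys 0. h \<notin> p \<and> (\<forall>k\<le>0. peval ?G (?F k) - h * pvar k \<in> p)"
      using p.one by (intro bexI[of _ 1]) auto
  qed simp_all
  then have "gen (subvariety N (stratum N {i})) \<approx> gen (basic_open_variety 0 1)"
    unfolding eq by (intro K0_eq_relation rel_iso)
  also have "\<dots> \<approx> 1"
    by (intro K0_eq_relation rel_point)
  finally show ?thesis .
qed

text \<open>A stratum with one more nonvanishing coordinate \<open>x\<^sub>j\<close> is a product with \<open>\<G>\<^sub>m\<close> through
  \<open>x \<mapsto> ((x\<^sub>i)\<^sub>i\<^sub>\<in>\<^sub>S, [x\<^sub>k : x\<^sub>j])\<close> for any \<open>k \<in> S\<close>.\<close>

lemma class_stratum_insert:
  assumes S: "S \<subseteq> {..N}" and k: "k \<in> S" and j: "j \<notin> S" "j \<le> N"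
  shows "gen (subvariety N (stratum N (insert j S))) \<approx> gen (subvariety N (stratum N S)) * gen Gm"
proof -
  \<comment> \<open>\<open>segre_var 1 i l\<close> is the variable with number
    \<open>2 * i + l\<close>, so \<open>m div 2\<close> is the row and the parity of
    \<open>m\<close> the column: \<open>z_i0 = x_i x_k\<close> and \<open>z_i1 = x_i x_j\<close> for
    \<open>i\<close> in \<open>S\<close>.\<close>
  define F where "F m = (if m div 2 \<in> S then pvar (m div 2) * (if even m then pvar k else pvar j) else 0)" for m
  \<comment> \<open>The inverse reads \<open>x_i\<close> off column 0 and \<open>x_j\<close> off the
    entry \<open>z_k1 = x_k x_j\<close>, so that all recovered coordinates carry the same factor
    \<open>x_k\<close>.\<close>
  define G where "G i = (if i \<in> S then segre_var 1 i 0 else if i = j then segre_var 1 k 1 else 0)" for i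
  let ?D = "segre_dim N 1"
  have kN: "k \<le> N" using S k by auto
  have F_segre0: "peval F (segre_var 1 i 0) = (if i \<in> S then pvar i * pvar k else 0)"
    "peval F (segre_var 1 i 1) = (if i \<in> S then pvar i * pvar j else 0)" for i
    by (simp_all add: segre_var_def F_def)
  \<comment> \<open>The second copy matches goals in which the simplifier has rewritten the column
    index 1 to \<open>Suc 0\<close>.\<close>
  note F_segre = F_segre0 F_segre0[unfolded One_nat_def]
  have "isomorphic (subvariety N (stratum N (insert j S))) (subvariety ?D (segre_stratum N 1 S {0, 1}))"
  proof (rule isomorphic_subvarieties[OF locally_closed_stratum locally_closed_segre_stratum])
    show "F m \<in> homog N 2" if "m \<le> ?D" for m
    proof -
      have "pvar (m div 2) * x \<in> homog N (1 + 1)" if "m div 2 \<in> S" "x \<in> homog N 1" for x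
        using that S by (intro homog_mult homog_pvar) auto
      then show ?thesis
        unfolding F_def using kN j homog_pvar by (auto simp: numeral_2_eq_2)
    qed
    show "G i \<in> homog ?D 1" if "i \<le> N" for i
      using segre_var_homog[OF that, of 0 1] segre_var_homog[OF kN, of 1 1] by (simp add: G_def)
    fix p assume p: "p \<in> stratum N (insert j S)"
    interpret p: point N p by (rule point_of_stratum[OF p])
    have x: "pvar i \<notin> p \<longleftrightarrow> i \<in> insert j S" if "i \<le> N" for i
      using stratum_pvar[OF p that] .
    have Fx: "peval F (segre_var 1 i l) \<notin> p \<longleftrightarrow> i \<in> S" if "i \<le> N" "l \<le> 1" for i l
    proof -
      have "l = 0 \<or> l = 1" using that by auto
      then show ?thesis
        using that x[OF that(1)] x[OF kN] x[OF j(2)] k kN j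
        by (auto simp: F_segre p.mult_iff polys_pvar)
    qed
    show "\<exists>m\<le>?D. F m \<notin> p"
      using Fx[of k 0] k segre_index[OF kN, of 0 1] kN unfolding segre_var_def by auto
    show "pull ?D F p \<in> segre_stratum N 1 S {0, 1}" if "point_map N p ?D F 2"
    proof -
      have mem: "f \<in> pull ?D F p \<longleftrightarrow> peval F f \<in> p" if "f \<in> polys ?D" for f
        using that by (rule mem_pull)
      have sp: "segre_var 1 i l \<in> polys ?D" if "i \<le> N" "l \<le> 1" for i l
        using segre_var_homog[OF that] by (rule homog_polys)
      have "peval F (segre_var 1 i l * segre_var 1 i' l' - segre_var 1 i l' * segre_var 1 i' l) = 0"
        if "l \<le> 1" "l' \<le> 1" for i i' l l'
      proof -
        have "l = 0 \<or> l = 1" "l' = 0 \<or> l' = 1" using that by auto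
        then show ?thesis by (auto simp: F_segre)
      qed
      note 0 = this
      have "pull ?D F p \<in> segre_points N 1"
        unfolding segre_points_def mem_Collect_eq
      proof (intro conjI allI impI)
        fix i i' l l' :: nat assume "i \<le> N" "i' \<le> N" "l \<le> 1" "l' \<le> 1"
        moreover from this have "segre_var 1 i l * segre_var 1 i' l' - segre_var 1 i l' * segre_var 1 i' l \<in> polys ?D"
          by (intro polys_diff polys_mult sp)
        ultimately show "segre_var 1 i l * segre_var 1 i' l' - segre_var 1 i l' * segre_var 1 i' l \<in> pull ?D F p"
          by (simp only: mem 0 p.zero)
      qed (rule point_map.pull_point[OF that])
      then show ?thesis
        unfolding segre_stratum_def using Fx mem sp by auto
    qed
    \<comment> \<open>The common factor is \<open>x_k\<close>. Outside \<open>insert j S\<close>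
      both terms vanish at \<open>p\<close>, the first one identically.\<close>
    have "peval F (G i) - pvar k * pvar i \<in> p" if "i \<le> N" for i
    proof (cases "i \<in> insert j S")
      case True
      then show ?thesis using j k by (auto simp: G_def F_segre mult.commute)
    next
      case False
      then have "- (pvar k * pvar i) \<in> p"
        using x[OF that] kN by (intro p.uminus p.mult polys_pvar) auto
      then show ?thesis using False by (simp add: G_def)
    qed
    then show "\<exists>h\<in>polys N. h \<notin> p \<and> (\<forall>i\<le>N. peval F (G i) - h * pvar i \<in> p)"
      using x[OF kN] k polys_pvar[OF kN] by blast
  next
    fix p assume p: "p \<in> segre_stratum N 1 S {0, 1}"
    then interpret p: segre_point N 1 p by unfold_locales (simp add: segre_stratum_def)
    have z: "segre_var 1 i l \<notin> p \<longleftrightarrow> i \<in> S" if "i \<le> N" "l \<le> 1" for i l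
      using p that by (auto simp: segre_stratum_def)
    have Gz: "G i \<notin> p \<longleftrightarrow> i \<in> insert j S" if "i \<le> N" for i
      using z[OF that, of 0] z[OF kN, of 1] k by (auto simp: G_def)
    show "\<exists>i\<le>N. G i \<notin> p"
      using Gz[OF kN] kN k by blast
    show "pull N G p \<in> stratum N (insert j S)" if "point_map ?D p N G 1"
      using that Gz by (rule pull_stratum)
    \<comment> \<open>The common factor of the other composite is \<open>z_k0\<close>. In column 0
      the identity is formal; in column 1 it compares \<open>z_i0 z_k1\<close> with
      \<open>z_k0 z_i1\<close> and is a Segre relation.\<close>
    have "peval G (F m) - segre_var 1 k 0 * pvar m \<in> p" if m_le: "m \<le> ?D" for m
    proof -
      obtain i l where il: "i \<le> N" "l \<le> 1" "m = i * (1 + 1) + l"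
        using segre_index_cases[OF m_le] by metis
      then have m: "pvar m = segre_var 1 i l" by (simp add: segre_var_def)
      have Fm: "F m = peval F (segre_var 1 i l)" unfolding m[symmetric] by simp
      consider "i \<notin> S" | "i \<in> S" "l = 0" | "i \<in> S" "l = 1"
        using il(2) by linarith
      then show ?thesis
      proof cases
        case 1
        then have "F m = 0" using il(2) by (auto simp: Fm F_segre le_Suc_eq)
        moreover have "- (segre_var 1 k 0 * segre_var 1 i l) \<in> p"
          using 1 z[OF il(1,2)] kN by (intro p.uminus p.mult p.var_polys) auto
        ultimately show ?thesis by (simp add: m)
      next
        case 2
        then have "peval G (F m) = segre_var 1 i 0 * segre_var 1 k 0"
          using k by (simp add: Fm F_segre G_def)
        then show ?thesis using 2 by (simp add: m)
      next
        case 3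
        then have "peval G (F m) = segre_var 1 i 0 * segre_var 1 k 1"
          using k j by (simp add: Fm F_segre G_def)
        then show ?thesis
          using 3 p.segre_relation[OF il(1) kN, of 0 1] by (simp add: m mult.commute)
      qed
    qed
    then show "\<exists>h\<in>polys ?D. h \<notin> p \<and> (\<forall>m\<le>?D. peval G (F m) - h * pvar m \<in> p)"
      using z[OF kN, of 0] k p.var_polys[OF kN, of 0] by (intro bexI[of _ "segre_var 1 k 0"]) auto
  qed simp_all
  then have "gen (subvariety N (stratum N (insert j S))) \<approx> gen (subvariety ?D (segre_stratum N 1 S {0, 1}))"
    by (intro K0_eq_relation rel_iso)
  also have "\<dots> \<approx> gen (subvariety N (stratum N S)) * gen Gm"
    using k S by (intro K0_eq_sym[OF class_stratum_times_Gm]) auto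
  finally show ?thesis .
qed

lemma class_stratum:
  assumes "S \<subseteq> {..N}" "S \<noteq> {}"
  shows "gen (subvariety N (stratum N S)) \<approx> gen Gm ^ (card S - 1)"
proof -
  have "finite S" using assms(1) finite_subset by blast
  then show ?thesis using assms(2,1)
  proof (induction S rule: finite_ne_induct)
    case (singleton i)
    then show ?case using class_point[of i N] by simp
  next
    case (insert j S)
    then obtain k where k: "k \<in> S" by blast
    have "gen (subvariety N (stratum N (insert j S))) \<approx> gen (subvariety N (stratum N S)) * gen Gm"
      using insert k by (intro class_stratum_insert) auto
    also have "\<dots> \<approx> gen Gm ^ (card S - 1) * gen Gm"
      using insert by (intro K0_eq_mult K0_eq_refl) auto
    also have "\<dots> = gen Gm ^ (card (insert j S) - 1)"
    proof -
      have "card S > 0" using insert by (simp add: card_gt_0_iff)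
      then have "card (insert j S) - 1 = Suc (card S - 1)"
        using insert by simp
      then show ?thesis by (simp only: power_Suc2)
    qed
    finally show ?case .
  qed
qed

lemma stratum_empty: "stratum N {} = {}"
proof -
  have False if "p \<in> stratum N {}" for p
    using that point.ex_pvar[OF point_of_stratum[OF that]] stratum_pvar[OF that] by auto
  then show ?thesis by blast
qed


section \<open>The Kirchhoff polynomial of the banana graph on the torus\<close>

abbreviation banana_poly :: "nat \<Rightarrow> zpoly" where
  "banana_poly n \<equiv> kirchhoff (banana n)"

lemma banana_poly_homog: "banana_poly (Suc N) \<in> homog N N"
  unfolding kirchhoff_banana
proof (rule homog_sum)
  fix i assume "i \<in> {..<Suc N}"
  then have "card ({..<Suc N} - {i}) = N" by simp
  moreover have "(\<Prod>j\<in>{..<Suc N} - {i}. pvar j) \<in> homog N (card ({..<Suc N} - {i}))"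
    by (intro homog_prod_const homog_pvar) simp
  ultimately show "(\<Prod>j\<in>{..<Suc N} - {i}. pvar j) \<in> homog N N" by simp
qed

text \<open>Deletion and contraction of the edge \<open>n\<close>: deleting it leaves
  \<open>banana n\<close>, contracting it leaves \<open>n\<close> loops, whose Kirchhoff polynomial
  is the product of all variables.\<close>

lemma banana_poly_Suc: "banana_poly (Suc n) = banana_poly n * pvar n + (\<Prod>j<n. pvar j)"
proof -
  have "(\<Prod>j\<in>{..<Suc n} - {i}. pvar j) = (\<Prod>j\<in>{..<n} - {i}. pvar j) * (pvar n :: zpoly)" if "i < n" for i
  proof -
    have "{..<Suc n} - {i} = insert n ({..<n} - {i})" using that by auto
    then show ?thesis by (simp add: mult.commute)
  qed
  moreover have "{..<Suc n} - {n} = {..<n}" by auto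
  ultimately show ?thesis
    unfolding kirchhoff_banana by (simp add: sum_distrib_right)
qed

text \<open>The index \<open>N\<close> is the dimension of the torus; the graph has
  \<open>Suc N\<close> edges.\<close>

definition torus_hypersurface :: "nat \<Rightarrow> zpoly set set" where
  "torus_hypersurface N = {p \<in> stratum N {..N}. banana_poly (Suc N) \<in> p}"

definition torus_complement :: "nat \<Rightarrow> zpoly set set" where
  "torus_complement N = {p \<in> stratum N {..N}. banana_poly (Suc N) \<notin> p}"

lemma locally_closed_torus_hypersurface: "locally_closed_in (proj_top N) (torus_hypersurface N)"
  and locally_closed_torus_complement: "locally_closed_in (proj_top N) (torus_complement N)"
  using locally_closed_conditions[OF _ _ locally_closed_stratum, of "{banana_poly (Suc N)}" "{}" N "{..N}"]
    locally_closed_conditions[OF _ _ locally_closed_stratum, of "{}" "{banana_poly (Suc N)}" N "{..N}"]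
  by (simp_all add: torus_hypersurface_def torus_complement_def)

lemma polys_mono: "f \<in> polys N \<Longrightarrow> N \<le> M \<Longrightarrow> f \<in> polys M"
  unfolding polys_iff by (meson atMost_subset_iff subset_trans)

text \<open>On the torus, \<open>\<Psi>\<^sub>n\<^sub>+\<^sub>1 = \<Psi>\<^sub>n t\<^sub>n + \<Prod>t\<^sub>i\<close> vanishes iff \<open>t\<^sub>n = - \<Prod>t\<^sub>i / \<Psi>\<^sub>n\<close>: the graph of this function.\<close>

lemma torus_complement_iso:
  "isomorphic (subvariety N (torus_complement N)) (subvariety (Suc N) (torus_hypersurface (Suc N)))"
proof -
  let ?\<Psi> = "banana_poly (Suc N)" and ?x = "\<Prod>j<Suc N. pvar j :: zpoly"
  \<comment> \<open>The graph of \<open>x_(N+1) = - (product of the x_j) / \<Psi>\<close> with the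
    denominator cleared; all entries are forms of degree \<open>Suc N\<close>.\<close>
  define F where "F k = (if k = Suc N then - ?x else ?\<Psi> * pvar k)" for k
  have \<Psi>: "?\<Psi> \<in> polys N" and x: "?x \<in> polys N"
    using banana_poly_homog[of N] by (auto intro!: polys_prod polys_pvar)
  have x_homog: "?x \<in> homog N (Suc N)"
  proof -
    have "?x \<in> homog N (card {..<Suc N})"
      by (intro homog_prod_const homog_pvar) simp
    then show ?thesis by (simp only: card_lessThan)
  qed
  have F_Suc: "F (Suc N) = - ?x" by (simp add: F_def)
  have F_le: "F k = ?\<Psi> * pvar k" if "k \<le> N" for k using that by (simp add: F_def)
  \<comment> \<open>\<open>\<Psi>\<close> has degree \<open>N\<close> and does not involve the last
    variable, so the common factor \<open>\<Psi>\<close> comes out as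
    \<open>\<Psi> ^ N\<close>.\<close>
  have F_\<Psi>: "peval F ?\<Psi> = ?\<Psi> ^ N * ?\<Psi>"
  proof -
    have "peval F ?\<Psi> = peval (\<lambda>k. ?\<Psi> * pvar k) ?\<Psi>"
      using \<Psi> F_le by (rule peval_cong_polys)
    then show ?thesis by (simp add: peval_scale[OF banana_poly_homog] peval_pvar_self)
  qed
  have F_x: "peval F ?x = ?\<Psi> ^ Suc N * ?x"
  proof -
    have "peval F ?x = (\<Prod>j<Suc N. ?\<Psi> * pvar j)"
      by (simp add: F_le del: prod.lessThan_Suc)
    then show ?thesis by (simp add: prod.distrib del: prod.lessThan_Suc)
  qed
  \<comment> \<open>By the recursion the two summands are \<open>- \<Psi> ^ Suc N * ?x\<close> and
    \<open>\<Psi> ^ Suc N * ?x\<close>.\<close>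
  have F_\<Psi>': "peval F (banana_poly (Suc (Suc N))) = 0"
    unfolding banana_poly_Suc[of "Suc N"] peval_add peval_mult F_\<Psi> F_x peval_pvar F_Suc
    by (simp add: algebra_simps)
  show ?thesis
  proof (rule isomorphic_subvarieties[OF locally_closed_torus_complement locally_closed_torus_hypersurface])
    show "F k \<in> homog N (Suc N)" if "k \<le> Suc N" for k
    proof (cases "k = Suc N")
      case True
      then show ?thesis using x_homog by (simp add: F_Suc homog_uminus del: prod.lessThan_Suc)
    next
      case False
      then show ?thesis
        using that homog_mult[OF banana_poly_homog[of N] homog_pvar[of k N]] by (simp add: F_le)
    qed
    \<comment> \<open>The inverse is the projection that forgets the last coordinate; the remaining
      coordinates do not vanish on the torus.\<close>
    show "pvar k \<in> homog (Suc N) 1" if "k \<le> N" for k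
      using that by (intro homog_pvar) simp
    fix p assume p: "p \<in> torus_complement N"
    then have ps: "p \<in> stratum N {..N}" and p\<Psi>: "?\<Psi> \<notin> p"
      by (simp_all add: torus_complement_def)
    interpret p: point N p by (rule point_of_stratum[OF ps])
    have px: "pvar k \<notin> p" if "k \<le> N" for k
      using stratum_pvar[OF ps that] that by simp
    have "?x \<notin> p"
      using p.prod_iff[of "{..<Suc N}" pvar] px polys_pvar by auto
    then have F_p: "F k \<notin> p" if "k \<le> Suc N" for k
      using that px p\<Psi> p.uminus[of "- ?x"] p.mult_iff[OF \<Psi> polys_pvar[of k N]]
      by (cases "k = Suc N") (auto simp: F_Suc F_le simp del: prod.lessThan_Suc)
    show "\<exists>k\<le>Suc N. F k \<notin> p" using F_p by blast
    show "pull (Suc N) F p \<in> torus_hypersurface (Suc N)" if "point_map N p (Suc N) F (Suc N)"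
      unfolding torus_hypersurface_def mem_Collect_eq
    proof
      show "pull (Suc N) F p \<in> stratum (Suc N) {..Suc N}"
        using F_p by (intro pull_stratum[OF that]) auto
      show "banana_poly (Suc (Suc N)) \<in> pull (Suc N) F p"
        unfolding mem_pull[OF homog_polys[OF banana_poly_homog]] F_\<Psi>' by (rule p.zero)
    qed
    show "\<exists>h\<in>polys N. h \<notin> p \<and> (\<forall>k\<le>N. peval F (pvar k) - h * pvar k \<in> p)"
      using p\<Psi> \<Psi> by (intro bexI[of _ ?\<Psi>]) (auto simp: F_le)
  next
    fix p assume p: "p \<in> torus_hypersurface (Suc N)"
    then have ps: "p \<in> stratum (Suc N) {..Suc N}" and p\<Psi>: "banana_poly (Suc (Suc N)) \<in> p"
      by (simp_all add: torus_hypersurface_def)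
    interpret p: point "Suc N" p by (rule point_of_stratum[OF ps])
    have px: "pvar k \<notin> p" if "k \<le> Suc N" for k
      using stratum_pvar[OF ps that] that by simp
    have \<Psi>': "?\<Psi> \<in> polys (Suc N)"
      using \<Psi> by (rule polys_mono) simp
    have xp: "?x \<notin> p"
      using p.prod_iff[of "{..<Suc N}" pvar] px polys_pvar by auto
    have rel: "?\<Psi> * pvar (Suc N) + ?x \<in> p"
      using p\<Psi> unfolding banana_poly_Suc[of "Suc N"] .
    \<comment> \<open>If \<open>\<Psi>\<close> vanished, the equation of the hypersurface would
      force the product of the coordinates to vanish as well.\<close>
    have \<Psi>p: "?\<Psi> \<notin> p"
    proof
      assume "?\<Psi> \<in> p"
      then have "?\<Psi> * pvar (Suc N) \<in> p"
        by (rule p.mult') (simp add: polys_pvar)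
      from p.diff[OF rel this] show False using xp by simp
    qed
    show "\<exists>k\<le>N. pvar k \<notin> p" using px by auto
    show "pull N pvar p \<in> torus_complement N" if "point_map (Suc N) p N pvar 1"
      unfolding torus_complement_def mem_Collect_eq
    proof
      show "pull N pvar p \<in> stratum N {..N}"
        using px by (intro pull_stratum[OF that]) auto
      show "?\<Psi> \<notin> pull N pvar p"
        using \<Psi>p by (simp add: mem_pull[OF \<Psi>] peval_pvar_self)
    qed
    have "peval pvar (F k) - ?\<Psi> * pvar k \<in> p" if "k \<le> Suc N" for k
    proof (cases "k = Suc N")
      case True
      have "- (?\<Psi> * pvar (Suc N) + ?x) \<in> p"
        by (rule p.uminus[OF rel])
      moreover have "peval pvar (F k) - ?\<Psi> * pvar k = - (?\<Psi> * pvar (Suc N) + ?x)"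
        unfolding peval_pvar_self True F_Suc by (simp only: minus_add_distrib diff_conv_add_uminus add.commute)
      ultimately show ?thesis by (simp only:)
    next
      case False
      then show ?thesis using that by (simp add: peval_pvar_self F_le)
    qed
    then show "\<exists>h\<in>polys (Suc N). h \<notin> p \<and> (\<forall>k\<le>Suc N. peval pvar (F k) - h * pvar k \<in> p)"
      using \<Psi>p \<Psi>' by blast
  qed simp_all
qed

text \<open>This is the quotient of \<open>x^N - (-1)^N\<close> by \<open>x + 1\<close>, with
  leading term \<open>x^(N-1)\<close> and value 0 for \<open>N = 0\<close>.\<close>

definition alternating :: "nat \<Rightarrow> 'a::comm_ring_1 \<Rightarrow> 'a" where
  "alternating N x = (\<Sum>j<N. (-1) ^ (N - 1 - j) * x ^ j)"

lemma alternating_Suc: "alternating (Suc N) x = x ^ N - alternating N x"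
proof -
  have "(\<Sum>j<N. (-1) ^ (N - j) * x ^ j) = - (\<Sum>j<N. (-1) ^ (N - 1 - j) * x ^ j)"
    unfolding sum_negf[symmetric]
  proof (intro sum.cong refl)
    fix j assume "j \<in> {..<N}"
    then have "N - j = Suc (N - 1 - j)" by auto
    then show "(-1) ^ (N - j) * x ^ j = - ((-1) ^ (N - 1 - j) * x ^ j)" by simp
  qed
  then show ?thesis by (simp add: alternating_def)
qed

lemma class_torus_hypersurface: "gen (subvariety N (torus_hypersurface N)) \<approx> alternating N (gen Gm)"
  and class_torus_complement: "gen (subvariety N (torus_complement N)) \<approx> gen Gm ^ N - alternating N (gen Gm)"
proof -
  \<comment> \<open>Stated relative to the class of the hypersurface, because the induction below
    needs it at \<open>N\<close> in order to reach \<open>Suc N\<close>.\<close>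
  have complement: "gen (subvariety N (torus_complement N)) \<approx> gen Gm ^ N - alternating N (gen Gm)"
    if "gen (subvariety N (torus_hypersurface N)) \<approx> alternating N (gen Gm)" for N
  proof -
    have "gen (subvariety N (stratum N {..N})) \<approx> gen (subvariety N (torus_hypersurface N)) + gen (subvariety N (torus_complement N))"
      using scissor[OF locally_closed_stratum, of N "{..N}" "banana_poly (Suc N)"]
      by (simp add: torus_hypersurface_def torus_complement_def)
    moreover have "gen (subvariety N (stratum N {..N})) \<approx> gen Gm ^ N"
      using class_stratum[of "{..N}" N] by simp
    ultimately have "gen (subvariety N (torus_hypersurface N)) + gen (subvariety N (torus_complement N)) \<approx> gen Gm ^ N"
      using K0_eq_trans K0_eq_sym by blast
    from K0_eq_diff[OF this that] K0_eq_diff[OF K0_eq_refl that] show ?thesis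
      using K0_eq_diff[OF \<open>_ + _ \<approx> gen Gm ^ N\<close> K0_eq_refl[of "gen (subvariety N (torus_hypersurface N))"]]
        K0_eq_trans by (smt (verit, best) add_diff_cancel_left')
  qed
  show hyp: "gen (subvariety N (torus_hypersurface N)) \<approx> alternating N (gen Gm)" for N
  proof (induction N)
    case 0
    \<comment> \<open>With one edge the Kirchhoff polynomial is the constant 1.\<close>
    have "torus_hypersurface 0 = {}"
    proof -
      have "banana_poly (Suc 0) = 1" by (simp add: kirchhoff_banana lessThan_Suc)
      then have False if "p \<in> torus_hypersurface 0" for p
        using that point.one[OF point_of_stratum] by (auto simp: torus_hypersurface_def)
      then show ?thesis by blast
    qed
    then show ?case using class_empty by (simp add: alternating_def)
  next
    case (Suc N)
    have "gen (subvariety (Suc N) (torus_hypersurface (Suc N))) \<approx> gen (subvariety N (torus_complement N))"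
      by (intro K0_eq_sym[OF K0_eq_relation[OF rel_iso[OF torus_complement_iso]]])
    also have "\<dots> \<approx> alternating (Suc N) (gen Gm)"
      unfolding alternating_Suc by (rule complement[OF Suc])
    finally show ?case .
  qed
  show "gen (subvariety N (torus_complement N)) \<approx> gen Gm ^ N - alternating N (gen Gm)"
    by (rule complement[OF hyp])
qed


section \<open>Rational points over prime fields\<close>

text \<open>The residue field is F_q: \<open>q\<close> vanishes in it and every fraction
  \<open>f/g\<close> equals some \<open>- c\<close> with \<open>c < q\<close>. The sign is chosen so
  that the condition can be tested by adding 1 repeatedly, see \<open>plus_nat\<close>.\<close>

definition rational :: "nat \<Rightarrow> nat \<Rightarrow> zpoly set \<Rightarrow> bool" where
  "rational q N p \<longleftrightarrow> p \<in> proj_points N \<and> of_nat q \<in> p \<and>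
    (\<forall>d. \<forall>f\<in>homog N d. \<forall>g\<in>homog N d. g \<notin> p \<longrightarrow> (\<exists>c<q. f + of_nat c * g \<in> p))"

lemma point_of_pts: "p \<in> pts X \<Longrightarrow> point (pdim X) p"
  using pts_subset by unfold_locales auto

section \<open>Ring operations on sections of the structure sheaf\<close>

lemma sectionI:
  assumes "s \<in> extensional U"
    and "\<And>p. p \<in> U \<Longrightarrow> \<exists>V d f g. openin (vtop X) V \<and> p \<in> V \<and> V \<subseteq> U \<and> f \<in> homog (pdim X) d \<and>
      g \<in> homog (pdim X) d \<and> (\<forall>q\<in>V. g \<notin> q \<and> s q = hfrac (pdim X) q f g)"
  shows "s \<in> carrier (struct_sheaf X U)"
  unfolding carrier_struct_sheaf using assms by (intro conjI ballI) (assumption, meson)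

lemma section_local:
  assumes "s \<in> carrier (struct_sheaf X U)" "p \<in> U"
  obtains V d f g where "openin (vtop X) V" "p \<in> V" "V \<subseteq> U" "f \<in> homog (pdim X) d" "g \<in> homog (pdim X) d"
    "\<And>q. q \<in> V \<Longrightarrow> g \<notin> q" "\<And>q. q \<in> V \<Longrightarrow> s q = hfrac (pdim X) q f g"
  using assms unfolding carrier_struct_sheaf by meson

lemma section_fraction:
  assumes V: "openin (vtop X) V" and fg: "f \<in> homog (pdim X) d" "g \<in> homog (pdim X) d" and "\<And>q. q \<in> V \<Longrightarrow> g \<notin> q"
  shows "(\<lambda>q\<in>V. hfrac (pdim X) q f g) \<in> carrier (struct_sheaf X V)"
proof (rule sectionI)
  fix p assume "p \<in> V"
  then show "\<exists>W d f' g'. openin (vtop X) W \<and> p \<in> W \<and> W \<subseteq> V \<and> f' \<in> homog (pdim X) d \<and> g' \<in> homog (pdim X) d \<and>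
      (\<forall>q\<in>W. g' \<notin> q \<and> (\<lambda>q\<in>V. hfrac (pdim X) q f g) q = hfrac (pdim X) q f' g')"
    using assms by (intro exI[of _ V] exI[of _ d] exI[of _ f] exI[of _ g]) auto
qed (rule restrict_extensional)

lemma section_one:
  assumes "openin (vtop X) V" shows "\<one>\<^bsub>struct_sheaf X V\<^esub> \<in> carrier (struct_sheaf X V)"
proof -
  have "V \<subseteq> pts X" using openin_subset[OF assms] by simp
  then have "\<one>\<^bsub>struct_sheaf X V\<^esub> = (\<lambda>q\<in>V. hfrac (pdim X) q 1 1)"
    unfolding struct_sheaf_ops using point.residue_one[OF point_of_pts] by (intro restrict_ext) auto
  moreover have "(\<lambda>q\<in>V. hfrac (pdim X) q 1 1) \<in> carrier (struct_sheaf X V)"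
    using \<open>V \<subseteq> pts X\<close> point.one[OF point_of_pts] by (intro section_fraction[OF assms homog_1 homog_1]) blast
  ultimately show ?thesis by simp
qed

lemma section_restrict:
  assumes "s \<in> carrier (struct_sheaf X V)" "openin (vtop X) W" "W \<subseteq> V"
  shows "restrict s W \<in> carrier (struct_sheaf X W)"
proof (rule sectionI)
  fix p assume p: "p \<in> W"
  obtain U d f g where U: "openin (vtop X) U" "p \<in> U" "U \<subseteq> V" "f \<in> homog (pdim X) d" "g \<in> homog (pdim X) d"
    "\<And>q. q \<in> U \<Longrightarrow> g \<notin> q" "\<And>q. q \<in> U \<Longrightarrow> s q = hfrac (pdim X) q f g"
    by (rule section_local[OF assms(1) subsetD[OF assms(3) p]]) (rule that)
  then show "\<exists>V d f g. openin (vtop X) V \<and> p \<in> V \<and> V \<subseteq> W \<and> f \<in> homog (pdim X) d \<and> g \<in> homog (pdim X) d \<and>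
      (\<forall>q\<in>V. g \<notin> q \<and> restrict s W q = hfrac (pdim X) q f g)"
    using p openin_Int[OF U(1) assms(2)] by (intro exI[of _ "U \<inter> W"] exI[of _ d] exI[of _ f] exI[of _ g]) simp
qed (rule restrict_extensional)

lemma section_op:
  assumes V: "openin (vtop X) V" and s: "s \<in> carrier (struct_sheaf X V)" "t \<in> carrier (struct_sheaf X V)"
  shows section_mult: "s \<otimes>\<^bsub>struct_sheaf X V\<^esub> t \<in> carrier (struct_sheaf X V)"
    and section_add: "s \<oplus>\<^bsub>struct_sheaf X V\<^esub> t \<in> carrier (struct_sheaf X V)"
proof -
  have VX: "V \<subseteq> pts X" using openin_subset[OF V] by simp
  have *: "\<exists>W d e f g f' g'. openin (vtop X) W \<and> p \<in> W \<and> W \<subseteq> V \<and> f \<in> homog (pdim X) d \<and> g \<in> homog (pdim X) d \<and>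
      f' \<in> homog (pdim X) e \<and> g' \<in> homog (pdim X) e \<and>
      (\<forall>q\<in>W. g \<notin> q \<and> g' \<notin> q \<and> s q = hfrac (pdim X) q f g \<and> t q = hfrac (pdim X) q f' g')" if p: "p \<in> V" for p
  proof -
    obtain U d f g where U: "openin (vtop X) U" "p \<in> U" "U \<subseteq> V" "f \<in> homog (pdim X) d" "g \<in> homog (pdim X) d"
      "\<And>q. q \<in> U \<Longrightarrow> g \<notin> q" "\<And>q. q \<in> U \<Longrightarrow> s q = hfrac (pdim X) q f g"
      by (rule section_local[OF s(1) p]) (rule that)
    obtain U' d' f' g' where U': "openin (vtop X) U'" "p \<in> U'" "U' \<subseteq> V" "f' \<in> homog (pdim X) d'" "g' \<in> homog (pdim X) d'"
      "\<And>q. q \<in> U' \<Longrightarrow> g' \<notin> q" "\<And>q. q \<in> U' \<Longrightarrow> t q = hfrac (pdim X) q f' g'"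
      by (rule section_local[OF s(2) p]) (rule that)
    show ?thesis
      using U U' openin_Int[OF U(1) U'(1)]
      by (intro exI[of _ "U \<inter> U'"] exI[of _ d] exI[of _ d'] exI[of _ f] exI[of _ g] exI[of _ f'] exI[of _ g']) (simp add: le_infI1)
  qed
  show "s \<otimes>\<^bsub>struct_sheaf X V\<^esub> t \<in> carrier (struct_sheaf X V)"
  proof (rule sectionI)
    fix p assume "p \<in> V"
    then obtain W d e f g f' g' where W: "openin (vtop X) W" "p \<in> W" "W \<subseteq> V" "f \<in> homog (pdim X) d" "g \<in> homog (pdim X) d"
      "f' \<in> homog (pdim X) e" "g' \<in> homog (pdim X) e"
      and eq: "\<And>q. q \<in> W \<Longrightarrow> g \<notin> q \<and> g' \<notin> q \<and> s q = hfrac (pdim X) q f g \<and> t q = hfrac (pdim X) q f' g'"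
      using * by meson
    have "g * g' \<notin> q \<and> (s \<otimes>\<^bsub>struct_sheaf X V\<^esub> t) q = hfrac (pdim X) q (f * f') (g * g')" if q: "q \<in> W" for q
    proof -
      interpret point "pdim X" q using point_of_pts q W(3) VX by blast
      have h: "hpair (pdim X) q f g" "hpair (pdim X) q f' g'"
        using eq[OF q] W(4-7) unfolding hpair_def by blast+
      have "q \<in> V" using q W(3) by blast
      then show ?thesis
        using eq[OF q] residue_mult[OF h] hpair_mult[OF h] by (simp add: struct_sheaf_ops hpair_def)
    qed
    then show "\<exists>W d f g. openin (vtop X) W \<and> p \<in> W \<and> W \<subseteq> V \<and> f \<in> homog (pdim X) d \<and> g \<in> homog (pdim X) d \<and>
        (\<forall>q\<in>W. g \<notin> q \<and> (s \<otimes>\<^bsub>struct_sheaf X V\<^esub> t) q = hfrac (pdim X) q f g)"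
      using W homog_mult[OF W(4,6)] homog_mult[OF W(5,7)]
      by (intro exI[of _ W] exI[of _ "d + e"] exI[of _ "f * f'"] exI[of _ "g * g'"]) simp
  qed (simp only: struct_sheaf_ops restrict_extensional)
  show "s \<oplus>\<^bsub>struct_sheaf X V\<^esub> t \<in> carrier (struct_sheaf X V)"
  proof (rule sectionI)
    fix p assume "p \<in> V"
    then obtain W d e f g f' g' where W: "openin (vtop X) W" "p \<in> W" "W \<subseteq> V" "f \<in> homog (pdim X) d" "g \<in> homog (pdim X) d"
      "f' \<in> homog (pdim X) e" "g' \<in> homog (pdim X) e"
      and eq: "\<And>q. q \<in> W \<Longrightarrow> g \<notin> q \<and> g' \<notin> q \<and> s q = hfrac (pdim X) q f g \<and> t q = hfrac (pdim X) q f' g'"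
      using * by meson
    have "g * g' \<notin> q \<and> (s \<oplus>\<^bsub>struct_sheaf X V\<^esub> t) q = hfrac (pdim X) q (f * g' + f' * g) (g * g')" if q: "q \<in> W" for q
    proof -
      interpret point "pdim X" q using point_of_pts q W(3) VX by blast
      have h: "hpair (pdim X) q f g" "hpair (pdim X) q f' g'"
        using eq[OF q] W(4-7) unfolding hpair_def by blast+
      have "q \<in> V" using q W(3) by blast
      then show ?thesis
        using eq[OF q] residue_add[OF h] hpair_mult[OF h] by (simp add: struct_sheaf_ops hpair_def)
    qed
    moreover have "f * g' + f' * g \<in> homog (pdim X) (d + e)"
      using homog_mult[OF W(4,7)] homog_mult[OF W(6,5)] by (intro homog_add) (simp_all add: add.commute)
    ultimately show "\<exists>W d f g. openin (vtop X) W \<and> p \<in> W \<and> W \<subseteq> V \<and> f \<in> homog (pdim X) d \<and> g \<in> homog (pdim X) d \<and>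
        (\<forall>q\<in>W. g \<notin> q \<and> (s \<oplus>\<^bsub>struct_sheaf X V\<^esub> t) q = hfrac (pdim X) q f g)"
      using W homog_mult[OF W(5,7)]
      by (intro exI[of _ W] exI[of _ "d + e"] exI[of _ "f * g' + f' * g"] exI[of _ "g * g'"]) simp
  qed (simp only: struct_sheaf_ops restrict_extensional)
qed

text \<open>Built from addition and one alone, the operations that \<open>ring_iso\<close> preserves
  directly. In this way \<open>struct_sheaf\<close> need not be shown to satisfy the ring
  axioms.\<close>

definition plus_nat :: "('a, 'm) ring_scheme \<Rightarrow> nat \<Rightarrow> 'a \<Rightarrow> 'a" where
  "plus_nat R k x = ((\<lambda>y. y \<oplus>\<^bsub>R\<^esub> \<one>\<^bsub>R\<^esub>) ^^ k) x"

lemma plus_nat_Suc: "plus_nat R (Suc k) x = plus_nat R k x \<oplus>\<^bsub>R\<^esub> \<one>\<^bsub>R\<^esub>"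
  by (simp add: plus_nat_def)

lemma plus_nat_closed:
  assumes "openin (vtop X) V" "s \<in> carrier (struct_sheaf X V)"
  shows "plus_nat (struct_sheaf X V) k s \<in> carrier (struct_sheaf X V)"
  unfolding plus_nat_def using assms by (induction k) (auto intro: section_add section_one)

lemma plus_nat_value:
  assumes V: "openin (vtop X) V" "p \<in> V" and fg: "hpair (pdim X) p f g" "s p = hfrac (pdim X) p f g"
  shows "plus_nat (struct_sheaf X V) k s p = hfrac (pdim X) p (f + of_nat k * g) g \<and>
    hpair (pdim X) p (f + of_nat k * g) g"
proof -
  interpret point "pdim X" p
    using openin_subset[OF V(1)] V(2) by (intro point_of_pts) auto
  have h: "hpair (pdim X) p (f + of_nat k * g) g" for k
    using fg(1) by (auto simp: hpair_def)
  have "plus_nat (struct_sheaf X V) k s p = hfrac (pdim X) p (f + of_nat k * g) g"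
  proof (induction k)
    case (Suc k)
    have "plus_nat (struct_sheaf X V) (Suc k) s p = hfrac (pdim X) p (f + of_nat k * g) g \<oplus>\<^bsub>residue_field (pdim X) p\<^esub> hfrac (pdim X) p 1 1"
      using Suc V(2) by (simp add: plus_nat_def struct_sheaf_ops residue_one)
    also have "\<dots> = hfrac (pdim X) p (f + of_nat (Suc k) * g) g"
      using residue_add[OF h hpair_of_nat[of 1]] by (simp add: algebra_simps)
    finally show ?case .
  qed (simp add: plus_nat_def fg)
  with h show ?thesis by blast
qed

text \<open>The germ of \<open>s\<close> at \<open>p\<close> lies in the maximal ideal of the local
  ring, expressed without stalks. Open sets, restriction and units are all carried along by
  \<open>isomorphic\<close>.\<close>

definition nonunit_at :: "qp_variety \<Rightarrow> zpoly set \<Rightarrow> zpoly set set \<Rightarrow> (zpoly set \<Rightarrow> (zpoly \<times> zpoly) set) \<Rightarrow> bool" where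
  "nonunit_at X p V s \<longleftrightarrow>
    (\<forall>W. openin (vtop X) W \<and> p \<in> W \<and> W \<subseteq> V \<longrightarrow> restrict s W \<notin> Units (struct_sheaf X W))"

text \<open>If \<open>f\<close> vanishes at \<open>p\<close>, the value at \<open>p\<close> of an
  inverse would have to be the inverse of zero. If not, inverting the local fraction gives an
  inverse section where its numerator is nonzero.\<close>

lemma nonunit_at_iff:
  assumes V: "openin (vtop X) V" "p \<in> V" and s: "s \<in> carrier (struct_sheaf X V)"
    and fg: "hpair (pdim X) p f g" "s p = hfrac (pdim X) p f g"
  shows "nonunit_at X p V s \<longleftrightarrow> f \<in> p"
proof
  have VX: "V \<subseteq> pts X" using openin_subset[OF V(1)] by simp
  interpret point "pdim X" p
    using VX V(2) by (intro point_of_pts) auto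
  note fg_polys = hpair_polys[OF fg(1)]
  {
    assume "f \<in> p"
    show "nonunit_at X p V s"
      unfolding nonunit_at_def
    proof (intro allI impI notI)
      fix W assume W: "openin (vtop X) W \<and> p \<in> W \<and> W \<subseteq> V" and "restrict s W \<in> Units (struct_sheaf X W)"
      then obtain t where t: "t \<in> carrier (struct_sheaf X W)"
        "restrict s W \<otimes>\<^bsub>struct_sheaf X W\<^esub> t = \<one>\<^bsub>struct_sheaf X W\<^esub>"
        unfolding Units_def by blast
      obtain f' g' where fg': "hpair (pdim X) p f' g'" "t p = hfrac (pdim X) p f' g'"
        using section_value[OF t(1)] W by blast
      have "hfrac (pdim X) p (f * f') (g * g') = hfrac (pdim X) p 1 1"
        using fun_cong[OF t(2), of p] W fg(2) fg'(2) residue_mult[OF fg(1) fg'(1)]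
        by (simp add: struct_sheaf_ops residue_one)
      then have "f * f' - g * g' \<in> p"
        using hfrac_eq_iff[OF hpair_mult[OF fg(1) fg'(1)] hpair_of_nat[of 1]] by simp
      moreover have "f * f' \<in> p"
        using \<open>f \<in> p\<close> hpair_polys[OF fg'(1)] by (intro mult') auto
      ultimately have "g * g' \<in> p"
        using diff_mem_iff by blast
      then show False
        using hpair_mult[OF fg(1) fg'(1)] by (simp add: hpair_def)
    qed
  }
  assume nu: "nonunit_at X p V s"
  show "f \<in> p"
  proof (rule ccontr)
    assume f: "f \<notin> p"
    \<comment> \<open>The fraction \<open>f/g\<close> is known to represent \<open>s\<close> only at
      \<open>p\<close>; an inverse on a neighbourhood needs one that represents \<open>s\<close> on
      an open set.\<close>
    obtain U d f' g' where U: "openin (vtop X) U" "p \<in> U" "U \<subseteq> V" "f' \<in> homog (pdim X) d" "g' \<in> homog (pdim X) d"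
      "\<And>q. q \<in> U \<Longrightarrow> g' \<notin> q" "\<And>q. q \<in> U \<Longrightarrow> s q = hfrac (pdim X) q f' g'"
      by (rule section_local[OF s V(2)]) (rule that)
    have hp': "hpair (pdim X) p f' g'" using U by (auto simp: hpair_def)
    have "f' * g - f * g' \<in> p"
      using hfrac_eq_iff[OF hp' fg(1)] U(2,7) fg(2) by simp
    then have f': "f' \<notin> p"
      using diff_mem_iff[of "f' * g" "f * g'"] f U(2,6) fg_polys mult_iff[of f g'] mult'[of f' g] homog_polys[OF U(5)] by blast
    let ?W = "U \<inter> basic_open (pdim X) f'"
    have W: "openin (vtop X) ?W"
    proof -
      have "?W = U \<inter> (pts X \<inter> basic_open (pdim X) f')"
        using openin_subset[OF U(1)] by auto
      then show ?thesis using openin_Int[OF U(1) openin_vtop_basic] by simp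
    qed
    have pW: "p \<in> ?W" using U(2) f' p by (simp add: basic_open_def)
    let ?t = "\<lambda>q\<in>?W. hfrac (pdim X) q g' f'"
    have t: "?t \<in> carrier (struct_sheaf X ?W)"
      by (rule section_fraction[OF W U(5,4)]) (simp add: basic_open_def)
    have st: "hfrac (pdim X) q f' g' \<otimes>\<^bsub>residue_field (pdim X) q\<^esub> hfrac (pdim X) q g' f' = \<one>\<^bsub>residue_field (pdim X) q\<^esub> \<and>
        hfrac (pdim X) q g' f' \<otimes>\<^bsub>residue_field (pdim X) q\<^esub> hfrac (pdim X) q f' g' = \<one>\<^bsub>residue_field (pdim X) q\<^esub>"
      if q: "q \<in> ?W" for q
    proof -
      interpret q: point "pdim X" q
        using q openin_subset[OF W] by (intro point_of_pts) auto
      have h: "hpair (pdim X) q f' g'" "hpair (pdim X) q g' f'"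
        using q U by (auto simp: hpair_def basic_open_def)
      have "hfrac (pdim X) q (f' * g') (g' * f') = hfrac (pdim X) q 1 1"
        using q.hfrac_eq_iff[OF q.hpair_mult[OF h] q.hpair_of_nat[of 1]] by (simp add: mult.commute)
      then show ?thesis
        using q.residue_mult[OF h] q.residue_mult[OF h(2,1)] q.residue_one by (simp add: mult.commute)
    qed
    have "restrict s ?W \<otimes>\<^bsub>struct_sheaf X ?W\<^esub> ?t = \<one>\<^bsub>struct_sheaf X ?W\<^esub>"
      "?t \<otimes>\<^bsub>struct_sheaf X ?W\<^esub> restrict s ?W = \<one>\<^bsub>struct_sheaf X ?W\<^esub>"
      unfolding struct_sheaf_ops using st U(7) by (auto intro!: restrict_ext)
    moreover have "restrict s ?W \<in> carrier (struct_sheaf X ?W)"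
      using U(3) by (intro section_restrict[OF s W]) blast
    ultimately have "restrict s ?W \<in> Units (struct_sheaf X ?W)"
      unfolding Units_def using t by blast
    moreover have "?W \<subseteq> V" using U(3) by blast
    ultimately show False
      using nu W pW unfolding nonunit_at_def by blast
  qed
qed

text \<open>Whether the residue field of a point is \<open>\<F>\<^sub>q\<close> can be read off the structure sheaf: a section
  vanishes at \<open>p\<close> iff it is not invertible near \<open>p\<close>.\<close>

definition sheaf_rational :: "nat \<Rightarrow> qp_variety \<Rightarrow> zpoly set \<Rightarrow> bool" where
  "sheaf_rational q X p \<longleftrightarrow> (\<forall>V. openin (vtop X) V \<and> p \<in> V \<longrightarrow>
    nonunit_at X p V (plus_nat (struct_sheaf X V) (q - 1) \<one>\<^bsub>struct_sheaf X V\<^esub>) \<and>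
    (\<forall>s\<in>carrier (struct_sheaf X V). \<exists>c<q. nonunit_at X p V (plus_nat (struct_sheaf X V) c s)))"

lemma sheaf_rational_iff:
  assumes q: "q \<ge> 1" and pX: "p \<in> pts X"
  shows "sheaf_rational q X p \<longleftrightarrow> rational q (pdim X) p"
proof
  interpret point "pdim X" p by (rule point_of_pts[OF pX])
  have const: "nonunit_at X p V (plus_nat (struct_sheaf X V) (q - 1) \<one>\<^bsub>struct_sheaf X V\<^esub>) \<longleftrightarrow> of_nat q \<in> p"
    if V: "openin (vtop X) V" "p \<in> V" for V
  proof -
    have "\<one>\<^bsub>struct_sheaf X V\<^esub> p = hfrac (pdim X) p 1 1"
      using V by (simp add: struct_sheaf_ops residue_one)
    note v = plus_nat_value[where f = 1 and g = 1 and s = "\<one>\<^bsub>struct_sheaf X V\<^esub>" and k = "q - 1", OF V _ this]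
    \<comment> \<open>Starting from the section 1, \<open>q - 1\<close> further additions give
      \<open>q\<close>; natural subtraction makes this depend on \<open>q \<ge> 1\<close>.\<close>
    have "1 + of_nat (q - 1) * 1 = (of_nat q :: zpoly)"
      using q by (simp add: of_nat_diff)
    with v have v': "plus_nat (struct_sheaf X V) (q - 1) \<one>\<^bsub>struct_sheaf X V\<^esub> p = hfrac (pdim X) p (of_nat q) 1"
        "hpair (pdim X) p (of_nat q) 1"
      using hpair_of_nat[of 1] by simp_all
    show ?thesis
      by (rule nonunit_at_iff[OF V plus_nat_closed[OF V(1) section_one[OF V(1)]] v'(2,1)])
  qed
  have sec: "nonunit_at X p V (plus_nat (struct_sheaf X V) c s) \<longleftrightarrow> f + of_nat c * g \<in> p"
    if V: "openin (vtop X) V" "p \<in> V" and s: "s \<in> carrier (struct_sheaf X V)"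
      and fg: "hpair (pdim X) p f g" "s p = hfrac (pdim X) p f g" for V s f g c
    using plus_nat_value[where s = s and k = c, OF V fg]
    by (intro nonunit_at_iff[OF V plus_nat_closed[OF V(1) s]]) auto
  show "rational q (pdim X) p" if sr: "sheaf_rational q X p"
    unfolding rational_def
  proof (intro conjI allI ballI impI)
    show "p \<in> proj_points (pdim X)" by (rule p)
    show "of_nat q \<in> p"
      using const[of "pts X"] sr pX openin_topspace[of "vtop X"] unfolding sheaf_rational_def by auto
    fix d f g assume fg: "f \<in> homog (pdim X) d" "g \<in> homog (pdim X) d" "g \<notin> p"
    let ?V = "pts X \<inter> basic_open (pdim X) g"
    have V: "openin (vtop X) ?V" "p \<in> ?V"
      using openin_vtop_basic pX fg(3) p by (auto simp: basic_open_def)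
    have s: "(\<lambda>q\<in>?V. hfrac (pdim X) q f g) \<in> carrier (struct_sheaf X ?V)"
      by (rule section_fraction[OF V(1) fg(1,2)]) (simp add: basic_open_def)
    have "hpair (pdim X) p f g" using fg by (auto simp: hpair_def)
    note sec' = sec[OF V s this]
    obtain c where "c < q" "nonunit_at X p ?V (plus_nat (struct_sheaf X ?V) c (\<lambda>q\<in>?V. hfrac (pdim X) q f g))"
      using sr V s unfolding sheaf_rational_def by meson
    then show "\<exists>c<q. f + of_nat c * g \<in> p"
      using sec'[of c] V(2) by (metis restrict_apply')
  qed
  show "sheaf_rational q X p" if r: "rational q (pdim X) p"
    unfolding sheaf_rational_def
  proof (intro allI impI conjI ballI; elim conjE)
    fix V assume V: "openin (vtop X) V" "p \<in> V"
    show "nonunit_at X p V (plus_nat (struct_sheaf X V) (q - 1) \<one>\<^bsub>struct_sheaf X V\<^esub>)"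
      using const[OF V] r by (simp add: rational_def)
    fix s assume s: "s \<in> carrier (struct_sheaf X V)"
    obtain f g where fg: "hpair (pdim X) p f g" "s p = hfrac (pdim X) p f g"
      using section_value[OF s V(2)] .
    then obtain c where "c < q" "f + of_nat c * g \<in> p"
      using r unfolding rational_def hpair_def by blast
    then show "\<exists>c<q. nonunit_at X p V (plus_nat (struct_sheaf X V) c s)"
      using sec[OF V s fg] by blast
  qed
qed

section \<open>Invariance of rationality under isomorphism\<close>

lemma ring_iso_Units_iff:
  assumes h: "h \<in> ring_iso R S" and x: "x \<in> carrier R"
    and closed: "\<one>\<^bsub>R\<^esub> \<in> carrier R" "\<And>y z. y \<in> carrier R \<Longrightarrow> z \<in> carrier R \<Longrightarrow> y \<otimes>\<^bsub>R\<^esub> z \<in> carrier R"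
  shows "h x \<in> Units S \<longleftrightarrow> x \<in> Units R"
proof -
  have hom: "h \<in> ring_hom R S" and bij: "bij_betw h (carrier R) (carrier S)"
    using h by (auto simp: ring_iso_def)
  have inj: "h y = h z \<longleftrightarrow> y = z" if "y \<in> carrier R" "z \<in> carrier R" for y z
    using bij that by (auto simp: bij_betw_def inj_on_def)
  have "(\<exists>y\<in>carrier S. y \<otimes>\<^bsub>S\<^esub> h x = \<one>\<^bsub>S\<^esub> \<and> h x \<otimes>\<^bsub>S\<^esub> y = \<one>\<^bsub>S\<^esub>) \<longleftrightarrow>
      (\<exists>y\<in>carrier R. h y \<otimes>\<^bsub>S\<^esub> h x = h \<one>\<^bsub>R\<^esub> \<and> h x \<otimes>\<^bsub>S\<^esub> h y = h \<one>\<^bsub>R\<^esub>)"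
    unfolding bij_betw_imp_surj_on[OF bij, symmetric] ring_hom_one[OF hom] by blast
  also have "\<dots> \<longleftrightarrow> (\<exists>y\<in>carrier R. y \<otimes>\<^bsub>R\<^esub> x = \<one>\<^bsub>R\<^esub> \<and> x \<otimes>\<^bsub>R\<^esub> y = \<one>\<^bsub>R\<^esub>)"
    using x closed by (intro bex_cong refl) (simp add: ring_hom_mult[OF hom, symmetric] inj)
  finally show ?thesis
    using x ring_hom_closed[OF hom x] unfolding Units_def mem_Collect_eq by blast
qed

text \<open>\<open>\<phi>\<close> is an arbitrary homeomorphism with no known relation to values in
  residue fields, so rationality is transported as \<open>sheaf_rational\<close>: units,
  restrictions and sums of sections correspond under \<open>\<psi>\<close>.\<close>

lemma isomorphic_rational:
  assumes iso: "isomorphic X Y" and q: "q \<ge> 1"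
  obtains \<phi> where "bij_betw \<phi> (pts X) (pts Y)"
    "\<And>p. p \<in> pts X \<Longrightarrow> rational q (pdim Y) (\<phi> p) \<longleftrightarrow> rational q (pdim X) p"
proof -
  obtain \<phi> \<psi> where hm: "homeomorphic_map (vtop X) (vtop Y) \<phi>"
    and \<psi>: "\<And>V. openin (vtop Y) V \<Longrightarrow> \<psi> V \<in> ring_iso (struct_sheaf Y V) (struct_sheaf X {p \<in> pts X. \<phi> p \<in> V})"
    and res: "\<And>V W s. openin (vtop Y) V \<Longrightarrow> openin (vtop Y) W \<Longrightarrow> W \<subseteq> V \<Longrightarrow> s \<in> carrier (struct_sheaf Y V) \<Longrightarrow>
      \<psi> W (restrict s W) = restrict (\<psi> V s) {p \<in> pts X. \<phi> p \<in> W}"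
  proof -
    obtain \<phi> \<psi> where *: "homeomorphic_map (vtop X) (vtop Y) \<phi>"
      "\<forall>V. openin (vtop Y) V \<longrightarrow> \<psi> V \<in> ring_iso (struct_sheaf Y V) (struct_sheaf X {p \<in> pts X. \<phi> p \<in> V})"
      "\<forall>V W. openin (vtop Y) V \<and> openin (vtop Y) W \<and> W \<subseteq> V \<longrightarrow> (\<forall>s\<in>carrier (struct_sheaf Y V).
        \<psi> W (restrict s W) = restrict (\<psi> V s) {p \<in> pts X. \<phi> p \<in> W})"
      using iso unfolding isomorphic_def by (elim exE conjE)
    from * show ?thesis by (intro that[of \<phi> \<psi>]) simp_all
  qed
  define pre where "pre V = {p \<in> pts X. \<phi> p \<in> V}" for V
  have bij: "bij_betw \<phi> (pts X) (pts Y)"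
    using homeomorphic_imp_injective_map[OF hm] homeomorphic_imp_surjective_map[OF hm] by (simp add: bij_betw_def)
  have open_pre: "openin (vtop X) (pre V)" if "openin (vtop Y) V" for V
    using openin_continuous_map_preimage[OF homeomorphic_imp_continuous_map[OF hm] that] by (simp add: pre_def)
  have image: "openin (vtop Y) (\<phi> ` U)" "pre (\<phi> ` U) = U" if U: "openin (vtop X) U" for U
  proof -
    show "openin (vtop Y) (\<phi> ` U)"
      using homeomorphic_imp_open_map[OF hm] U by (simp add: open_map_def)
    show "pre (\<phi> ` U) = U"
      using openin_subset[OF U] bij by (auto simp: pre_def bij_betw_def inj_on_def)
  qed
  note \<psi>' = \<psi>[folded pre_def] and res' = res[folded pre_def]
  have hom: "\<psi> V \<in> ring_hom (struct_sheaf Y V) (struct_sheaf X (pre V))" if "openin (vtop Y) V" for V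
    using \<psi>'[OF that] by (simp add: ring_iso_def)
  have nonunit: "nonunit_at X p (pre V) (\<psi> V s) \<longleftrightarrow> nonunit_at Y (\<phi> p) V s"
    if V: "openin (vtop Y) V" "s \<in> carrier (struct_sheaf Y V)" "p \<in> pts X" for V s p
  proof -
    have u: "restrict (\<psi> V s) (pre W) \<in> Units (struct_sheaf X (pre W)) \<longleftrightarrow> restrict s W \<in> Units (struct_sheaf Y W)"
      if W: "openin (vtop Y) W" "W \<subseteq> V" for W
      unfolding res'[OF V(1) W V(2), symmetric]
      by (rule ring_iso_Units_iff[OF \<psi>'[OF W(1)] section_restrict[OF V(2) W] section_one[OF W(1)] section_mult[OF W(1)]])
    \<comment> \<open>A homeomorphism makes every open subset of \<open>X\<close> a preimage, so
      quantifying over preimages \<open>pre W\<close> loses nothing.\<close>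
    have "nonunit_at X p (pre V) (\<psi> V s) \<longleftrightarrow>
        (\<forall>W. openin (vtop Y) W \<and> p \<in> pre W \<and> pre W \<subseteq> pre V \<longrightarrow> restrict (\<psi> V s) (pre W) \<notin> Units (struct_sheaf X (pre W)))"
      unfolding nonunit_at_def
    proof (intro iffI allI impI; elim conjE)
      fix W assume "\<forall>W. openin (vtop X) W \<and> p \<in> W \<and> W \<subseteq> pre V \<longrightarrow> restrict (\<psi> V s) W \<notin> Units (struct_sheaf X W)"
        and "openin (vtop Y) W" "p \<in> pre W" "pre W \<subseteq> pre V"
      then show "restrict (\<psi> V s) (pre W) \<notin> Units (struct_sheaf X (pre W))"
        using open_pre by blast
    next
      fix U assume a: "\<forall>W. openin (vtop Y) W \<and> p \<in> pre W \<and> pre W \<subseteq> pre V \<longrightarrow> restrict (\<psi> V s) (pre W) \<notin> Units (struct_sheaf X (pre W))"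
        and U: "openin (vtop X) U" "p \<in> U" "U \<subseteq> pre V"
      show "restrict (\<psi> V s) U \<notin> Units (struct_sheaf X U)"
        using a[rule_format, of "\<phi> ` U"] U(2,3) unfolding image(2)[OF U(1)] using image(1)[OF U(1)] by blast
    qed
    also have "\<dots> \<longleftrightarrow> (\<forall>W. openin (vtop Y) W \<and> \<phi> p \<in> W \<and> W \<subseteq> V \<longrightarrow> restrict s W \<notin> Units (struct_sheaf Y W))"
    proof -
      have "pre W \<subseteq> pre V \<longleftrightarrow> W \<subseteq> V" if "openin (vtop Y) W" for W
      proof
        assume le: "pre W \<subseteq> pre V"
        have "W \<subseteq> \<phi> ` pts X"
          using openin_subset[OF that] bij_betw_imp_surj_on[OF bij] by simp
        then have "W \<subseteq> \<phi> ` pre W" unfolding pre_def by blast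
        with le show "W \<subseteq> V" unfolding pre_def by blast
      qed (auto simp: pre_def)
      moreover have "p \<in> pre W \<longleftrightarrow> \<phi> p \<in> W" for W using V(3) by (simp add: pre_def)
      ultimately show ?thesis using u by metis
    qed
    finally show ?thesis by (simp add: nonunit_at_def)
  qed
  have pn: "\<psi> V (plus_nat (struct_sheaf Y V) k s) = plus_nat (struct_sheaf X (pre V)) k (\<psi> V s)"
    if V: "openin (vtop Y) V" "s \<in> carrier (struct_sheaf Y V)" for V s k
  proof (induction k)
    case (Suc k)
    have "\<psi> V (plus_nat (struct_sheaf Y V) (Suc k) s) =
        \<psi> V (plus_nat (struct_sheaf Y V) k s) \<oplus>\<^bsub>struct_sheaf X (pre V)\<^esub> \<one>\<^bsub>struct_sheaf X (pre V)\<^esub>"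
      by (simp only: plus_nat_Suc ring_hom_add[OF hom[OF V(1)] plus_nat_closed[OF V] section_one[OF V(1)]] ring_hom_one[OF hom[OF V(1)]])
    then show ?case by (simp only: Suc plus_nat_Suc)
  qed (simp add: plus_nat_def)
  have sr: "sheaf_rational q Y (\<phi> p) \<longleftrightarrow> sheaf_rational q X p" if p: "p \<in> pts X" for p
  proof -
    have "(nonunit_at X p (pre V) (plus_nat (struct_sheaf X (pre V)) (q - 1) \<one>\<^bsub>struct_sheaf X (pre V)\<^esub>) \<and>
        (\<forall>s\<in>carrier (struct_sheaf X (pre V)). \<exists>c<q. nonunit_at X p (pre V) (plus_nat (struct_sheaf X (pre V)) c s))) \<longleftrightarrow>
      (nonunit_at Y (\<phi> p) V (plus_nat (struct_sheaf Y V) (q - 1) \<one>\<^bsub>struct_sheaf Y V\<^esub>) \<and>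
        (\<forall>s\<in>carrier (struct_sheaf Y V). \<exists>c<q. nonunit_at Y (\<phi> p) V (plus_nat (struct_sheaf Y V) c s)))"
      if V: "openin (vtop Y) V" for V
    proof -
      have carr: "carrier (struct_sheaf X (pre V)) = \<psi> V ` carrier (struct_sheaf Y V)"
        using \<psi>'[OF V] by (simp add: ring_iso_def bij_betw_def)
      have one: "\<one>\<^bsub>struct_sheaf X (pre V)\<^esub> = \<psi> V \<one>\<^bsub>struct_sheaf Y V\<^esub>"
        by (rule ring_hom_one[OF hom[OF V], symmetric])
      have nu: "nonunit_at X p (pre V) (plus_nat (struct_sheaf X (pre V)) c (\<psi> V s)) \<longleftrightarrow>
          nonunit_at Y (\<phi> p) V (plus_nat (struct_sheaf Y V) c s)" if s: "s \<in> carrier (struct_sheaf Y V)" for c s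
        unfolding pn[OF V s, symmetric] by (rule nonunit[OF V plus_nat_closed[OF V s] p])
      show ?thesis
        unfolding one nu[OF section_one[OF V]] carr ball_simps using nu by (meson image_iff)
    qed
    note eq = this
    have pV: "p \<in> pre V \<longleftrightarrow> \<phi> p \<in> V" for V using p by (simp add: pre_def)
    show ?thesis
    proof
      assume "sheaf_rational q X p"
      then show "sheaf_rational q Y (\<phi> p)"
        unfolding sheaf_rational_def using eq open_pre pV by meson
    next
      assume Y: "sheaf_rational q Y (\<phi> p)"
      show "sheaf_rational q X p"
        unfolding sheaf_rational_def
      proof (intro allI impI)
        fix U assume U: "openin (vtop X) U \<and> p \<in> U"
        then have "openin (vtop Y) (\<phi> ` U)" "pre (\<phi> ` U) = U" "\<phi> p \<in> \<phi> ` U"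
          using image by auto
        then show "nonunit_at X p U (plus_nat (struct_sheaf X U) (q - 1) \<one>\<^bsub>struct_sheaf X U\<^esub>) \<and>
            (\<forall>s\<in>carrier (struct_sheaf X U). \<exists>c<q. nonunit_at X p U (plus_nat (struct_sheaf X U) c s))"
          using eq[of "\<phi> ` U"] Y unfolding sheaf_rational_def by simp
      qed
    qed
  qed
  have "rational q (pdim Y) (\<phi> p) \<longleftrightarrow> rational q (pdim X) p" if p: "p \<in> pts X" for p
  proof -
    have "\<phi> p \<in> pts Y" using bij p by (auto simp: bij_betw_def)
    then show ?thesis using sr[OF p] sheaf_rational_iff[OF q] p by blast
  qed
  then show ?thesis using that bij by blast
qed


section \<open>Counting rational points\<close>

lemma peval_of_int_hom: "peval (\<lambda>i. of_int (a i)) f = of_int (peval a f)"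
  by (simp add: peval_def meval_def)

lemma peval_const_poly:
  fixes a :: "'a \<Rightarrow> 'b::comm_ring_1"
  shows "peval (\<lambda>i. [:a i:]) f = [:peval a f:]"
proof -
  have c: "[:x:] ^ n = [:x ^ n:]" for x :: 'b and n
    by (induction n) (simp_all add: mult.commute)
  have "(\<Prod>i\<in>A. [:h i:]) = [:prod h A:]" for A and h :: "'a \<Rightarrow> 'b"
    by (induction A rule: infinite_finite_induct) (simp_all add: mult.commute)
  then have m: "meval (\<lambda>i. [:a i:]) m = [:meval a m:]" for m
    by (simp add: meval_def c)
  have "(\<Sum>i\<in>A. [:h i:]) = [:sum h A:]" for A and h :: "('a \<Rightarrow>\<^sub>0 nat) \<Rightarrow> 'b"
    by (induction A rule: infinite_finite_induct) simp_all
  then show ?thesis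
    by (simp add: peval_def m of_int_poly mult.commute)
qed

lemma cong_peval_int:
  assumes f: "f \<in> polys N" and \<sigma>: "\<And>i. i \<le> N \<Longrightarrow> [a i = b i] (mod m)"
  shows "[peval a f = peval b f] (mod (m :: int))"
  unfolding peval_def meval_def
  using f by (intro cong_sum cong_mult cong_refl cong_prod cong_pow \<sigma>) (auto simp: polys_iff)

text \<open>The point with coordinates \<open>a\<close> modulo \<open>q\<close>: the kernel of \<open>x\<^sub>i \<mapsto> a\<^sub>i t\<close> into \<open>\<F>\<^sub>q[t]\<close>.\<close>

definition rpoint :: "nat \<Rightarrow> nat \<Rightarrow> (nat \<Rightarrow> int) \<Rightarrow> zpoly set" where
  "rpoint q N a = {f \<in> polys N. [:int q:] dvd peval (\<lambda>i. [:0, a i:]) f}"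

definition nonzero_coords :: "nat \<Rightarrow> nat \<Rightarrow> (nat \<Rightarrow> int) \<Rightarrow> bool" where
  "nonzero_coords q N a \<longleftrightarrow> (\<exists>i\<le>N. \<not> int q dvd a i)"

lemma peval_line:
  assumes "f \<in> homog N d" shows "peval (\<lambda>i. [:0, a i:]) f = monom (peval a f) d"
proof -
  have "(\<lambda>i. [:0, a i:]) = (\<lambda>i. [:0, 1:] * [:a i:])" by simp
  then have "peval (\<lambda>i. [:0, a i:]) f = [:0, 1:] ^ d * [:peval a f:]"
    using peval_scale[OF assms, of "[:0, 1:]" "\<lambda>i. [:a i:]"] by (simp only: peval_const_poly)
  then show ?thesis by (simp add: monom_altdef)
qed

lemma mem_rpoint:
  assumes "f \<in> homog N d" shows "f \<in> rpoint q N a \<longleftrightarrow> int q dvd peval a f"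
  using homog_polys[OF assms] by (auto simp: rpoint_def peval_line[OF assms] const_poly_dvd_iff coeff_monom)

text \<open>The powers of the polynomial variable keep the homogeneous components apart:
  \<open>q\<close> divides the whole polynomial iff it divides the value of each component. This
  makes \<open>rpoint\<close> a homogeneous ideal.\<close>

lemma coeff_peval_line:
  assumes f: "f \<in> polys N" shows "coeff (peval (\<lambda>i. [:0, a i:]) f) d = peval a (hcomp d f)"
proof -
  let ?D = "mdeg ` Poly_Mapping.keys f"
  have "peval (\<lambda>i. [:0, a i:]) f = (\<Sum>k\<in>?D. peval (\<lambda>i. [:0, a i:]) (hcomp k f))"
    by (subst (1) sum_hcomp[symmetric]) simp
  also have "\<dots> = (\<Sum>k\<in>?D. monom (peval a (hcomp k f)) k)"
    by (intro sum.cong refl peval_line[OF hcomp_homog[OF f]])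
  finally have "coeff (peval (\<lambda>i. [:0, a i:]) f) d = (\<Sum>k\<in>?D. if k = d then peval a (hcomp k f) else 0)"
    by (simp add: coeff_sum)
  also have "\<dots> = peval a (hcomp d f)"
  proof (cases "d \<in> ?D")
    case False
    then have "hcomp d f = 0"
      by (intro poly_mapping_eqI) (auto simp: lookup_hcomp in_keys_iff)
    then show ?thesis using False by (simp add: sum.delta')
  qed (simp add: sum.delta')
  finally show ?thesis .
qed

lemma rpoint_point:
  assumes q: "prime q" and a: "nonzero_coords q N a"
  shows "rpoint q N a \<in> proj_points N"
proof -
  \<comment> \<open>A prime number stays prime in the polynomial ring over the integers; this gives
    primality of the kernel.\<close>
  have pe: "prime_elem [:int q:]"
    using q by (intro lift_prime_elem_poly) auto
  obtain i where i: "i \<le> N" "\<not> int q dvd a i"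
    using a by (auto simp: nonzero_coords_def)
  show ?thesis
  proof (rule proj_pointsI)
    show "i \<le> N" by fact
    show "pvar i \<notin> rpoint q N a"
      using mem_rpoint[OF homog_pvar[OF i(1)]] i(2) by simp
    show "rpoint q N a \<subseteq> polys N" "0 \<in> rpoint q N a"
      by (auto simp: rpoint_def)
    show "f + g \<in> rpoint q N a" if "f \<in> rpoint q N a" "g \<in> rpoint q N a" for f g
      using that by (auto simp: rpoint_def)
    show "f * g \<in> rpoint q N a" if "f \<in> rpoint q N a" "g \<in> polys N" for f g
      using that polys_mult[of f N g] by (simp add: rpoint_def)
    show "f \<in> rpoint q N a \<or> g \<in> rpoint q N a"
      if "f \<in> polys N" "g \<in> polys N" "f * g \<in> rpoint q N a" for f g
      using that prime_elem_dvd_mult_iff[OF pe] by (simp add: rpoint_def)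
    show "hcomp d f \<in> rpoint q N a" if "f \<in> rpoint q N a" for f d
    proof -
      have f: "f \<in> polys N" "[:int q:] dvd peval (\<lambda>i. [:0, a i:]) f"
        using that by (simp_all add: rpoint_def)
      then have "int q dvd peval a (hcomp d f)"
        unfolding const_poly_dvd_iff coeff_peval_line[OF f(1)] by blast
      then show ?thesis using mem_rpoint[OF hcomp_homog[OF f(1)]] by simp
    qed
  qed
qed

lemma ex_inverse_mod:
  assumes "prime q" "\<not> int q dvd x" obtains y where "[x * y = 1] (mod int q)"
proof -
  have "coprime (int q) x"
    using assms by (intro prime_imp_coprime) auto
  then show ?thesis
    using cong_solve_coprime_int[of x "int q"] that by (auto simp: coprime_commute)
qed

lemma rpoint_rational:
  assumes q: "prime q" and a: "nonzero_coords q N a"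
  shows "rational q N (rpoint q N a)"
  unfolding rational_def
proof (intro conjI allI ballI impI)
  show "rpoint q N a \<in> proj_points N" by (rule rpoint_point[OF q a])
  show "of_nat q \<in> rpoint q N a"
    by (simp add: mem_rpoint[OF homog_of_nat])
  fix d f g assume f: "f \<in> homog N d" and g: "g \<in> homog N d" "g \<notin> rpoint q N a"
  have "\<not> int q dvd peval a g" using g mem_rpoint by blast
  from ex_inverse_mod[OF q this] obtain y where y: "[peval a g * y = 1] (mod int q)" .
  \<comment> \<open>The representative of \<open>- f(a) / g(a)\<close> modulo \<open>q\<close>, with
    \<open>y\<close> inverse to \<open>g(a)\<close>.\<close>
  define c where "c = nat ((- peval a f * y) mod int q)"
  have q0: "q > 0" using q by (simp add: prime_gt_0_nat)
  have c: "int c = (- peval a f * y) mod int q" using q0 by (simp add: c_def)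
  have "c < q" using q0 by (simp add: c_def nat_less_iff)
  moreover have "[peval a f + int c * peval a g = 0] (mod int q)"
  proof -
    have "[int c = - peval a f * y] (mod int q)" by (simp add: c cong_def)
    then have "[peval a f + int c * peval a g = peval a f + (- peval a f * y) * peval a g] (mod int q)"
      by (intro cong_add cong_mult cong_refl)
    also have "peval a f + (- peval a f * y) * peval a g = peval a f - peval a f * (peval a g * y)"
      by (simp add: algebra_simps)
    also have "[\<dots> = peval a f - peval a f * 1] (mod int q)"
      by (intro cong_diff cong_mult cong_refl y)
    finally show ?thesis by simp
  qed
  then have "f + of_nat c * g \<in> rpoint q N a"
    using mem_rpoint[of "f + of_nat c * g" N d q a] f g by (auto simp: cong_0_iff)
  ultimately show "\<exists>c<q. f + of_nat c * g \<in> rpoint q N a" by blast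
qed

text \<open>The integers in \<open>p\<close> form a proper ideal containing \<open>q\<close>, and
  \<open>q\<close> generates a maximal ideal: an integer prime to \<open>q\<close> would put 1 into
  \<open>p\<close>.\<close>

lemma (in point) of_int_mem_iff:
  assumes q: "prime q" "of_nat q \<in> p" shows "of_int m \<in> p \<longleftrightarrow> int q dvd m"
proof
  assume m: "of_int m \<in> p"
  show "int q dvd m"
  proof (rule ccontr)
    assume "\<not> int q dvd m"
    from ex_inverse_mod[OF q(1) this] obtain y where "[m * y = 1] (mod int q)" .
    then obtain k where "m * y - 1 = int q * k"
      by (auto simp: cong_iff_dvd_diff)
    then have 1: "m * y - int q * k = 1" by simp
    have "of_int (m * y - int q * k) \<in> p"
      unfolding of_int_diff of_int_mult of_int_of_nat_eq by (intro diff mult' m q(2) polys_of_int)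
    then show False using one by (simp add: 1)
  qed
next
  assume "int q dvd m"
  then obtain k where "m = int q * k" by blast
  then show "of_int m \<in> p" using mult'[OF q(2), of "of_int k"] by simp
qed

text \<open>Normalise by a coordinate \<open>x_k\<close> that does not vanish: each
  \<open>x_j / x_k\<close> equals \<open>- c_j\<close> in F_q, and these integers are the
  coordinates. Their bounded range leaves finitely many rational points.\<close>

lemma rational_eq_rpoint:
  assumes q: "prime q" and rp: "rational q N p"
  obtains a where "nonzero_coords q N a" "a \<in> {..N} \<rightarrow>\<^sub>E {- int q<..0}" "p = rpoint q N a"
proof -
  interpret point N p using rp by unfold_locales (simp add: rational_def)
  have qp: "of_nat q \<in> p" using rp by (simp add: rational_def)
  obtain k where k: "k \<le> N" "pvar k \<notin> p" using ex_pvar by blast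
  have "\<exists>c<q. pvar j + of_nat c * pvar k \<in> p" if "j \<le> N" for j
    using rp homog_pvar[OF that] homog_pvar[OF k(1)] k(2) unfolding rational_def by blast
  then obtain c where c: "\<And>j. j \<le> N \<Longrightarrow> c j < q" "\<And>j. j \<le> N \<Longrightarrow> pvar j + of_nat (c j) * pvar k \<in> p"
    by metis
  define a where "a = (\<lambda>j\<in>{..N}. - int (c j))"
  have cg: "point.cong N p (pvar j) (pvar k * of_int (a j))" if "j \<le> N" for j
    using that k c(2)[OF that] by (intro congI polys_mult polys_pvar polys_of_int) (simp_all add: a_def mult.commute)
  have mem: "f \<in> p \<longleftrightarrow> int q dvd peval a f" if f: "f \<in> homog N d" for f d
  proof -
    have "point.cong N p (peval pvar f) (pvar k ^ d * peval (\<lambda>i. of_int (a i)) f)"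
      by (rule cong_peval_scale[OF f polys_pvar[OF k(1)] cg])
    then have "f \<in> p \<longleftrightarrow> pvar k ^ d * of_int (peval a f) \<in> p"
      unfolding peval_pvar_self peval_of_int_hom by (rule cong_mem_iff)
    also have "\<dots> \<longleftrightarrow> of_int (peval a f) \<in> p"
      using mult_iff[OF polys_power[OF polys_pvar[OF k(1)]] polys_of_int] power_iff[OF polys_pvar[OF k(1)]] k(2) by blast
    finally show ?thesis using of_int_mem_iff[OF q qp] by simp
  qed
  have nz: "nonzero_coords q N a"
    unfolding nonzero_coords_def using k mem[OF homog_pvar[OF k(1)]] by auto
  moreover have "a \<in> {..N} \<rightarrow>\<^sub>E {- int q<..0}"
    using c(1) by (auto simp: a_def)
  moreover have "p = rpoint q N a"
    by (rule point_eqI[OF p rpoint_point[OF q nz]]) (simp add: mem mem_rpoint)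
  ultimately show ?thesis by (rule that)
qed

lemma rpoint_eqI:
  assumes q: "prime q" and a: "nonzero_coords q N a" "nonzero_coords q N b"
    and u: "\<not> int q dvd u" "\<not> int q dvd v" and eq: "\<And>i. i \<le> N \<Longrightarrow> [u * a i = v * b i] (mod int q)"
  shows "rpoint q N a = rpoint q N b"
proof (rule point_eqI[OF rpoint_point[OF q a(1)] rpoint_point[OF q a(2)]])
  fix f d assume f: "f \<in> homog N d"
  have pq: "prime (int q)" using q by simp
  have "[peval (\<lambda>i. u * a i) f = peval (\<lambda>i. v * b i) f] (mod int q)"
    by (rule cong_peval_int[OF homog_polys[OF f] eq])
  then have "int q dvd u ^ d * peval a f \<longleftrightarrow> int q dvd v ^ d * peval b f"
    unfolding peval_scale[OF f] by (rule cong_dvd_iff)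
  then have "int q dvd peval a f \<longleftrightarrow> int q dvd peval b f"
    using prime_dvd_mult_iff[OF pq] prime_dvd_power[OF pq] u by blast
  then show "f \<in> rpoint q N a \<longleftrightarrow> f \<in> rpoint q N b"
    by (simp add: mem_rpoint[OF f])
qed

text \<open>The linear forms \<open>a_i x_k - a_k x_i\<close> vanish at the point \<open>a\<close>,
  hence at \<open>b\<close>. This is proportionality with factors \<open>b_k\<close> and
  \<open>a_k\<close>, both prime to \<open>q\<close> if \<open>a_k\<close> is.\<close>

lemma rpoint_eqD:
  assumes q: "prime q" and a: "nonzero_coords q N a" and eq: "rpoint q N a = rpoint q N b"
  obtains u v where "\<not> int q dvd u" "\<not> int q dvd v" "\<And>i. i \<le> N \<Longrightarrow> [u * a i = v * b i] (mod int q)"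
proof -
  obtain k where k: "k \<le> N" "\<not> int q dvd a k" using a by (auto simp: nonzero_coords_def)
  have b: "\<not> int q dvd b k"
    using k(2) eq mem_rpoint[OF homog_pvar[OF k(1)], of q a] mem_rpoint[OF homog_pvar[OF k(1)], of q b] by simp
  have "[b k * a i = a k * b i] (mod int q)" if "i \<le> N" for i
  proof -
    have h: "of_int (a i) * pvar k - of_int (a k) * pvar i \<in> homog N 1"
      using that k by (intro homog_diff homog_of_int_mult homog_pvar)
    have "of_int (a i) * pvar k - of_int (a k) * pvar i \<in> rpoint q N a"
      using mem_rpoint[OF h] by simp
    then show ?thesis
      using mem_rpoint[OF h, of q b] eq by (simp add: cong_iff_dvd_diff mult.commute)
  qed
  with b k that show ?thesis by blast
qed

section \<open>The point count and its additivity\<close>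

definition rational_points :: "nat \<Rightarrow> qp_variety \<Rightarrow> zpoly set set" where
  "rational_points q X = {p \<in> pts X. rational q (pdim X) p}"

definition point_count :: "nat \<Rightarrow> qp_variety \<Rightarrow> nat" where
  "point_count q X = card (rational_points q X)"

lemma finite_rational_points:
  assumes "prime q" shows "finite (rational_points q X)"
proof (rule finite_subset)
  show "rational_points q X \<subseteq> rpoint q (pdim X) ` ({..pdim X} \<rightarrow>\<^sub>E {- int q<..0})"
  proof
    fix p assume "p \<in> rational_points q X"
    then have "rational q (pdim X) p" by (simp add: rational_points_def)
    from rational_eq_rpoint[OF assms this] show "p \<in> rpoint q (pdim X) ` ({..pdim X} \<rightarrow>\<^sub>E {- int q<..0})"
      by blast
  qed
qed (intro finite_imageI finite_PiE; simp)

lemma point_count_isomorphic: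
  assumes "isomorphic X Y" "prime q" shows "point_count q X = point_count q Y"
proof -
  obtain \<phi> where \<phi>: "bij_betw \<phi> (pts X) (pts Y)"
    "\<And>p. p \<in> pts X \<Longrightarrow> rational q (pdim Y) (\<phi> p) \<longleftrightarrow> rational q (pdim X) p"
    using isomorphic_rational[OF assms(1), of q] prime_ge_1_nat[OF assms(2)] by blast
  have "\<phi> ` rational_points q X = rational_points q Y"
  proof (intro equalityI subsetI)
    fix y assume y: "y \<in> rational_points q Y"
    then obtain x where "x \<in> pts X" "y = \<phi> x"
      using bij_betw_imp_surj_on[OF \<phi>(1)] by (auto simp: rational_points_def)
    then show "y \<in> \<phi> ` rational_points q X"
      using y \<phi>(2) by (simp add: rational_points_def)
  next
    fix y assume "y \<in> \<phi> ` rational_points q X"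
    then show "y \<in> rational_points q Y"
      using \<phi>(2) bij_betw_imp_surj_on[OF \<phi>(1)] by (auto simp: rational_points_def)
  qed
  then have "bij_betw \<phi> (rational_points q X) (rational_points q Y)"
    using bij_betw_subset[OF \<phi>(1), of "rational_points q X"] by (auto simp: rational_points_def)
  then show ?thesis by (simp add: point_count_def bij_betw_same_card)
qed

lemma point_count_scissor:
  assumes "pdim Y = pdim X" "pdim Z = pdim X" "pts Y \<subseteq> pts X" "pts Z = pts X - pts Y" "prime q"
  shows "point_count q X = point_count q Y + point_count q Z"
proof -
  have "rational_points q X = rational_points q Y \<union> rational_points q Z"
    using assms by (auto simp: rational_points_def)
  moreover have "rational_points q Y \<inter> rational_points q Z = {}"
    using assms by (auto simp: rational_points_def)
  ultimately show ?thesis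
    using finite_rational_points[OF assms(5)] by (simp add: point_count_def card_Un_disjoint)
qed

section \<open>Multiplicativity of the point count on Segre products\<close>

context
  fixes q N M :: nat assumes q: "prime q"
begin

definition tensor :: "(nat \<Rightarrow> int) \<Rightarrow> (nat \<Rightarrow> int) \<Rightarrow> nat \<Rightarrow> int" where
  "tensor a b m = a (m div (M + 1)) * b (m mod (M + 1))"

lemma tensor_index: "j \<le> M \<Longrightarrow> tensor a b (i * (M + 1) + j) = a i * b j"
proof -
  assume "j \<le> M"
  then have "(i * (M + 1) + j) div (M + 1) = i"
    by (subst div_mult_self3) simp_all
  moreover have "(i * (M + 1) + j) mod (M + 1) = j"
    using \<open>j \<le> M\<close> by (subst mod_mult_self3) simp_all
  ultimately show ?thesis by (simp add: tensor_def)
qed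

lemma peval_segre_var: "peval c (segre_var M i j) = c (i * (M + 1) + j)"
  by (simp add: segre_var_def)

lemma tensor_nonzero:
  assumes "nonzero_coords q N a" "nonzero_coords q M b"
  shows "nonzero_coords q (segre_dim N M) (tensor a b)"
proof -
  obtain i j where "i \<le> N" "\<not> int q dvd a i" "j \<le> M" "\<not> int q dvd b j"
    using assms by (auto simp: nonzero_coords_def)
  moreover from this have "\<not> int q dvd tensor a b (i * (M + 1) + j)"
    using q prime_dvd_mult_iff[of "int q" "a i" "b j"] unfolding tensor_index[OF \<open>j \<le> M\<close>] by simp
  ultimately show ?thesis
    unfolding nonzero_coords_def using segre_index by blast
qed

lemma rpoint_tensor_segre:
  assumes "nonzero_coords q N a" "nonzero_coords q M b"
  shows "rpoint q (segre_dim N M) (tensor a b) \<in> segre_points N M"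
  unfolding segre_points_def mem_Collect_eq
proof (intro conjI allI impI)
  show "rpoint q (segre_dim N M) (tensor a b) \<in> proj_points (segre_dim N M)"
    by (rule rpoint_point[OF q tensor_nonzero[OF assms]])
  fix i k j l assume "i \<le> N" "k \<le> N" "j \<le> M" "l \<le> M"
  moreover from this have "segre_var M i j * segre_var M k l - segre_var M i l * segre_var M k j \<in> homog (segre_dim N M) (1 + 1)"
    by (intro homog_diff homog_mult segre_var_homog)
  ultimately show "segre_var M i j * segre_var M k l - segre_var M i l * segre_var M k j \<in> rpoint q (segre_dim N M) (tensor a b)"
    by (simp only: mem_rpoint peval_diff peval_mult peval_segre_var tensor_index) (simp add: algebra_simps)
qed

text \<open>The coordinates of a Segre point form a matrix of rank one modulo \<open>q\<close>. The
  column and the row through a nonzero entry \<open>c_kj\<close> represent the projections, and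
  their tensor product is \<open>c_kj\<close> times the matrix.\<close>

lemma segre_rpoint:
  assumes c: "nonzero_coords q (segre_dim N M) c" and r: "rpoint q (segre_dim N M) c \<in> segre_points N M"
    and kj: "k \<le> N" "j \<le> M" "\<not> int q dvd c (k * (M + 1) + j)"
  defines "a \<equiv> (\<lambda>i. c (i * (M + 1) + j))" and "b \<equiv> (\<lambda>j. c (k * (M + 1) + j))"
  shows "nonzero_coords q N a" "nonzero_coords q M b"
    "segre_fst N M (rpoint q (segre_dim N M) c) = rpoint q N a"
    "segre_snd N M (rpoint q (segre_dim N M) c) = rpoint q M b"
    "rpoint q (segre_dim N M) c = rpoint q (segre_dim N M) (tensor a b)"
proof -
  interpret r: segre_point N M "rpoint q (segre_dim N M) c" by unfold_locales (rule r)
  show a: "nonzero_coords q N a" and b: "nonzero_coords q M b"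
    using kj by (auto simp: nonzero_coords_def a_def b_def)
  have kj': "segre_var M k j \<notin> rpoint q (segre_dim N M) c"
    unfolding mem_rpoint[OF segre_var_homog[OF kj(1,2)]] peval_segre_var by (rule kj(3))
  show "segre_fst N M (rpoint q (segre_dim N M) c) = rpoint q N a"
  proof (rule point_eqI[OF r.segre_fst_point rpoint_point[OF q a]])
    fix f d assume f: "f \<in> homog N d"
    have "peval (\<lambda>i. segre_var M i j) f \<in> homog (segre_dim N M) (d * 1)"
      by (rule peval_homog[OF f segre_var_homog[OF _ kj(2)]])
    then show "f \<in> segre_fst N M (rpoint q (segre_dim N M) c) \<longleftrightarrow> f \<in> rpoint q N a"
      unfolding r.segre_fst_eq[OF kj(1,2) kj'] mem_pull[OF homog_polys[OF f]] mem_rpoint[OF f]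
      by (simp only: mem_rpoint peval_peval peval_segre_var a_def)
  qed
  show "segre_snd N M (rpoint q (segre_dim N M) c) = rpoint q M b"
  proof (rule point_eqI[OF r.segre_snd_point rpoint_point[OF q b]])
    fix f d assume f: "f \<in> homog M d"
    have "peval (\<lambda>i. segre_var M k i) f \<in> homog (segre_dim N M) (d * 1)"
      by (rule peval_homog[OF f segre_var_homog[OF kj(1)]])
    then show "f \<in> segre_snd N M (rpoint q (segre_dim N M) c) \<longleftrightarrow> f \<in> rpoint q M b"
      unfolding r.segre_snd_eq[OF kj(1,2) kj'] mem_pull[OF homog_polys[OF f]] mem_rpoint[OF f]
      by (simp only: mem_rpoint peval_peval peval_segre_var b_def)
  qed
  show "rpoint q (segre_dim N M) c = rpoint q (segre_dim N M) (tensor a b)"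
  proof (rule rpoint_eqI[OF q c tensor_nonzero[OF a b] kj(3), of 1])
    show "\<not> int q dvd 1" using q not_prime_unit by force
    fix m assume "m \<le> segre_dim N M"
    then obtain i l where il: "i \<le> N" "l \<le> M" "m = i * (M + 1) + l"
      using segre_index_cases by metis
    have "segre_var M k j * segre_var M i l - segre_var M k l * segre_var M i j \<in> homog (segre_dim N M) (1 + 1)"
      using il kj by (intro homog_diff homog_mult segre_var_homog)
    from mem_rpoint[OF this, of q c] r.segre_relation[OF kj(1) il(1) kj(2) il(2)]
    have "int q dvd c (k * (M + 1) + j) * c m - c (k * (M + 1) + l) * c (i * (M + 1) + j)"
      by (simp only: peval_diff peval_mult peval_segre_var il)
    then show "[c (k * (M + 1) + j) * c m = 1 * tensor a b m] (mod int q)"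
      unfolding il(3) tensor_index[OF il(2)] by (simp only: cong_iff_dvd_diff a_def b_def mult_1 mult.commute)
  qed
qed

lemma point_count_product:
  assumes Z: "is_product X Y Z" and dims: "pdim X = N" "pdim Y = M"
  shows "point_count q Z = point_count q X * point_count q Y"
proof -
  let ?D = "segre_dim N M"
  have Zd: "pdim Z = ?D" and Zp: "pts Z = {r \<in> segre_points N M. segre_fst N M r \<in> pts X \<and> segre_snd N M r \<in> pts Y}"
    using Z dims by (auto simp: is_product_def)
  have rep: "\<exists>a b. nonzero_coords q N a \<and> nonzero_coords q M b \<and> r = rpoint q ?D (tensor a b) \<and>
      segre_fst N M r = rpoint q N a \<and> segre_snd N M r = rpoint q M b"
    if r: "r \<in> segre_points N M" "rational q ?D r" for r
  proof -
    obtain c where c: "nonzero_coords q ?D c" "r = rpoint q ?D c"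
      using rational_eq_rpoint[OF q r(2)] by metis
    obtain m where m: "m \<le> ?D" "\<not> int q dvd c m"
      using c(1) by (auto simp: nonzero_coords_def)
    obtain k j where kj: "k \<le> N" "j \<le> M" "m = k * (M + 1) + j"
      using segre_index_cases[OF m(1)] by metis
    show ?thesis
      using segre_rpoint[OF c(1) r(1)[unfolded c(2)] kj(1,2) m(2)[unfolded kj(3)]] unfolding c(2) by blast
  qed
  have "bij_betw (\<lambda>r. (segre_fst N M r, segre_snd N M r)) (rational_points q Z) (rational_points q X \<times> rational_points q Y)"
  proof (rule bij_betw_imageI[OF inj_onI])
    fix r s assume "r \<in> rational_points q Z" "s \<in> rational_points q Z"
      and eq: "(segre_fst N M r, segre_snd N M r) = (segre_fst N M s, segre_snd N M s)"
    then have rs: "r \<in> segre_points N M" "rational q ?D r" "s \<in> segre_points N M" "rational q ?D s"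
      by (auto simp: rational_points_def Zp Zd)
    obtain a b where ab: "nonzero_coords q N a" "nonzero_coords q M b" "r = rpoint q ?D (tensor a b)"
      "segre_fst N M r = rpoint q N a" "segre_snd N M r = rpoint q M b"
      using rep[OF rs(1,2)] by blast
    obtain a' b' where ab': "nonzero_coords q N a'" "nonzero_coords q M b'" "s = rpoint q ?D (tensor a' b')"
      "segre_fst N M s = rpoint q N a'" "segre_snd N M s = rpoint q M b'"
      using rep[OF rs(3,4)] by blast
    have "rpoint q N a = rpoint q N a'" "rpoint q M b = rpoint q M b'"
      using eq ab(4,5) ab'(4,5) by simp_all
    then obtain u v u' v' where u: "\<not> int q dvd u" "\<not> int q dvd v" "\<And>i. i \<le> N \<Longrightarrow> [u * a i = v * a' i] (mod int q)"
      and u': "\<not> int q dvd u'" "\<not> int q dvd v'" "\<And>i. i \<le> M \<Longrightarrow> [u' * b i = v' * b' i] (mod int q)"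
      using rpoint_eqD[OF q ab(1)] rpoint_eqD[OF q ab(2)] by metis
    show "r = s"
      unfolding ab(3) ab'(3)
    \<comment> \<open>The factors of proportionality of the two projections multiply.\<close>
    proof (rule rpoint_eqI[OF q tensor_nonzero[OF ab(1,2)] tensor_nonzero[OF ab'(1,2)], of "u * u'" "v * v'"])
      show "\<not> int q dvd u * u'" "\<not> int q dvd v * v'"
        using u u' q by (simp_all add: prime_dvd_mult_iff)
      fix m assume "m \<le> ?D"
      then obtain i l where il: "i \<le> N" "l \<le> M" "m = i * (M + 1) + l"
        using segre_index_cases by metis
      have "[(u * a i) * (u' * b l) = (v * a' i) * (v' * b' l)] (mod int q)"
        by (intro cong_mult u u' il)
      then show "[u * u' * tensor a b m = v * v' * tensor a' b' m] (mod int q)"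
        unfolding il(3) tensor_index[OF il(2)] by (simp only: mult_ac)
    qed
  next
    show "(\<lambda>r. (segre_fst N M r, segre_snd N M r)) ` rational_points q Z = rational_points q X \<times> rational_points q Y"
    proof (intro equalityI subsetI)
      fix x assume "x \<in> (\<lambda>r. (segre_fst N M r, segre_snd N M r)) ` rational_points q Z"
      then obtain r where r: "r \<in> rational_points q Z" "x = (segre_fst N M r, segre_snd N M r)" by blast
      then have r': "r \<in> segre_points N M" "rational q ?D r" "segre_fst N M r \<in> pts X" "segre_snd N M r \<in> pts Y"
        by (auto simp: rational_points_def Zp Zd)
      obtain a b where ab: "nonzero_coords q N a" "nonzero_coords q M b"
        "segre_fst N M r = rpoint q N a" "segre_snd N M r = rpoint q M b"
        using rep[OF r'(1,2)] by blast
      show "x \<in> rational_points q X \<times> rational_points q Y"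
        using r' rpoint_rational[OF q ab(1)] rpoint_rational[OF q ab(2)] by (simp add: r(2) rational_points_def ab dims)
    next
      fix x assume "x \<in> rational_points q X \<times> rational_points q Y"
      then obtain p p' where p: "x = (p, p')" "p \<in> pts X" "p' \<in> pts Y" "rational q N p" "rational q M p'"
        by (auto simp: rational_points_def dims)
      obtain a where a: "nonzero_coords q N a" "p = rpoint q N a" using rational_eq_rpoint[OF q p(4)] by metis
      obtain b where b: "nonzero_coords q M b" "p' = rpoint q M b" using rational_eq_rpoint[OF q p(5)] by metis
      let ?r = "rpoint q ?D (tensor a b)"
      have r: "?r \<in> segre_points N M" by (rule rpoint_tensor_segre[OF a(1) b(1)])
      obtain k j where kj: "k \<le> N" "\<not> int q dvd a k" "j \<le> M" "\<not> int q dvd b j"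
        using a b by (auto simp: nonzero_coords_def)
      have "\<not> int q dvd tensor a b (k * (M + 1) + j)"
        using kj q prime_dvd_mult_iff[of "int q" "a k" "b j"] unfolding tensor_index[OF kj(3)] by simp
      note sr = segre_rpoint[OF tensor_nonzero[OF a(1) b(1)] r kj(1,3) this]
      have unit: "\<not> int q dvd 1" using q not_prime_unit by force
      \<comment> \<open>Column \<open>j\<close> of the tensor product is \<open>b_j\<close> times
        \<open>a\<close>, the same projective point because \<open>q\<close> does not divide
        \<open>b_j\<close>; row \<open>k\<close> is \<open>a_k\<close> times \<open>b\<close>
        likewise.\<close>
      have "segre_fst N M ?r = p"
        unfolding sr(3) a(2)
      proof (rule rpoint_eqI[OF q sr(1) a(1) unit kj(4)])
        show "[1 * tensor a b (i * (M + 1) + j) = b j * a i] (mod int q)" for i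
          unfolding tensor_index[OF kj(3)] by (simp add: mult.commute)
      qed
      moreover have "segre_snd N M ?r = p'"
        unfolding sr(4) b(2)
      proof (rule rpoint_eqI[OF q sr(2) b(1) unit kj(2)])
        show "[1 * tensor a b (k * (M + 1) + l) = a k * b l] (mod int q)" if "l \<le> M" for l
          unfolding tensor_index[OF that] by simp
      qed
      moreover have "rational q ?D ?r"
        by (rule rpoint_rational[OF q tensor_nonzero[OF a(1) b(1)]])
      ultimately show "x \<in> (\<lambda>r. (segre_fst N M r, segre_snd N M r)) ` rational_points q Z"
        using r p by (intro image_eqI[of _ _ ?r]) (auto simp: rational_points_def Zp Zd)
    qed
  qed
  then show ?thesis
    by (simp add: point_count_def bij_betw_same_card card_cartesian_product)
qed

end

section \<open>Point counts of the point and of the multiplicative group\<close>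

lemma point_count_point:
  assumes q: "prime q" shows "point_count q (basic_open_variety 0 1) = 1"
proof -
  have one: "nonzero_coords q 0 (\<lambda>_. 1)"
    using q not_prime_unit by (force simp: nonzero_coords_def)
  have "rational_points q (basic_open_variety 0 1) = {rpoint q 0 (\<lambda>_. 1)}"
  proof (intro equalityI subsetI)
    fix p assume "p \<in> rational_points q (basic_open_variety 0 1)"
    then have "rational q 0 p" by (simp add: rational_points_def pdim_basic_open_variety)
    then obtain a where a: "nonzero_coords q 0 a" "p = rpoint q 0 a" using rational_eq_rpoint[OF q] by metis
    have "rpoint q 0 a = rpoint q 0 (\<lambda>_. 1)"
      by (rule rpoint_eqI[OF q a(1) one, of 1 "a 0"]) (use a(1) one in \<open>auto simp: nonzero_coords_def\<close>)
    then show "p \<in> {rpoint q 0 (\<lambda>_. 1)}" using a by simp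
  next
    fix p assume "p \<in> {rpoint q 0 (\<lambda>_. 1)}"
    moreover have "rpoint q 0 (\<lambda>_. 1) \<in> proj_points 0" by (rule rpoint_point[OF q one])
    moreover from this have "1 \<notin> rpoint q 0 (\<lambda>_. 1)"
      using point.one[of 0] by (simp add: point_def)
    ultimately show "p \<in> rational_points q (basic_open_variety 0 1)"
      using rpoint_rational[OF q one]
      by (simp add: rational_points_def pdim_basic_open_variety pts_basic_open_variety basic_open_def)
  qed
  then show ?thesis by (simp add: point_count_def)
qed

text \<open>The first coordinate is normalised to 1, so the points are \<open>[1 : c]\<close> with
  \<open>c\<close> from 1 to \<open>q - 1\<close>.\<close>

lemma point_count_Gm:
  assumes q: "prime q" shows "point_count q Gm = q - 1"
proof -
  let ?a = "\<lambda>c i::nat. if i = 0 then 1 else int c"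
  have unit: "\<not> int q dvd 1" using q not_prime_unit by force
  have nz: "nonzero_coords q 1 (?a c)" for c
    using unit by (auto simp: nonzero_coords_def intro!: exI[of _ 0])
  have small: "\<not> int q dvd int c" if "c \<in> {1..<q}" for c
    using that by (auto dest: dvd_imp_le)
  have rp: "rational_points q Gm = {p \<in> stratum 1 {0, 1}. rational q 1 p}"
    using locally_closed_stratum[of 1 "{0, 1}"] by (simp add: rational_points_def Gm_eq pdim_subvariety pts_subvariety)
  have mem: "pvar i \<notin> rpoint q 1 a \<longleftrightarrow> \<not> int q dvd a i" if "i \<le> 1" for i a
    using mem_rpoint[OF homog_pvar[OF that]] by simp
  have "bij_betw (\<lambda>c. rpoint q 1 (?a c)) {1..<q} (rational_points q Gm)"
    unfolding bij_betw_def rp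
  proof (intro conjI inj_onI equalityI subsetI)
    fix c c' assume c: "c \<in> {1..<q}" "c' \<in> {1..<q}" and eq: "rpoint q 1 (?a c) = rpoint q 1 (?a c')"
    obtain u v where u: "\<not> int q dvd u" and uv: "\<And>i. i \<le> 1 \<Longrightarrow> [u * ?a c i = v * ?a c' i] (mod int q)"
      using rpoint_eqD[OF q nz eq] by metis
    have "[u = v] (mod int q)" using uv[of 0] by simp
    then have "[u * int c' = v * int c'] (mod int q)" by (rule cong_scalar_right)
    also have "[v * int c' = u * int c] (mod int q)" using cong_sym[OF uv[of 1]] by simp
    finally have "int q dvd u * (int c' - int c)"
      by (simp add: cong_iff_dvd_diff right_diff_distrib)
    then have "int q dvd int c' - int c"
      using u q prime_dvd_mult_iff[of "int q"] by simp
    then have "[c' = c] (mod q)" by (simp add: cong_iff_dvd_diff[symmetric] cong_int_iff)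
    then show "c = c'" using c by (simp add: cong_def)
  next
    fix p assume "p \<in> (\<lambda>c. rpoint q 1 (?a c)) ` {1..<q}"
    then obtain c where c: "c \<in> {1..<q}" "p = rpoint q 1 (?a c)" by blast
    have "p \<in> stratum 1 {0, 1}"
      using rpoint_point[OF q nz] mem[of _ "?a c"] small[OF c(1)] unit unfolding c(2) stratum_def by auto
    then show "p \<in> {p \<in> stratum 1 {0, 1}. rational q 1 p}"
      using rpoint_rational[OF q nz] c(2) by simp
  next
    fix p assume p: "p \<in> {p \<in> stratum 1 {0, 1}. rational q 1 p}"
    then obtain a where a: "nonzero_coords q 1 a" "p = rpoint q 1 a"
      using rational_eq_rpoint[OF q] by (metis (no_types, lifting) mem_Collect_eq)
    have a01: "\<not> int q dvd a 0" "\<not> int q dvd a 1"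
      using p stratum_pvar[of p 1 "{0, 1}"] mem[of _ a] a(2) by auto
    obtain y where y: "[a 0 * y = 1] (mod int q)"
      using ex_inverse_mod[OF q a01(1)] .
    have q0: "q > 0" using q by (simp add: prime_gt_0_nat)
    \<comment> \<open>The ratio of \<open>a 1\<close> to \<open>a 0\<close> modulo \<open>q\<close>,
      with \<open>y\<close> inverse to \<open>a 0\<close>.\<close>
    define c where "c = nat ((y * a 1) mod int q)"
    have ic: "int c = (y * a 1) mod int q" using q0 by (simp add: c_def)
    have cc: "[int c = y * a 1] (mod int q)" by (simp add: ic cong_def)
    have "\<not> int q dvd y"
    proof
      assume "int q dvd y"
      then have "int q dvd a 0 * y" by simp
      then show False using cong_dvd_iff[OF y] unit by simp
    qed
    then have "\<not> int q dvd int c"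
      using cong_dvd_iff[OF cc] a01(2) q by (simp add: prime_dvd_mult_iff)
    then have "c \<noteq> 0" by (intro notI) simp
    moreover have "c < q" using q0 by (simp add: c_def nat_less_iff)
    ultimately have c: "c \<in> {1..<q}" by simp
    have "rpoint q 1 a = rpoint q 1 (?a c)"
    proof (rule rpoint_eqI[OF q a(1) nz unit a01(1)])
      fix i :: nat assume "i \<le> 1"
      have "[a 0 * int c = a 0 * (y * a 1)] (mod int q)" by (rule cong_scalar_left[OF cc])
      also have "a 0 * (y * a 1) = (a 0 * y) * a 1" by simp
      also have "[\<dots> = 1 * a 1] (mod int q)" by (rule cong_scalar_right[OF y])
      finally have "[1 * a 1 = a 0 * int c] (mod int q)" by (rule cong_sym)
      then show "[1 * a i = a 0 * ?a c i] (mod int q)"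
        using \<open>i \<le> 1\<close> by (cases "i = 0") (auto simp: le_Suc_eq)
    qed
    then show "p \<in> (\<lambda>c. rpoint q 1 (?a c)) ` {1..<q}" using a(2) c by blast
  qed
  then show ?thesis using bij_betw_same_card by (fastforce simp: point_count_def)
qed

text \<open>On the free ring the point count is evaluation of the variables. Its kernel is an ideal
  containing all four kinds of relations, hence contains \<open>K0_ideal\<close>.\<close>

lemma K0_eq_point_count:
  assumes ab: "a \<approx> b" and q: "prime q"
  shows "peval (\<lambda>X. int (point_count q X)) a = peval (\<lambda>X. int (point_count q X)) b"
proof -
  let ?h = "peval (\<lambda>X. int (point_count q X))"
  let ?I = "{f. ?h f = 0}"
  interpret cring free_ring by (rule cring_free_ring)
  have "ideal ?I free_ring"
  proof (rule idealI)
    show "subgroup ?I (add_monoid free_ring)"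
    proof (rule subgroup.intro)
      fix x assume "x \<in> ?I"
      then show "inv\<^bsub>add_monoid free_ring\<^esub> x \<in> ?I"
        using a_inv_free_ring[of x] by (simp add: a_inv_def)
    qed auto
  qed (auto intro: ring_axioms)
  moreover have "K0_relations \<subseteq> ?I"
  proof
    fix x assume "x \<in> K0_relations"
    then show "x \<in> ?I"
    proof cases
      case (rel_iso X Y)
      then show ?thesis using point_count_isomorphic[OF _ q] by simp
    next
      case (rel_scissor Y X Z)
      have "pts Y \<subseteq> pts X" using closedin_subset[OF rel_scissor(4)] by simp
      then show ?thesis using point_count_scissor[OF rel_scissor(2,3) _ rel_scissor(5) q] rel_scissor by simp
    next
      case (rel_product X Y Z)
      then show ?thesis using point_count_product[OF q rel_product(2) refl refl] by simp
    next
      case rel_point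
      then show ?thesis using point_count_point[OF q] by simp
    qed
  qed
  ultimately have "K0_ideal \<subseteq> ?I"
    unfolding K0_ideal_def by (rule genideal_minimal)
  then have "?h (a - b) = 0" using ab by (auto simp: K0_eq_def)
  then show ?thesis by simp
qed


section \<open>The classes of the banana graph hypersurface and its complement\<close>

text \<open>Every term omits a single variable, so it contains at least one of the two vanishing
  coordinates.\<close>

lemma banana_poly_mem:
  assumes ps: "p \<in> stratum N S" and ij: "i \<le> N" "j \<le> N" "i \<noteq> j" "i \<notin> S" "j \<notin> S"
  shows "banana_poly (Suc N) \<in> p"
proof -
  interpret point N p by (rule point_of_stratum[OF ps])
  show ?thesis
    unfolding kirchhoff_banana
  proof (rule sum)
    fix k assume "k \<in> {..<Suc N}"
    obtain l where l: "l \<noteq> k" "l \<le> N" "l \<notin> S" using ij by metis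
    then have "pvar l \<in> p" using stratum_pvar[OF ps] by blast
    then show "(\<Prod>m\<in>{..<Suc N} - {k}. pvar m) \<in> p"
      using prod_iff[of "{..<Suc N} - {k}" pvar] l(1,2) polys_pvar by auto
  qed
qed

text \<open>Only the term that omits the vanishing coordinate \<open>i\<close> survives, and it is a
  product of nonvanishing coordinates.\<close>

lemma banana_poly_not_mem:
  assumes ps: "p \<in> stratum N ({..N} - {i})" and i: "i \<le> N"
  shows "banana_poly (Suc N) \<notin> p"
proof -
  interpret point N p by (rule point_of_stratum[OF ps])
  have x: "pvar k \<in> p \<longleftrightarrow> k = i" if "k \<le> N" for k
    using stratum_pvar[OF ps that] that by auto
  have term_mem: "(\<Prod>m\<in>{..<Suc N} - {k}. pvar m) \<in> p \<longleftrightarrow> k \<noteq> i" for k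
    using prod_iff[of "{..<Suc N} - {k}" pvar] x polys_pvar i by (auto simp: less_Suc_eq_le)
  have "banana_poly (Suc N) = (\<Prod>m\<in>{..<Suc N} - {i}. pvar m) + (\<Sum>k\<in>{..<Suc N} - {i}. \<Prod>m\<in>{..<Suc N} - {k}. pvar m)"
    unfolding kirchhoff_banana using i by (intro sum.remove) auto
  moreover have "(\<Sum>k\<in>{..<Suc N} - {i}. \<Prod>m\<in>{..<Suc N} - {k}. pvar m) \<in> p"
    using term_mem by (intro sum) auto
  ultimately show ?thesis
    using term_mem[of i] diff_mem_iff[of "banana_poly (Suc N)" "\<Prod>m\<in>{..<Suc N} - {i}. pvar m"] by simp
qed

text \<open>No, one, or at least two vanishing coordinates: the three behaviours of the Kirchhoff
  polynomial on a stratum. The cardinalities are recorded because the weights depend on them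
  alone.\<close>

lemma subset_card_cases:
  assumes "S \<subseteq> {..N}"
  obtains "S = {..N}" "card S = Suc N"
  | i where "i \<le> N" "S = {..N} - {i}" "card S = N"
  | i j where "i \<le> N" "j \<le> N" "i \<noteq> j" "i \<notin> S" "j \<notin> S" "card S < N"
proof -
  have fin: "finite S" using assms finite_subset by blast
  have card: "card ({..N} - S) = Suc N - card S"
    using assms fin by (simp add: card_Diff_subset)
  consider "{..N} - S = {}" | i where "{..N} - S = {i}" | i j where "i \<in> {..N} - S" "j \<in> {..N} - S" "i \<noteq> j"
    by blast
  then show ?thesis
  proof cases
    case 1
    then show ?thesis using assms that(1) by fastforce
  next
    case (2 i)
    then have "S = {..N} - {i}" "i \<le> N" using assms by auto
    then show ?thesis using that(2) by simp
  next
    case (3 i j)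
    have "card {i, j} \<le> card ({..N} - S)"
      using 3 by (intro card_mono) auto
    then have "card S < N" using 3 card by simp
    then show ?thesis using that(3) 3 by auto
  qed
qed

lemma sum_Pow_card:
  assumes "finite A"
  shows "(\<Sum>S\<in>Pow A. w (card S)) = (\<Sum>k\<le>card A. of_nat (card A choose k) * (w k :: 'a::comm_semiring_1))"
proof -
  have "(\<Sum>S\<in>Pow A. w (card S)) = (\<Sum>k\<le>card A. \<Sum>S\<in>{S \<in> Pow A. card S = k}. w (card S))"
    using assms by (intro sum.group[symmetric]) (auto intro: card_mono)
  also have "\<dots> = (\<Sum>k\<le>card A. of_nat (card A choose k) * w k)"
  proof (intro sum.cong refl)
    fix k
    have "card {S \<in> Pow A. card S = k} = card A choose k"
      using n_subsets[OF assms] by simp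
    then show "(\<Sum>S\<in>{S \<in> Pow A. card S = k}. w (card S)) = of_nat (card A choose k) * w k"
      by simp
  qed
  finally show ?thesis .
qed

lemma stratify_card:
  assumes A: "locally_closed_in (proj_top N) A"
    and w: "\<And>S. S \<subseteq> {..N} \<Longrightarrow> gen (subvariety N (A \<inter> stratum N S)) \<approx> w (card S)"
  shows "gen (subvariety N A) \<approx> (\<Sum>k\<le>Suc N. of_nat (Suc N choose k) * w k)"
proof -
  have "{p \<in> A. \<forall>i\<in>{..N}. pvar i \<notin> p \<longleftrightarrow> i \<in> S} = A \<inter> stratum N S" for S
    using locally_closed_subset[OF A] by (auto simp: stratum_def)
  then have "gen (subvariety N A) \<approx> (\<Sum>S\<in>Pow {..N}. gen (subvariety N (A \<inter> stratum N S)))"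
    using stratify[OF finite_atMost A, of N] by simp
  also have "\<dots> \<approx> (\<Sum>S\<in>Pow {..N}. w (card S))"
    using w by (intro K0_eq_sum) auto
  also have "\<dots> = (\<Sum>k\<le>Suc N. of_nat (Suc N choose k) * w k)"
    using sum_Pow_card[of "{..N}" w] by simp
  finally show ?thesis .
qed

text \<open>Exponent \<open>j\<close> belongs to strata with \<open>Suc j\<close> nonvanishing
  coordinates. At \<open>Suc j = N\<close> there is no binomial term because the polynomial has no
  zeros on those strata; the signs come from the open torus.\<close>

lemma class_banana_hypersurface:
  "gen (graph_hypersurface (banana (Suc N))) \<approx>
    (\<Sum>j<N. of_int ((-1) ^ (N - 1 - j) + (if Suc j < N then int (Suc N choose Suc j) else 0)) * gen Gm ^ j)"
proof -
  let ?A = "{p \<in> proj_points N. banana_poly (Suc N) \<in> p}"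
  \<comment> \<open>The value 0 at \<open>k = 0\<close> accounts for the empty stratum; truncated
    subtraction would otherwise give it the class \<open>gen Gm ^ 0\<close>.\<close>
  define w where "w k = (if k = Suc N then alternating N (gen Gm) else if k = N \<or> k = 0 then 0 else gen Gm ^ (k - 1))" for k
  have A: "?A \<inter> stratum N S = {p \<in> stratum N S. banana_poly (Suc N) \<in> p}" for S
    by (auto simp: stratum_def)
  have "graph_hypersurface (banana (Suc N)) = subvariety N ?A"
    using subvariety_pts[of "graph_hypersurface (banana (Suc N))"]
    by (simp add: graph_hypersurface_def banana_def[of "Suc N"] pdim_hypersurface pts_hypersurface)
  then have "gen (graph_hypersurface (banana (Suc N))) = gen (subvariety N ?A)" by simp
  also have "\<dots> \<approx> (\<Sum>k\<le>Suc N. of_nat (Suc N choose k) * w k)"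
  proof (rule stratify_card[OF locally_closed_hypersurface])
    fix S assume S: "S \<subseteq> {..N}"
    show "gen (subvariety N (?A \<inter> stratum N S)) \<approx> w (card S)"
      unfolding A
    proof (cases rule: subset_card_cases[OF S])
      case 1
      then show "gen (subvariety N {p \<in> stratum N S. banana_poly (Suc N) \<in> p}) \<approx> w (card S)"
        using class_torus_hypersurface[of N] by (simp add: torus_hypersurface_def w_def)
    next
      case (2 i)
      then have eq: "{p \<in> stratum N S. banana_poly (Suc N) \<in> p} = {}"
        using banana_poly_not_mem[of _ N i] by blast
      then show "gen (subvariety N {p \<in> stratum N S. banana_poly (Suc N) \<in> p}) \<approx> w (card S)"
        unfolding eq using 2(3) class_empty by (simp add: w_def)
    next
      case (3 i j)
      then have eq: "{p \<in> stratum N S. banana_poly (Suc N) \<in> p} = stratum N S"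
        using banana_poly_mem by blast
      show "gen (subvariety N {p \<in> stratum N S. banana_poly (Suc N) \<in> p}) \<approx> w (card S)"
      proof (cases "S = {}")
        case True
        then show ?thesis unfolding eq using class_empty by (simp add: w_def stratum_empty)
      next
        case False
        moreover from this have "card S \<noteq> 0" using S finite_subset[OF S] by simp
        ultimately show ?thesis
          unfolding eq using class_stratum[OF S] 3(6) by (simp add: w_def)
      qed
    qed
  qed
  also have "(\<Sum>k\<le>Suc N. of_nat (Suc N choose k) * w k) =
      (\<Sum>k\<le>N. of_nat (Suc N choose k) * w k) + alternating N (gen Gm)"
    by (simp add: w_def)
  also have "(\<Sum>k\<le>N. of_nat (Suc N choose k) * w k) = (\<Sum>j<N. of_nat (Suc N choose Suc j) * w (Suc j))"
    by (simp only: sum.atMost_shift) (simp add: w_def)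
  also have "\<dots> + alternating N (gen Gm) =
      (\<Sum>j<N. of_int ((-1) ^ (N - 1 - j) + (if Suc j < N then int (Suc N choose Suc j) else 0)) * gen Gm ^ j)"
    unfolding alternating_def sum.distrib[symmetric]
  proof (intro sum.cong refl)
    fix j assume "j \<in> {..<N}"
    then have "w (Suc j) = (if Suc j < N then gen Gm ^ j else 0)" by (auto simp: w_def)
    then show "of_nat (Suc N choose Suc j) * w (Suc j) + (-1) ^ (N - 1 - j) * gen Gm ^ j =
        of_int ((-1) ^ (N - 1 - j) + (if Suc j < N then int (Suc N choose Suc j) else 0)) * gen Gm ^ j"
      by (simp add: algebra_simps del: binomial_Suc_Suc)
  qed
  finally show ?thesis .
qed

text \<open>For \<open>N = 0\<close> the stratum with one vanishing coordinate is empty, so the last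
  summand would wrongly count a point; hence \<open>N \<ge> 1\<close>.\<close>

lemma class_banana_complement:
  assumes N: "N \<ge> 1"
  shows "gen (graph_complement (banana (Suc N))) \<approx>
    gen Gm ^ N - alternating N (gen Gm) + of_nat (Suc N) * gen Gm ^ (N - 1)"
proof -
  let ?A = "basic_open N (banana_poly (Suc N))"
  define w where "w k = (if k = Suc N then gen Gm ^ N - alternating N (gen Gm) else if k = N then gen Gm ^ (N - 1) else 0)" for k
  have A: "?A \<inter> stratum N S = {p \<in> stratum N S. banana_poly (Suc N) \<notin> p}" for S
    by (auto simp: stratum_def basic_open_def)
  have "graph_complement (banana (Suc N)) = subvariety N ?A"
    using subvariety_pts[of "graph_complement (banana (Suc N))"]
    by (simp add: graph_complement_def banana_def[of "Suc N"] pdim_basic_open_variety pts_basic_open_variety)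
  then have "gen (graph_complement (banana (Suc N))) = gen (subvariety N ?A)" by simp
  also have "\<dots> \<approx> (\<Sum>k\<le>Suc N. of_nat (Suc N choose k) * w k)"
  proof (rule stratify_card[OF locally_closed_basic_open])
    fix S assume S: "S \<subseteq> {..N}"
    show "gen (subvariety N (?A \<inter> stratum N S)) \<approx> w (card S)"
      unfolding A
    proof (cases rule: subset_card_cases[OF S])
      case 1
      then show "gen (subvariety N {p \<in> stratum N S. banana_poly (Suc N) \<notin> p}) \<approx> w (card S)"
        using class_torus_complement[of N] by (simp add: torus_complement_def w_def)
    next
      case (2 i)
      then have eq: "{p \<in> stratum N S. banana_poly (Suc N) \<notin> p} = stratum N S"
        using banana_poly_not_mem[of _ N i] by blast
      have "S \<noteq> {}" using 2(3) N by auto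
      then show "gen (subvariety N {p \<in> stratum N S. banana_poly (Suc N) \<notin> p}) \<approx> w (card S)"
        unfolding eq using class_stratum[OF S] 2(3) by (simp add: w_def)
    next
      case (3 i j)
      then have eq: "{p \<in> stratum N S. banana_poly (Suc N) \<notin> p} = {}"
        using banana_poly_mem by blast
      then show "gen (subvariety N {p \<in> stratum N S. banana_poly (Suc N) \<notin> p}) \<approx> w (card S)"
        unfolding eq using 3(6) class_empty by (simp add: w_def)
    qed
  qed
  also have "(\<Sum>k\<le>Suc N. of_nat (Suc N choose k) * w k) =
      gen Gm ^ N - alternating N (gen Gm) + of_nat (Suc N) * gen Gm ^ (N - 1)"
  proof -
    obtain K where K: "N = Suc K" using N by (cases N) auto
    have "(\<Sum>k\<le>K. of_nat (Suc N choose k) * w k) = 0"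
      by (intro sum.neutral) (auto simp: w_def K)
    then have "(\<Sum>k\<le>N. of_nat (Suc N choose k) * w k) = of_nat (Suc N choose N) * w N"
      by (simp add: K del: binomial_Suc_Suc)
    moreover have "Suc N choose N = Suc N" by (simp add: binomial_symmetric[of N "Suc N"])
    ultimately show ?thesis
      by (simp add: w_def del: binomial_Suc_Suc)
  qed
  finally show ?thesis .
qed

text \<open>The class of G_m is transcendental over the integers: a nonzero difference of the two
  polynomials would vanish at \<open>q - 1\<close> for every prime \<open>q\<close>, an infinite set
  of integers.\<close>

lemma K0_eq_poly_eq:
  assumes eq: "(\<Sum>k\<le>d. of_int (a k) * gen Gm ^ k) \<approx> (\<Sum>k\<le>e. of_int (b k) * gen Gm ^ k)"
  shows "(\<Sum>k\<le>d. monom (a k) k) = (\<Sum>k\<le>e. monom (b k) k)"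
proof (rule ccontr)
  let ?P = "\<Sum>k\<le>d. monom (a k) k" and ?R = "\<Sum>k\<le>e. monom (b k) k"
  assume "?P \<noteq> ?R"
  then have "finite {x. poly (?P - ?R) x = 0}"
    by (intro poly_roots_finite) simp
  moreover have "(\<lambda>q. int (q - 1)) ` {q. prime q} \<subseteq> {x. poly (?P - ?R) x = 0}"
  proof (intro image_subsetI)
    fix q :: nat assume "q \<in> {q. prime q}"
    then have q: "prime q" by simp
    have "poly ?P (int (q - 1)) = poly ?R (int (q - 1))"
      using K0_eq_point_count[OF eq q] by (simp add: point_count_Gm[OF q] poly_sum poly_monom)
    then show "int (q - 1) \<in> {x. poly (?P - ?R) x = 0}" by simp
  qed
  moreover have "infinite ((\<lambda>q. int (q - 1)) ` {q::nat. prime q})"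
  proof
    assume fin: "finite ((\<lambda>q. int (q - 1)) ` {q::nat. prime q})"
    have "inj_on (\<lambda>q. int (q - 1)) {q::nat. prime q}"
      by (intro inj_onI) (auto dest!: prime_ge_1_nat)
    from finite_imageD[OF fin this] show False using primes_infinite by simp
  qed
  ultimately show False using finite_subset by blast
qed

text \<open>The negative coefficient of the complement sits at exponent \<open>n - 4\<close>, which
  needs \<open>n \<ge> 4\<close>. For n = 1, 2, 3 the complement has class 1, T + 1 and T^2 + 2 T +
  1, all of them effective.\<close>

theorem lemma3p8:
  fixes n :: nat
  assumes "n \<ge> 1"
  shows "effective_in_T (K0_class (graph_hypersurface (banana n))) \<and>
    (n \<ge> 4 \<longrightarrow> \<not> effective_in_T (K0_class (graph_complement (banana n))))"
proof (intro conjI impI notI)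
  obtain N where n: "n = Suc N" using assms by (cases n) auto
  define c where "c j = (-1) ^ (N - 1 - j) + (if Suc j < N then int (Suc N choose Suc j) else 0)" for j
  \<comment> \<open>Below the top exponent the binomial coefficient is at least 1 and absorbs a sign
    -1; at \<open>j = N - 1\<close> there is no binomial term, but the sign is +1.\<close>
  have c: "c j \<ge> 0" if "j < N" for j
  proof (cases "Suc j < N")
    case True
    then have "(Suc N choose Suc j) > 0" by (intro zero_less_binomial) simp
    moreover have "(-1 :: int) ^ (N - 1 - j) \<ge> -1"
      by (cases "even (N - 1 - j)") auto
    ultimately show ?thesis unfolding c_def if_P[OF True] by linarith
  next
    case False
    then have "N - 1 - j = 0" using that by simp
    then show ?thesis using False by (simp add: c_def)
  qed
  have "gen (graph_hypersurface (banana n)) \<approx> (\<Sum>j<N. of_int (c j) * gen Gm ^ j)"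
    using class_banana_hypersurface[of N] by (simp only: n c_def)
  \<comment> \<open>\<open>effective_in_T\<close> sums over a range \<open>{..d}\<close>; the extra
    exponent \<open>N\<close> gets coefficient 0, which also covers the empty sum for
    \<open>N = 0\<close>.\<close>
  also have "(\<Sum>j<N. of_int (c j) * gen Gm ^ j) = (\<Sum>j\<le>N. of_nat (if j < N then nat (c j) else 0) * gen Gm ^ j)"
  proof -
    have "(\<Sum>j<N. of_int (c j) * gen Gm ^ j) = (\<Sum>j<N. of_nat (if j < N then nat (c j) else 0) * gen Gm ^ j)"
      using c by (intro sum.cong refl) simp
    then show ?thesis by (simp add: lessThan_Suc_atMost[symmetric])
  qed
  finally show "effective_in_T (K0_class (graph_hypersurface (banana n)))"
    unfolding effective_in_T_iff by (intro exI)
  assume "n \<ge> 4" and "effective_in_T (K0_class (graph_complement (banana n)))"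
  then have N: "N \<ge> 3"
    and "\<exists>d (a :: nat \<Rightarrow> nat). gen (graph_complement (banana n)) \<approx> (\<Sum>k\<le>d. of_nat (a k) * gen Gm ^ k)"
    by (simp_all add: n effective_in_T_iff)
  then obtain d and a :: "nat \<Rightarrow> nat"
    where a: "gen (graph_complement (banana n)) \<approx> (\<Sum>k\<le>d. of_nat (a k) * gen Gm ^ k)" by blast
  \<comment> \<open>The coefficients of the complement: 1 at \<open>N\<close>, then the negated
    alternating signs, with the \<open>Suc N\<close> strata having one vanishing coordinate added at
    \<open>N - 1\<close>.\<close>
  define b where "b k = (if k = N then 1 else - ((-1) ^ (N - 1 - k)) + (if k = N - 1 then int (Suc N) else 0))" for k
  have "(\<Sum>k\<le>N. of_int (b k) * gen Gm ^ k) =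
      gen Gm ^ N - alternating N (gen Gm) + of_nat (Suc N) * gen Gm ^ (N - 1)"
  proof -
    have "(\<Sum>k<N. of_int (b k) * gen Gm ^ k) =
        (\<Sum>k<N. (if k = N - 1 then of_nat (Suc N) * gen Gm ^ k else 0) - (-1) ^ (N - 1 - k) * gen Gm ^ k)"
      by (intro sum.cong refl) (auto simp: b_def algebra_simps)
    also have "\<dots> = - alternating N (gen Gm) + of_nat (Suc N) * gen Gm ^ (N - 1)"
      using N by (simp add: sum_subtractf alternating_def)
    finally show ?thesis
      by (simp add: lessThan_Suc_atMost[symmetric] b_def)
  qed
  then have "(\<Sum>k\<le>N. of_int (b k) * gen Gm ^ k) \<approx> (\<Sum>k\<le>d. of_int (int (a k)) * gen Gm ^ k)"
    using K0_eq_trans[OF K0_eq_sym[OF class_banana_complement] a[unfolded n]] N by simp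
  from K0_eq_poly_eq[OF this]
  have "coeff (\<Sum>k\<le>N. monom (b k) k) (N - 3) = coeff (\<Sum>k\<le>d. monom (int (a k)) k) (N - 3)"
    by simp
  moreover have "coeff (\<Sum>k\<le>N. monom (b k) k) (N - 3) = b (N - 3)"
    by (simp add: coeff_sum coeff_monom)
  moreover have "coeff (\<Sum>k\<le>d. monom (int (a k)) k) (N - 3) \<ge> 0"
    by (simp add: coeff_sum coeff_monom sum_nonneg)
  \<comment> \<open>Since \<open>N - 1 - (N - 3) = 2\<close>, the alternating sum has coefficient +1
    here and is subtracted; the term \<open>Suc N\<close> sits two exponents higher.\<close>
  moreover have "b (N - 3) = -1"
  proof -
    obtain M where "N = M + 3" using N le_Suc_ex[of 3 N] by (auto simp: add.commute)
    then show ?thesis by (simp add: b_def)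
  qed
  ultimately show False by simp
qed

end
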